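(* Let $T=\{t_n\}_{n\ge1}$ satisfy one of the conditions $\mathbf{Z}$, $\mathbf{\Pi}$ or $\mathbf{A_\gamma}$ (defined in the context). Assume that $F$ is an entire function such that $F=\mathcal{C}_{a,k}/\mathcal{C}_{b,m}$, where $\mathcal{C}_{a,k}$ and $\mathcal{C}_{b,m}$ are regularized Cauchy transforms with poles in $T$ (with $\mathcal{C}_{b,m}\not\equiv 0$). Then $F$ is of finite exponential type. Moreover: (1) in cases $\mathbf{Z}$ and $\mathbf{A_\gamma}$, $F$ is of zero exponential type; (2) in cases $\mathbf{\Pi}$ and $\mathbf{A_\gamma}$, $F$ is of Cartwright class with respect to some line, i.e. there exist $c\in\mathbb{C}$ and $u\in\mathbb{C}$ with $|u|=1$ such that $z\mapsto F(uz+c)$ is of Cartwright class.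
   Context: Standing assumptions: $T=\{t_n\}\subset\mathbb{C}$ consists of pairwise distinct points, $0\notin T$, and $|t_n|\to\infty$. For an integer $k\ge0$ and a complex sequence $a=\{a_n\}$ with $\sum_n |t_n|^{-k-1}|a_n|<\infty$, the regularized Cauchy transform with poles in $T$ is $$\mathcal{C}_{a,k}(z)=\sum_n a_n\Big(\frac{1}{z-t_n}+\frac1{t_n}+\dots+\frac{z^{k-1}}{t_n^k}\Big)=z^k\sum_n\frac{a_n}{t_n^k(z-t_n)}$$ (for $k=0$ this is $\sum_n a_n/(z-t_n)$). An entire function $F$ is of Cartwright class if it is of finite exponential type and $\int_{\mathbb{R}}\frac{\log^+|F(x)|}{1+x^2}dx<\infty$. $T$ has finite convergence exponent if $\sum_n|t_n|^{-K}<\infty$ for some $K>0$; the convergence exponent is the infimum of such $K$. Conditions: $\mathbf{Z}$: $T$ is the zero set of some entire function of zero exponential type. $\mathbf{\Pi}$: $T$ lies in some strip (a set of points at distance at most $h$ from some line, $h>0$) and has finite convergence exponent. $\mathbf{A_\gamma}$ ($0<\gamma<1$): $T$ lies in some angle $\{\theta_0<\arg z<\theta_0+\pi\gamma\}$ and the convergence exponent of $T$ is strictly less than $\gamma^{-1}$. *)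

theory Defs
  imports "HOL-Analysis.Analysis"
begin

definition admissible_seq :: "(nat \<Rightarrow> complex) \<Rightarrow> bool" where
  "admissible_seq t \<longleftrightarrow> inj t \<and> (\<forall>n. t n \<noteq> 0) \<and>
     filterlim (\<lambda>n. norm (t n)) at_top sequentially"

definition cauchy_coeff_ok :: "(nat \<Rightarrow> complex) \<Rightarrow> nat \<Rightarrow> (nat \<Rightarrow> complex) \<Rightarrow> bool" where
  "cauchy_coeff_ok t k a \<longleftrightarrow> summable (\<lambda>n. norm (a n) / norm (t n) ^ (k + 1))"

text \<open>Regularized Cauchy transform  C_{a,k}(z) = z^k * sum_n a_n / (t_n^k (z - t_n)),
  meaningful for z not in T.\<close>
definition reg_cauchy :: "(nat \<Rightarrow> complex) \<Rightarrow> (nat \<Rightarrow> complex) \<Rightarrow> nat \<Rightarrow> complex \<Rightarrow> complex" where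
  "reg_cauchy t a k z = z ^ k * (\<Sum>n. a n / (t n ^ k * (z - t n)))"

definition finite_exp_type :: "(complex \<Rightarrow> complex) \<Rightarrow> bool" where
  "finite_exp_type F \<longleftrightarrow> (\<exists>A B. \<forall>z. norm (F z) \<le> A * exp (B * norm z))"

definition zero_exp_type :: "(complex \<Rightarrow> complex) \<Rightarrow> bool" where
  "zero_exp_type F \<longleftrightarrow> (\<forall>\<epsilon>>0. \<exists>A. \<forall>z. norm (F z) \<le> A * exp (\<epsilon> * norm z))"

definition cartwright :: "(complex \<Rightarrow> complex) \<Rightarrow> bool" where
  "cartwright F \<longleftrightarrow> F holomorphic_on UNIV \<and> finite_exp_type F \<and>
     integrable lborel (\<lambda>x::real. max 0 (ln (norm (F (of_real x)))) / (1 + x\<^sup>2))"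

definition finite_conv_exponent :: "(nat \<Rightarrow> complex) \<Rightarrow> bool" where
  "finite_conv_exponent t \<longleftrightarrow> (\<exists>K>0. summable (\<lambda>n. norm (t n) powr (- K)))"

text \<open>Convergence exponent (infimum, in the extended reals; \<infinity> if no K works).\<close>
definition conv_exponent :: "(nat \<Rightarrow> complex) \<Rightarrow> ereal" where
  "conv_exponent t = Inf {ereal K | K. K > 0 \<and> summable (\<lambda>n. norm (t n) powr (- K))}"

definition cond_Z :: "(nat \<Rightarrow> complex) \<Rightarrow> bool" where
  "cond_Z t \<longleftrightarrow> (\<exists>G. G holomorphic_on UNIV \<and> zero_exp_type G \<and> {z. G z = 0} = range t)"

definition cond_Pi :: "(nat \<Rightarrow> complex) \<Rightarrow> bool" where
  "cond_Pi t \<longleftrightarrow> (\<exists>p u h. u \<noteq> 0 \<and> h > 0 \<and>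
       (\<forall>n. \<exists>s::real. norm (t n - (p + of_real s * u)) \<le> h)) \<and> finite_conv_exponent t"

definition cond_A :: "real \<Rightarrow> (nat \<Rightarrow> complex) \<Rightarrow> bool" where
  "cond_A \<gamma> t \<longleftrightarrow> (\<exists>\<theta>0. \<forall>n. \<exists>r \<theta>. r > 0 \<and> \<theta>0 < \<theta> \<and> \<theta> < \<theta>0 + pi * \<gamma> \<and>
       t n = of_real r * cis \<theta>) \<and> conv_exponent t < ereal (1 / \<gamma>)"

end

theory Submission
  imports Defs "HOL-Complex_Analysis.Complex_Analysis"
begin

text \<open>Write \<open>F = A / B\<close> with \<open>A\<close>, \<open>B\<close> the two Cauchy transforms. At a distance from the poles both are
  polynomially bounded. On a disc, \<open>ln (1 + |F|) \<le> ln (|A| + |B|) - ln |B|\<close>, and Jensen's inequality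
  bounds the mean of \<open>- ln |B|\<close> over the circle by its value at the centre; Harnack's inequality
  carries this over to the other points. Applied to large circles that avoid the poles (which are
  removed from \<open>B\<close> by a polynomial factor), this shows that \<open>ln |F|\<close> grows no faster than the
  integrated counting function of \<open>T\<close>; the latter is \<open>o(r)\<close> in case \<open>Z\<close>, by Jensen's
  inequality again, and of finite order otherwise. Applied to half-planes free of poles, it
  gives \<open>ln |F(z)| = O((1 + |z|)\<^sup>2 / Re z)\<close> and the integrability of \<open>ln (1 + |F|)\<close> over the boundary
  with respect to harmonic measure, that is, the Cartwright condition. In case \<open>A\<close> the complement
  of the angle has an opening larger than \<open>\<pi>\<close>, so mapping it to a half-plane by a power yields
  \<open>ln |F(z)| = O(|z| powr \<sigma>)\<close> with \<open>\<sigma> < 1\<close>. The Phragmen-Lindelof principle extends these bounds to the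
  remaining sectors.\<close>

section \<open>Harmonic majorants on the disc\<close>

text \<open>The basic inequality needs upper bounds for \<open>A\<close> and \<open>B\<close> on a
  boundary curve and a lower bound for \<open>B\<close> at a single point only. The identity theorem
  supplies such a point in every pole-free open set, so the zeros of \<open>B\<close> never have to
  be controlled. The function to be majorized is \<open>ln (1 + |F|)\<close> rather than
  \<open>ln |F|\<close>, because Harnack's inequality and the integrability argument both use
  nonnegativity.

  On a half-plane Harnack's inequality costs the factor \<open>(1 + |z|)\<^sup>2 / Re z\<close>. It
  is linear in \<open>|z|\<close> in closed sectors inside the half-plane, but worthless near the
  boundary line, so thin sectors containing T are left over. Closing them by Phragmen-Lindelof takes
  an a priori finite order \<open>K\<close>, which is what the large circles provide, and a
  half-opening \<eta> with \<open>K * \<eta> < pi / 2\<close>. Around a strip \<eta> can be taken as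
  small as needed. Around an angle of opening \<open>pi * \<gamma>\<close> it must exceed
  \<open>pi * \<gamma> / 2\<close>, and a convergence exponent below \<open>1 / \<gamma>\<close> is
  exactly what leaves room for this.\<close>

lemma real_polynomial_function_on_circle:
  fixes p :: "complex \<Rightarrow> real"
  assumes "real_polynomial_function p"
  shows "\<exists>n (g :: complex poly). \<forall>w. norm w = 1 \<longrightarrow> w ^ n * of_real (p w) = poly g w"
  using assms
proof (induction p rule: real_polynomial_function.induct)
  case (linear f)
  interpret bounded_linear f by fact
  have f: "f w = Re w * f 1 + Im w * f \<i>" for w
  proof -
    have "f w = f (Re w *\<^sub>R 1 + Im w *\<^sub>R \<i>)"
      by (metis complex_eq scaleR_conv_of_real mult.commute mult.right_neutral)
    then show ?thesis by (simp only: add scaleR real_scaleR_def)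
  qed
  \<comment> \<open>On the circle \<open>cnj w = 1 / w\<close>, hence
    \<open>w * Re w = (w\<^sup>2 + 1) / 2\<close> and
    \<open>w * Im w = - \<i> * (w\<^sup>2 - 1) / 2\<close>. The coefficients are collected from
    \<open>f w = Re w * f 1 + Im w * f \<i>\<close>.\<close>
  let ?g = "[: (f 1 + \<i> * f \<i>) / 2, 0, (f 1 - \<i> * f \<i>) / 2 :]"
  have "w ^ 1 * of_real (f w) = poly ?g w" if "norm w = 1" for w
  proof -
    have "w * cnj w = 1" using that by (simp add: complex_norm_square[symmetric])
    then have "w * of_real (Re w) = (w\<^sup>2 + 1) / 2" "w * of_real (Im w) = - \<i> * (w\<^sup>2 - 1) / 2"
      by (simp_all add: complex_eq_iff power2_eq_square field_simps)
    moreover have "w * of_real (f w) = (w * of_real (Re w)) * f 1 + (w * of_real (Im w)) * f \<i>"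
      by (subst f) (simp add: algebra_simps)
    ultimately show ?thesis by (simp only:) (simp add: field_simps power2_eq_square)
  qed
  then show ?case by blast
next
  case (const c)
  show ?case by (rule exI[of _ 0], rule exI[of _ "[:of_real c:]"]) simp
next
  case (add p q)
  then obtain n m and g h :: "complex poly" where
    *: "norm w = 1 \<Longrightarrow> w ^ n * of_real (p w) = poly g w" "norm w = 1 \<Longrightarrow> w ^ m * of_real (q w) = poly h w" for w
    by metis
  have "w ^ (n + m) * of_real (p w + q w) = poly (monom 1 m * g + monom 1 n * h) w" if "norm w = 1" for w
    using *[OF that, symmetric] by (simp add: poly_monom power_add algebra_simps)
  then show ?case by blast
next
  case (mult p q)
  then obtain n m and g h :: "complex poly" where
    *: "norm w = 1 \<Longrightarrow> w ^ n * of_real (p w) = poly g w" "norm w = 1 \<Longrightarrow> w ^ m * of_real (q w) = poly h w" for w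
    by metis
  have "w ^ (n + m) * of_real (p w * q w) = poly (g * h) w" if "norm w = 1" for w
    using *[OF that, symmetric] by (simp add: power_add algebra_simps)
  then show ?case by blast
qed

text \<open>On the circle \<open>p\<close> is a Laurent polynomial in \<open>w\<close>. A negative
  power is the conjugate of a positive one there, so conjugating such a term leaves its real part
  unchanged and turns the sum into an ordinary polynomial.\<close>

lemma real_polynomial_function_on_circle_eq_Re:
  fixes p :: "complex \<Rightarrow> real"
  assumes "real_polynomial_function p"
  shows "\<exists>h. h holomorphic_on UNIV \<and> (\<forall>w. norm w = 1 \<longrightarrow> p w = Re (h w))"
proof -
  obtain n and g :: "complex poly" where g: "norm w = 1 \<Longrightarrow> w ^ n * of_real (p w) = poly g w" for w
    using real_polynomial_function_on_circle[OF assms] by blast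
  define h where "h = (\<lambda>w. \<Sum>j\<le>degree g. if n \<le> j then coeff g j * w ^ (j - n) else cnj (coeff g j) * w ^ (n - j))"
  have "p w = Re (h w)" if w: "norm w = 1" for w
  proof -
    have wc: "w * cnj w = 1" using w by (simp add: complex_norm_square[symmetric])
    have "of_real (p w) = cnj w ^ n * (w ^ n * of_real (p w))"
      using wc by (simp add: power_mult_distrib[symmetric] mult.assoc[symmetric] mult.commute)
    also have "\<dots> = (\<Sum>j\<le>degree g. coeff g j * (w ^ j * cnj w ^ n))"
      unfolding g[OF w] poly_altdef by (simp add: sum_distrib_left mult_ac)
    finally have "p w = (\<Sum>j\<le>degree g. Re (coeff g j * (w ^ j * cnj w ^ n)))"
      by (metis Re_complex_of_real Re_sum)
    also have "\<dots> = (\<Sum>j\<le>degree g. Re (if n \<le> j then coeff g j * w ^ (j - n) else cnj (coeff g j) * w ^ (n - j)))"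
    proof (rule sum.cong[OF refl])
      fix j
      show "Re (coeff g j * (w ^ j * cnj w ^ n)) =
        Re (if n \<le> j then coeff g j * w ^ (j - n) else cnj (coeff g j) * w ^ (n - j))"
      proof (cases "n \<le> j")
        case True
        then have "w ^ j * cnj w ^ n = w ^ (j - n) * (w * cnj w) ^ n"
          by (simp add: power_mult_distrib mult.assoc[symmetric] power_add[symmetric])
        with True wc show ?thesis by simp
      next
        case False
        then have "w ^ j * cnj w ^ n = (w * cnj w) ^ j * cnj w ^ (n - j)"
          by (simp add: power_mult_distrib mult.assoc power_add[symmetric])
        with False wc have "coeff g j * (w ^ j * cnj w ^ n) = cnj (cnj (coeff g j) * w ^ (n - j))" by simp
        with False show ?thesis by (metis cnj.simps(1))
      qed
    qed
    finally show ?thesis by (simp add: h_def)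
  qed
  moreover have "h holomorphic_on UNIV"
    unfolding h_def
  proof (intro holomorphic_on_sum)
    fix j
    show "(\<lambda>w. if n \<le> j then coeff g j * w ^ (j - n) else cnj (coeff g j) * w ^ (n - j)) holomorphic_on UNIV"
      by (cases "n \<le> j") (auto intro!: holomorphic_intros)
  qed
  ultimately show ?thesis by blast
qed

text \<open>The Dirichlet problem solved up to \<epsilon>. Since \<open>h\<close> is entire, its
  real part is harmonic across the circle, and neither Poisson kernels nor boundary limits are
  needed afterwards.\<close>

lemma continuous_on_circle_approx_Re:
  fixes u :: "complex \<Rightarrow> real"
  assumes "continuous_on (sphere 0 1) u" "0 < \<epsilon>"
  obtains h where "h holomorphic_on UNIV" "\<And>w. norm w = 1 \<Longrightarrow> \<bar>u w - Re (h w)\<bar> < \<epsilon>"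
proof -
  obtain p where p: "real_polynomial_function p" "\<And>w. w \<in> sphere 0 1 \<Longrightarrow> \<bar>u w - p w\<bar> < \<epsilon>"
    using Stone_Weierstrass_real_polynomial_function[OF compact_sphere assms] by blast
  with real_polynomial_function_on_circle_eq_Re[OF p(1)] that show ?thesis
    by (metis mem_sphere_0)
qed

lemma norm_le_on_disc:
  assumes "f holomorphic_on cball 0 1" "\<And>w. norm w = 1 \<Longrightarrow> norm (f w) \<le> B" "norm z < 1"
  shows "norm (f z) \<le> B"
proof (rule maximum_modulus_frontier[of f "cball 0 1"])
  show "f holomorphic_on interior (cball 0 1)"
    using assms(1) by (rule holomorphic_on_subset) auto
  show "continuous_on (closure (cball 0 1)) f"
    using assms(1) by (simp add: holomorphic_on_imp_continuous_on)
qed (use assms in auto)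

text \<open>The maximum principle for the subharmonic function \<open>ln |f| - Re h\<close>, in
  multiplicative form so that zeros of \<open>f\<close> need no separate treatment.\<close>

lemma norm_mult_exp_le_on_disc:
  assumes "f holomorphic_on cball 0 1" "h holomorphic_on UNIV"
    and "\<And>w. norm w = 1 \<Longrightarrow> norm (f w) \<le> exp (Re (h w))" "norm z < 1"
  shows "norm (f z) \<le> exp (Re (h z))"
proof -
  have h: "h holomorphic_on cball 0 1" using assms(2) by (rule holomorphic_on_subset) simp
  have "norm (f z * exp (- h z)) \<le> 1"
  proof (rule norm_le_on_disc[where f = "\<lambda>z. f z * exp (- h z)"])
    show "(\<lambda>z. f z * exp (- h z)) holomorphic_on cball 0 1"
      using assms(1) h by (intro holomorphic_intros)
    show "norm (f w * exp (- h w)) \<le> 1" if "norm w = 1" for w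
      using assms(3)[OF that] by (simp add: norm_mult norm_exp_eq_Re exp_minus field_simps norm_divide)
  qed fact
  then show ?thesis by (simp add: norm_mult norm_exp_eq_Re exp_minus field_simps norm_divide)
qed

text \<open>For positive real part and \<open>a = h 0\<close>, the quotient
  \<open>(h - a) / (h + cnj a)\<close> maps the disc into itself and fixes 0, so the Schwarz lemma
  bounds it by \<open>norm z\<close>; solving for the real part gives the claim.\<close>

lemma Harnack_disc:
  assumes h: "h holomorphic_on UNIV" and pos: "\<And>w. norm w = 1 \<Longrightarrow> 0 \<le> Re (h w)" and z: "norm z < 1"
  shows "Re (h z) \<le> (1 + norm z) / (1 - norm z) * Re (h 0)"
proof -
  have nonneg: "0 \<le> Re (h w)" if "norm w < 1" for w
    using norm_mult_exp_le_on_disc[of "\<lambda>_. 1" h w] h pos that by simp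
  have main: "Re (g z) \<le> (1 + norm z) / (1 - norm z) * Re (g 0)"
    if g: "g holomorphic_on UNIV" "\<And>w. norm w < 1 \<Longrightarrow> 0 < Re (g w)" for g
  proof -
    define a where "a = g 0"
    have a: "0 < Re a" using g(2)[of 0] by (simp add: a_def)
    have nz: "g w + cnj a \<noteq> 0" if "norm w < 1" for w
      using g(2)[OF that] a by (auto simp: complex_eq_iff)
    have n1: "norm ((g w - a) / (g w + cnj a)) < 1" if "norm w < 1" for w
    proof -
      have "(norm (g w - a))\<^sup>2 < (norm (g w + cnj a))\<^sup>2"
        using g(2)[OF that] a unfolding cmod_power2 
        by (simp add: power2_eq_square algebra_simps)
      then have "norm (g w - a) < norm (g w + cnj a)"
        by (rule power_less_imp_less_base) simp
      then show ?thesis using nz[OF that] by (simp add: norm_divide)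
    qed
    have "norm ((g z - a) / (g z + cnj a)) \<le> norm z"
    proof (rule Schwarz_Lemma(1)[where f = "\<lambda>w. (g w - a) / (g w + cnj a)"])
      have "g holomorphic_on ball 0 1" using g(1) by (rule holomorphic_on_subset) simp
      then show "(\<lambda>w. (g w - a) / (g w + cnj a)) holomorphic_on ball 0 1"
        using nz by (auto intro!: holomorphic_intros)
    qed (use n1 z a_def in auto)
    then have *: "norm (g z - a) \<le> norm z * norm (g z + cnj a)"
      using nz[OF z] by (simp add: norm_divide field_simps)
    define s where "s = norm z"
    have s: "0 \<le> s" "s < 1" using z by (auto simp: s_def)
    define x y where "x = Re (g z)" and "y = Im (g z) - Im a"
    have "(norm (g z - a))\<^sup>2 \<le> s\<^sup>2 * (norm (g z + cnj a))\<^sup>2"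
      using power_mono[OF *, of 2] by (simp add: s_def power_mult_distrib)
    then have "(x - Re a)\<^sup>2 + y\<^sup>2 \<le> s\<^sup>2 * ((x + Re a)\<^sup>2 + y\<^sup>2)"
      by (simp add: cmod_power2 x_def y_def)
    moreover have "s\<^sup>2 * y\<^sup>2 \<le> y\<^sup>2"
      using s by (simp add: mult_left_le_one_le power_le_one)
    ultimately have "(x - Re a)\<^sup>2 \<le> s\<^sup>2 * (x + Re a)\<^sup>2"
      unfolding distrib_left by linarith
    then have "(x - Re a)\<^sup>2 \<le> (s * (x + Re a))\<^sup>2"
      by (simp only: power_mult_distrib)
    moreover have "0 \<le> s * (x + Re a)" using s a g(2)[OF z] by (simp add: x_def)
    ultimately have "x - Re a \<le> s * (x + Re a)" by (rule power2_le_imp_le)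
    then have "x * (1 - s) \<le> (1 + s) * Re a" by (simp add: algebra_simps)
    then show ?thesis using s by (simp add: x_def[symmetric] s_def[symmetric] a_def[symmetric] field_simps)
  qed
  \<comment> \<open>\<open>main\<close> asks for a strictly positive real part, while the maximum
    principle only yields \<open>nonneg\<close>. A constant \<open>d\<close> is added; its
    contribution is the arbitrary error \<open>e\<close>.\<close>
  have "Re (h z) \<le> (1 + norm z) / (1 - norm z) * Re (h 0) + e" if "0 < e" for e
  proof -
    define d where "d = e * (1 - norm z) / (1 + norm z)"
    have "1 + norm z > 0" by (smt (verit) norm_ge_zero)
    then have d: "0 < d" "(1 + norm z) / (1 - norm z) * d = e"
      using that z by (auto simp: d_def)
    have "Re (h z + of_real d) \<le> (1 + norm z) / (1 - norm z) * Re (h 0 + of_real d)"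
    proof (rule main)
      show "(\<lambda>z. h z + of_real d) holomorphic_on UNIV" by (intro holomorphic_intros h)
    qed (use nonneg d in \<open>fastforce intro: add_nonneg_pos\<close>)
    then have "Re (h z) + d \<le> (1 + norm z) / (1 - norm z) * Re (h 0) + (1 + norm z) / (1 - norm z) * d"
      by (simp only: distrib_left plus_complex.sel Re_complex_of_real)
    with d show ?thesis by simp
  qed
  then show ?thesis by (rule field_le_epsilon)
qed

text \<open>Jensen's inequality for \<open>B\<close> bounds the mean of \<open>ln (1 + |f|) = ln (|B| + |f B|) - ln |B|\<close>
  over the circle. The harmonic function \<open>Re h\<close>, a polynomial approximation to the Poisson
  integral, replaces the mean, so that zeros of \<open>B\<close> on the circle cause no trouble.\<close>

lemma quotient_majorant_disc:
  assumes f: "f holomorphic_on cball 0 1" and B: "B holomorphic_on cball 0 1"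
    and B1: "\<And>w. norm w = 1 \<Longrightarrow> norm (B w) \<le> 1"
    and A1: "\<And>w. norm w = 1 \<Longrightarrow> norm (f w * B w) \<le> 1"
    and B0: "B 0 \<noteq> 0" and \<epsilon>: "0 < \<epsilon>"
  obtains h where "h holomorphic_on UNIV"
    "\<And>w. norm w = 1 \<Longrightarrow> ln (1 + norm (f w)) \<le> Re (h w)"
    "Re (h 0) \<le> ln (2 / norm (B 0)) + \<epsilon>"
proof -
  have "compact (f ` sphere 0 1)"
    by (intro compact_continuous_image compact_sphere continuous_on_subset[OF holomorphic_on_imp_continuous_on[OF f]])
       auto
  then obtain M where M: "0 < M" "\<And>w. norm w = 1 \<Longrightarrow> norm (f w) \<le> M"
    using compact_imp_bounded bounded_pos by (metis imageI mem_sphere_0)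
  \<comment> \<open>\<open>norm (B w)\<close> is cut off from below so that its logarithm is
    continuous on the circle. The level is such that wherever the cut-off acts,
    \<open>- ln \<delta> = ln (1 + M)\<close> already dominates
    \<open>ln (1 + norm (f w))\<close>.\<close>
  define \<delta> where "\<delta> = 1 / (1 + M)"
  define v where "v = (\<lambda>w. ln (max (norm (B w)) \<delta>))"
  have \<delta>: "0 < \<delta>" using M by (simp add: \<delta>_def)
  have "continuous_on (sphere 0 1) v"
    unfolding v_def using \<delta>
    by (intro continuous_intros continuous_on_subset[OF holomorphic_on_imp_continuous_on[OF B]]) auto
  then obtain g where g: "g holomorphic_on UNIV" "\<And>w. norm w = 1 \<Longrightarrow> \<bar>v w - Re (g w)\<bar> < \<epsilon> / 2"
    by (rule continuous_on_circle_approx_Re[of v "\<epsilon> / 2"]) (use \<epsilon> in auto)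
  have gv: "Re (g w) < v w + \<epsilon> / 2" "v w < Re (g w) + \<epsilon> / 2" if "norm w = 1" for w
    using g(2)[OF that] unfolding abs_less_iff by linarith+
  define h where "h = (\<lambda>w. of_real (ln 2 + \<epsilon> / 2) - g w)"
  show ?thesis
  proof
    show "h holomorphic_on UNIV" unfolding h_def by (intro holomorphic_intros g)
    show "ln (1 + norm (f w)) \<le> Re (h w)" if w: "norm w = 1" for w
    proof -
      have "ln (1 + norm (f w)) \<le> ln 2 - v w"
      proof (cases "\<delta> \<le> norm (B w)")
        case True
        then have pos: "norm (B w) > 0" using \<delta> by linarith
        have "(1 + norm (f w)) * norm (B w) \<le> 2"
          using A1[OF w] B1[OF w] by (simp add: norm_mult algebra_simps)
        then have "1 + norm (f w) \<le> 2 / norm (B w)" using pos by (simp add: field_simps)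
        then have "ln (1 + norm (f w)) \<le> ln (2 / norm (B w))"
          by (subst ln_le_cancel_iff) (use pos in \<open>auto intro: add_pos_nonneg\<close>)
        with True pos show ?thesis by (simp add: v_def ln_div)
      next
        case False
        have "ln (1 + norm (f w)) \<le> ln (1 + M)" using M(2)[OF w] M(1) by (simp add: add_pos_nonneg)
        moreover have "v w = - ln (1 + M)" using False M(1) by (simp add: v_def \<delta>_def ln_div)
        moreover have "0 < ln (2::real)" by simp
        ultimately show ?thesis by linarith
      qed
      with gv(1)[OF w] show ?thesis by (simp add: h_def)
    qed
    \<comment> \<open>Jensen's inequality at the centre: \<open>ln (norm (B w)) \<le> v w\<close> on
      the circle, and \<open>Re (g 0)\<close> stands for the mean of \<open>v\<close> up to an error
      below \<open>\<epsilon> / 2\<close>.\<close>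
    have "norm (B 0) \<le> exp (Re (g 0 + of_real (\<epsilon> / 2)))"
    proof (rule norm_mult_exp_le_on_disc[OF B, where h = "\<lambda>w. g w + of_real (\<epsilon> / 2)"])
      show "norm (B w) \<le> exp (Re (g w + complex_of_real (\<epsilon> / 2)))" if "norm w = 1" for w
      proof -
        have "norm (B w) \<le> exp (v w)" using \<delta> by (simp add: v_def)
        also have "\<dots> \<le> exp (Re (g w) + \<epsilon> / 2)" using gv(2)[OF that] by simp
        finally show ?thesis by simp
      qed
    qed (use g in \<open>auto intro!: holomorphic_intros\<close>)
    then have "ln (norm (B 0)) \<le> Re (g 0 + of_real (\<epsilon> / 2))"
      using B0 by (metis ln_exp ln_le_cancel_iff exp_gt_zero zero_less_norm_iff)
    then show "Re (h 0) \<le> ln (2 / norm (B 0)) + \<epsilon>"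
      using B0 by (simp add: h_def ln_div)
  qed
qed

text \<open>By the maximum principle \<open>ln |f|\<close> stays below the majorant
  \<open>Re h\<close> inside the disc. As \<open>ln (1 + |f|)\<close> is nonnegative, so is
  \<open>Re h\<close> on the circle, and Harnack's inequality reduces the bound at \<open>z\<close>
  to the value at the centre, the only place where the size of \<open>B\<close> enters.\<close>

lemma quotient_bound_disc:
  assumes f: "f holomorphic_on cball 0 1" and B: "B holomorphic_on cball 0 1"
    and B1: "\<And>w. norm w = 1 \<Longrightarrow> norm (B w) \<le> 1"
    and A1: "\<And>w. norm w = 1 \<Longrightarrow> norm (f w * B w) \<le> 1"
    and B0: "B 0 \<noteq> 0" and z: "norm z < 1"
  shows "norm (f z) \<le> exp ((1 + norm z) / (1 - norm z) * ln (2 / norm (B 0)))"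
proof (cases "f z = 0")
  case False
  define K where "K = (1 + norm z) / (1 - norm z)"
  have K: "K > 0" using z by (simp add: K_def add_pos_nonneg)
  have "ln (norm (f z)) \<le> K * ln (2 / norm (B 0)) + e" if e: "0 < e" for e
  proof -
    obtain h where h: "h holomorphic_on UNIV"
      "\<And>w. norm w = 1 \<Longrightarrow> ln (1 + norm (f w)) \<le> Re (h w)"
      "Re (h 0) \<le> ln (2 / norm (B 0)) + e / K"
      using quotient_majorant_disc[OF f B B1 A1 B0, of "e / K"] e K by (metis divide_pos_pos)
    have "norm (f z) \<le> exp (Re (h z))"
    proof (rule norm_mult_exp_le_on_disc[OF f h(1)])
      show "norm (f w) \<le> exp (Re (h w))" if "norm w = 1" for w
      proof -
        have "norm (f w) \<le> exp (ln (1 + norm (f w)))" by (simp add: add_pos_nonneg)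
        also have "\<dots> \<le> exp (Re (h w))" using h(2)[OF that] by simp
        finally show ?thesis .
      qed
    qed fact
    then have "ln (norm (f z)) \<le> Re (h z)" using False by (metis ln_exp ln_le_cancel_iff exp_gt_zero zero_less_norm_iff)
    also have "\<dots> \<le> K * Re (h 0)"
      unfolding K_def
    proof (rule Harnack_disc[OF h(1) _ z])
      show "0 \<le> Re (h w)" if "norm w = 1" for w
        using h(2)[OF that] by (smt (verit) ln_ge_zero norm_ge_zero)
    qed
    also have "\<dots> \<le> K * (ln (2 / norm (B 0)) + e / K)" using h(3) K by simp
    also have "\<dots> = K * ln (2 / norm (B 0)) + e" using K by (simp add: field_simps)
    finally show ?thesis .
  qed
  then have "ln (norm (f z)) \<le> K * ln (2 / norm (B 0))" by (rule field_le_epsilon)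
  then show ?thesis unfolding K_def[symmetric]
    using False by (metis exp_le_cancel_iff exp_ln zero_less_norm_iff)
qed simp

section \<open>Quotients of bounded functions on a half-plane\<close>

lemma mean_value_circle:
  assumes "h holomorphic_on cball 0 1"
  shows "((\<lambda>\<theta>. Re (h (cis (2 * pi * \<theta>)))) has_integral Re (h 0)) {0..1}"
proof -
  have "((\<lambda>u. h u / (u - 0)) has_contour_integral (2 * of_real pi * \<i> * h 0)) (circlepath 0 1)"
    by (rule Cauchy_integral_circlepath_simple[OF assms]) simp
  then have "((\<lambda>\<theta>. h (cis (2 * pi * \<theta>)) * (2 * of_real pi * \<i>)) has_integral (2 * of_real pi * \<i> * h 0)) {0..1}"
    unfolding has_contour_integral vector_derivative_circlepath
    by (simp add: circlepath cis_conv_exp mult_ac)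
  from has_integral_mult_left[OF this, of "1 / (2 * of_real pi * \<i>)"]
  have "((\<lambda>\<theta>. h (cis (2 * pi * \<theta>))) has_integral h 0) {0..1}"
    by (simp add: field_simps)
  from has_integral_linear[OF this bounded_linear_Re] show ?thesis by (simp add: o_def)
qed

lemma integrable_lborel_nonneg_bounded:
  fixes \<phi> :: "real \<Rightarrow> real"
  assumes cont: "continuous_on UNIV \<phi>" and nonneg: "\<And>x. 0 \<le> \<phi> x"
    and bound: "\<And>N. integral {- real N..real N} \<phi> \<le> C"
  shows "integrable lborel \<phi>"
proof -
  let ?f = "\<lambda>N x. indicator {- real N..real N} x *\<^sub>R \<phi> x"
  have int: "set_integrable lborel {- real N..real N} \<phi>" for N
    by (rule borel_integrable_atLeastAtMost') (rule continuous_on_subset[OF cont subset_UNIV])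
  then have f: "integrable lborel (?f N)" for N
    unfolding set_integrable_def .
  have "integral\<^sup>L lborel (?f N) = integral {- real N..real N} \<phi>" for N
    using set_borel_integral_eq_integral(2)[OF int] by (simp add: set_lebesgue_integral_def)
  then have le: "integral\<^sup>L lborel (?f N) \<le> C" for N using bound by simp
  have mono: "?f n x \<le> ?f m x" if "n \<le> m" for n m x
    using that nonneg[of x] by (auto simp: indicator_def)
  have "incseq (\<lambda>N. integral\<^sup>L lborel (?f N))"
    by (intro incseq_SucI integral_mono f mono) simp
  then obtain I where I: "(\<lambda>N. integral\<^sup>L lborel (?f N)) \<longlonglongrightarrow> I"
    using incseq_convergent[of "\<lambda>N. integral\<^sup>L lborel (?f N)" C] le by blast
  show ?thesis
  proof (rule integrable_monotone_convergence[OF f _ _ I])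
    show "AE x in lborel. mono (\<lambda>N. ?f N x)"
      by (intro always_eventually allI monoI mono)
    show "AE x in lborel. (\<lambda>N. ?f N x) \<longlonglongrightarrow> \<phi> x"
    proof (intro always_eventually allI)
      fix x
      obtain N0 where N0: "\<bar>x\<bar> \<le> real N0" using real_arch_simple by blast
      have "eventually (\<lambda>N. ?f N x = \<phi> x) sequentially"
        using eventually_ge_at_top[of N0]
      proof eventually_elim
        case (elim N)
        then have "\<bar>x\<bar> \<le> real N" using N0 by linarith
        then have "x \<in> {- real N..real N}" by auto
          then show ?case by simp
      qed
      then show "(\<lambda>N. ?f N x) \<longlonglongrightarrow> \<phi> x" by (rule tendsto_eventually)
    qed
    show "\<phi> \<in> borel_measurable lborel"
      using borel_measurable_continuous_onI[OF cont] by simp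
  qed
qed

lemma Cayley_Re_pos:
  assumes "norm w < 1"
  shows "0 < Re ((1 + w) / (1 - w))"
proof -
  have "w \<noteq> 1" using assms by auto
  then have "0 < (norm (1 - w))\<^sup>2" by simp
  moreover have "(Re w)\<^sup>2 + (Im w)\<^sup>2 < 1"
    using power_strict_mono[OF assms, of 2] by (simp add: cmod_power2)
  then have "0 < Re (1 + w) * Re (1 - w) + Im (1 + w) * Im (1 - w)"
    by (simp add: power2_eq_square algebra_simps)
  ultimately show ?thesis
    unfolding Re_divide cmod_power2 by (rule divide_pos_pos[rotated])
qed

text \<open>The Cayley transform moves the disc bound to the half-plane with centre 1. For the point
  \<open>w\<close> of the disc belonging to \<open>z\<close>, the Harnack factor is at most
  \<open>4 / (1 - (norm w)\<^sup>2)\<close>, which equals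
  \<open>(norm (z + 1))\<^sup>2 / Re z\<close>.\<close>

lemma quotient_bound_half_plane:
  assumes f: "f holomorphic_on {z. 0 < Re z}" and B: "B holomorphic_on {z. 0 < Re z}"
    and B1: "\<And>z. 0 < Re z \<Longrightarrow> norm (B z) \<le> 1"
    and A1: "\<And>z. 0 < Re z \<Longrightarrow> norm (f z * B z) \<le> 1"
    and B0: "B 1 \<noteq> 0" and z: "0 < Re z"
  shows "norm (f z) \<le> exp ((norm (z + 1))\<^sup>2 / Re z * ln (2 / norm (B 1)))"
proof -
  define w where "w = (z - 1) / (z + 1)"
  have z1: "z + 1 \<noteq> 0" using z by (auto simp: complex_eq_iff)
  have wz: "(1 + w) / (1 - w) = z" 
  proof -
    have "1 + w = 2 * z / (z + 1)" "1 - w = 2 / (z + 1)" using z1 by (simp_all add: w_def field_simps)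
    then show ?thesis using z1 by simp
  qed
  have n1: "1 - (norm w)\<^sup>2 = 4 * Re z / (norm (z + 1))\<^sup>2"
  proof -
    have "(norm (z + 1))\<^sup>2 - (norm (z - 1))\<^sup>2 = 4 * Re z"
      unfolding cmod_power2 by (simp add: power2_eq_square algebra_simps)
    moreover have "1 - (norm w)\<^sup>2 = ((norm (z + 1))\<^sup>2 - (norm (z - 1))\<^sup>2) / (norm (z + 1))\<^sup>2"
    proof -
      have "(norm w)\<^sup>2 = (norm (z - 1))\<^sup>2 / (norm (z + 1))\<^sup>2"
        by (simp add: w_def norm_divide power_divide)
      then show ?thesis using z1 by (simp add: diff_divide_distrib)
    qed
    ultimately show ?thesis by simp
  qed
  moreover have "0 < 4 * Re z / (norm (z + 1))\<^sup>2" using z z1 by simp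
  ultimately have "(norm w)\<^sup>2 < 1\<^sup>2" by (metis diff_gt_0_iff_gt one_power2)
  then have w: "norm w < 1" by (rule power_less_imp_less_base) simp
  define L where "L = ln (2 / norm (B 1))"
  have L: "0 \<le> L" using B1[of 1] B0 by (simp add: L_def)
  have hol: "(\<lambda>w. g ((1 + of_real r * w) / (1 - of_real r * w))) holomorphic_on cball 0 1"
    if "g holomorphic_on {z. 0 < Re z}" "0 < r" "r < 1" for g and r :: real
  proof -
    have lt: "norm (of_real r * w) < 1" if "norm w \<le> 1" for w :: complex
    proof -
      have "r * norm w \<le> r * 1" using that \<open>0 < r\<close> by (intro mult_left_mono) auto
      then have "r * norm w < 1" using \<open>r < 1\<close> by linarith
      then show ?thesis using \<open>0 < r\<close> by (simp add: norm_mult)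
    qed
    have "g \<circ> (\<lambda>w. (1 + of_real r * w) / (1 - of_real r * w)) holomorphic_on cball 0 1"
    proof (rule holomorphic_on_compose_gen[OF _ that(1)])
      have "1 - of_real r * w \<noteq> 0" if "norm w \<le> 1" for w :: complex using lt[OF that] by auto
      then show "(\<lambda>w. (1 + of_real r * w) / (1 - of_real r * w)) holomorphic_on cball 0 1"
        by (auto intro!: holomorphic_intros)
    qed (use lt Cayley_Re_pos in auto)
    then show ?thesis by (simp add: o_def)
  qed
  \<comment> \<open>The disc bound wants holomorphy on the closed disc, but \<open>f\<close> and
    \<open>B\<close> are only given in the open half-plane. It is therefore used on the circle of
    radius \<open>r < 1\<close>, and \<open>r\<close> tends to 1 at the end.\<close>
  have bd: "norm (f z) \<le> exp ((1 + norm w / r) / (1 - norm w / r) * L)" if r: "norm w < r" "r < 1" for r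
  proof -
    have r0: "0 < r" using r(1) by (smt (verit) norm_ge_zero)
    let ?\<psi> = "\<lambda>w. (1 + of_real r * w) / (1 - of_real r * w)"
    have lt: "norm (of_real r * v) < 1" if "norm v = 1" for v :: complex
      using that r r0 by (simp add: norm_mult)
    have "norm (f (?\<psi> (w / of_real r))) \<le> exp ((1 + norm (w / of_real r)) / (1 - norm (w / of_real r)) * ln (2 / norm (B (?\<psi> 0))))"
    proof (rule quotient_bound_disc[where f = "\<lambda>w. f (?\<psi> w)" and B = "\<lambda>w. B (?\<psi> w)"])
      show "norm (B (?\<psi> v)) \<le> 1" "norm (f (?\<psi> v) * B (?\<psi> v)) \<le> 1" if "norm v = 1" for v
        using A1 B1 Cayley_Re_pos[OF lt[OF that]] by auto
      show "norm (w / of_real r) < 1" using r r0 by (simp add: norm_divide)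
    qed (use hol[OF f r0 r(2)] hol[OF B r0 r(2)] B0 in auto)
    then show ?thesis using r0 wz by (simp add: norm_divide L_def)
  qed
  have "norm (f z) \<le> exp ((1 + norm w) / (1 - norm w) * L)"
  proof (rule tendsto_lowerbound)
    have "((\<lambda>r. exp ((1 + norm w / r) / (1 - norm w / r) * L)) \<longlongrightarrow> exp ((1 + norm w / 1) / (1 - norm w / 1) * L)) (at_left 1)"
      using w by (intro tendsto_intros) auto
    then show "((\<lambda>r. exp ((1 + norm w / r) / (1 - norm w / r) * L)) \<longlongrightarrow> exp ((1 + norm w) / (1 - norm w) * L)) (at_left 1)"
      by simp
    show "eventually (\<lambda>r. norm (f z) \<le> exp ((1 + norm w / r) / (1 - norm w / r) * L)) (at_left 1)"
      unfolding eventually_at_left_field using w bd by blast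
  qed simp
  also have "\<dots> \<le> exp ((norm (z + 1))\<^sup>2 / Re z * L)"
  proof -
    have "(1 + norm w) / (1 - norm w) = (1 + norm w)\<^sup>2 / (1 - (norm w)\<^sup>2)"
    proof -
      have "1 - (norm w)\<^sup>2 = (1 - norm w) * (1 + norm w)" by (simp add: power2_eq_square algebra_simps)
      moreover have "0 < 1 + norm w" by (simp add: add_pos_nonneg)
      ultimately show ?thesis by (simp add: power2_eq_square)
    qed
    also have "\<dots> \<le> 2\<^sup>2 / (1 - (norm w)\<^sup>2)"
      using w \<open>(norm w)\<^sup>2 < 1\<^sup>2\<close> by (intro divide_right_mono power_mono) auto
    also have "\<dots> = (norm (z + 1))\<^sup>2 / Re z" unfolding n1 using z z1 by (simp add: field_simps)
    finally show ?thesis using L unfolding exp_le_cancel_iff by (rule mult_right_mono)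
  qed
  finally show ?thesis by (simp add: L_def)
qed

text \<open>The means of \<open>ln (1 + |f|)\<close> over the Cayley images of the circles of radius
  \<open>r < 1\<close> are bounded by \<open>L\<close>. The substitution
  \<open>\<theta> = 1 / 2 + arctan x / pi\<close> turns them into integrals against
  \<open>dx / (pi * (1 + x\<^sup>2))\<close>. On a bounded interval of \<open>x\<close> the limit
  \<open>r = 1\<close> is harmless, as \<open>f\<close> is entire and \<open>x\<close> stays away
  from the point that goes to infinity; monotone convergence then covers the line.\<close>

lemma integrable_boundary_half_plane:
  assumes f: "f holomorphic_on UNIV" and B: "B holomorphic_on {z. 0 < Re z}"
    and B1: "\<And>z. 0 < Re z \<Longrightarrow> norm (B z) \<le> 1"
    and A1: "\<And>z. 0 < Re z \<Longrightarrow> norm (f z * B z) \<le> 1"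
    and B0: "B 1 \<noteq> 0"
  shows "integrable lborel (\<lambda>x. ln (1 + norm (f (- \<i> * of_real x))) / (1 + x\<^sup>2))"
proof -
  define u where "u = (\<lambda>z. ln (1 + norm (f z)))"
  have u0: "0 \<le> u z" for z by (simp add: u_def)
  have fc: "continuous_on UNIV f" using f by (rule holomorphic_on_imp_continuous_on)
  have uc: "continuous_on UNIV u"
    unfolding u_def by (intro continuous_intros fc) (smt (verit) norm_ge_zero)
  define L where "L = ln (2 / norm (B 1))"
  define \<psi> :: "complex \<Rightarrow> complex" where "\<psi> = (\<lambda>w. (1 + w) / (1 - w))"
  have lt: "norm (of_real r * v) < 1" if "norm v \<le> 1" "0 < r" "r < 1" for v :: complex and r
  proof -
    have "r * norm v \<le> r * 1" using that by (intro mult_left_mono) auto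
    then have "r * norm v < 1" using that by linarith
    then show ?thesis using that by (simp add: norm_mult)
  qed
  have \<psi>: "(\<lambda>w. \<psi> (of_real r * w)) holomorphic_on cball 0 1" "\<And>w. norm w \<le> 1 \<Longrightarrow> 0 < Re (\<psi> (of_real r * w))"
    if r: "0 < r" "r < 1" for r
  proof -
    have "1 - of_real r * w \<noteq> 0" if "norm w \<le> 1" for w :: complex using lt[OF that r] by auto
    then show "(\<lambda>w. \<psi> (of_real r * w)) holomorphic_on cball 0 1"
      unfolding \<psi>_def by (auto intro!: holomorphic_intros)
    show "0 < Re (\<psi> (of_real r * w))" if "norm w \<le> 1" for w
      unfolding \<psi>_def by (rule Cayley_Re_pos[OF lt[OF that r]])
  qed
  have circle_int: "(\<lambda>\<theta>. u (\<psi> (of_real r * cis (2 * pi * \<theta>)))) integrable_on {0..1}"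
    and circle_le: "integral {0..1} (\<lambda>\<theta>. u (\<psi> (of_real r * cis (2 * pi * \<theta>)))) \<le> L"
    and circle_cont: "continuous_on {0..1} (\<lambda>\<theta>. u (\<psi> (of_real r * cis (2 * pi * \<theta>))))"
    if r: "0 < r" "r < 1" for r
  proof -
    have fr: "(\<lambda>w. f (\<psi> (of_real r * w))) holomorphic_on cball 0 1"
      using holomorphic_on_compose_gen[OF \<psi>(1)[OF r] f] by (simp add: o_def)
    have Br: "(\<lambda>w. B (\<psi> (of_real r * w))) holomorphic_on cball 0 1"
      using holomorphic_on_compose_gen[OF \<psi>(1)[OF r] B] \<psi>(2)[OF r] by (force simp: o_def)
    show cont: "continuous_on {0..1} (\<lambda>\<theta>. u (\<psi> (of_real r * cis (2 * pi * \<theta>))))"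
    proof (rule continuous_on_compose2[OF uc])
      show "continuous_on {0..1} (\<lambda>\<theta>. \<psi> (complex_of_real r * cis (2 * pi * \<theta>)))"
        by (rule continuous_on_compose2[OF holomorphic_on_imp_continuous_on[OF \<psi>(1)[OF r]]])
           (auto intro!: continuous_intros)
    qed simp
    then show int: "(\<lambda>\<theta>. u (\<psi> (of_real r * cis (2 * pi * \<theta>)))) integrable_on {0..1}"
      by (rule integrable_continuous_real)
    show "integral {0..1} (\<lambda>\<theta>. u (\<psi> (of_real r * cis (2 * pi * \<theta>)))) \<le> L"
    proof (rule field_le_epsilon)
      fix e :: real assume e: "0 < e"
      obtain h where h: "h holomorphic_on UNIV"
        "\<And>w. norm w = 1 \<Longrightarrow> u (\<psi> (of_real r * w)) \<le> Re (h w)" "Re (h 0) \<le> L + e"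
      proof (rule quotient_majorant_disc[OF fr Br _ _ _ e])
        show "B (\<psi> (of_real r * 0)) \<noteq> 0" using B0 by (simp add: \<psi>_def)
        show "norm (B (\<psi> (of_real r * w))) \<le> 1" "norm (f (\<psi> (of_real r * w)) * B (\<psi> (of_real r * w))) \<le> 1"
          if "norm w = 1" for w using A1 B1 \<psi>(2)[OF r, of w] that by auto
      qed (auto simp: u_def L_def \<psi>_def)
      have "((\<lambda>\<theta>. Re (h (cis (2 * pi * \<theta>)))) has_integral Re (h 0)) {0..1}"
        by (rule mean_value_circle) (rule holomorphic_on_subset[OF h(1)], simp)
      then have "integral {0..1} (\<lambda>\<theta>. u (\<psi> (of_real r * cis (2 * pi * \<theta>)))) \<le> Re (h 0)"
        using has_integral_le[OF integrable_integral[OF int]] h(2) by (metis norm_cis)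
      with h(3) show "integral {0..1} (\<lambda>\<theta>. u (\<psi> (of_real r * cis (2 * pi * \<theta>)))) \<le> L + e" by simp
    qed
  qed
  \<comment> \<open>\<open>E x\<close> is the point of the circle with parameter \<open>x\<close>:
    its Cayley image is the boundary point \<open>- \<i> * x\<close>.\<close>
  define E where "E = (\<lambda>x::real. - ((1 + \<i> * of_real x) / (1 - \<i> * of_real x)))"
  have nz: "1 - \<i> * of_real x \<noteq> 0" "1 + \<i> * of_real x \<noteq> 0" for x by (auto simp: complex_eq_iff)
  have cisE: "cis (2 * pi * (1 / 2 + arctan x / pi)) = E x" for x
  proof -
    have s: "sqrt (1 + x\<^sup>2) \<noteq> 0" using sum_power2_gt_zero_iff[of 1 x] by simp
    have sq: "complex_of_real (sqrt (1 + x\<^sup>2)) ^ 2 = 1 + of_real x ^ 2"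
      by (metis of_real_1 of_real_add of_real_power real_sqrt_pow2 add_nonneg_nonneg zero_le_one zero_le_power2)
    have c: "cis (arctan x) = (1 + \<i> * of_real x) / of_real (sqrt (1 + x\<^sup>2))"
      by (simp add: complex_eq_iff cos_arctan sin_arctan)
    have "cis (2 * pi * (1 / 2 + arctan x / pi)) = cis (pi + (arctan x + arctan x))"
      by (rule arg_cong[of _ _ cis]) (simp add: distrib_left)
    also have "\<dots> = - (cis (arctan x) * cis (arctan x))"
      by (simp only: cis_mult[symmetric] cis_pi) simp
    also have "\<dots> = - ((1 + \<i> * of_real x)\<^sup>2 / (1 + of_real x ^ 2))"
      unfolding c using sq by (simp add: power2_eq_square)
    also have "1 + of_real x ^ 2 = (1 + \<i> * of_real x) * (1 - \<i> * of_real x)"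
      by (simp add: power2_eq_square algebra_simps)
    finally show ?thesis using nz[of x] by (simp add: E_def power2_eq_square)
  qed
  \<comment> \<open>With \<open>1 - \<i> * x\<close> cleared, the denominator vanishes for no
    \<open>r \<ge> 0\<close>. This form makes \<open>\<Phi>\<close> jointly continuous up to and
    including \<open>r = 1\<close>.\<close>
  have \<psi>E: "\<psi> (of_real r * E x) =
      ((1 - \<i> * of_real x) - of_real r * (1 + \<i> * of_real x)) / ((1 - \<i> * of_real x) + of_real r * (1 + \<i> * of_real x))" for r x
    using nz[of x] by (simp add: \<psi>_def E_def divide_simps)
  have dn: "(1 - \<i> * of_real x) + of_real r * (1 + \<i> * of_real x) \<noteq> 0" if "0 \<le> r" for r x
    using that by (auto simp: complex_eq_iff)
  define \<Phi> where "\<Phi> = (\<lambda>r x. u (\<psi> (of_real r * E x)) / (pi * (1 + x\<^sup>2)))"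
  have sq_pos: "0 < 1 + (x::real)\<^sup>2" for x by (simp add: add_pos_nonneg)
  have \<Phi>_le: "integral {- N..N} (\<Phi> r) \<le> L" if r: "0 < r" "r < 1" and N: "0 \<le> N" for r N
  proof -
    define g where "g = (\<lambda>x. 1 / 2 + arctan x / pi)"
    define v where "v = (\<lambda>\<theta>. u (\<psi> (of_real r * cis (2 * pi * \<theta>))))"
    have g01: "g x \<in> {0..1}" for x
      using arctan_bounded[of x] pi_gt_zero by (auto simp: g_def field_simps)
    have gN: "g (- N) \<le> g N" using N arctan_monotone'[of "-N" N] by (auto simp: g_def divide_right_mono)
    have "((\<lambda>x. (1 / (pi * (1 + x\<^sup>2))) *\<^sub>R v (g x)) has_integral integral {g (- N)..g N} v) {- N..N}"
    proof (rule has_integral_substitution)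
      show "continuous_on {0..1} v" using circle_cont[OF r] by (simp add: v_def)
      show "(g has_field_derivative 1 / (pi * (1 + x\<^sup>2))) (at x within {- N..N})" for x
      proof -
        have "(g has_field_derivative 0 + inverse (1 + x\<^sup>2) / pi) (at x within {- N..N})"
          unfolding g_def
          by (intro DERIV_add DERIV_const DERIV_cdivide has_field_derivative_at_within[OF DERIV_arctan])
        then show ?thesis by (simp add: inverse_eq_divide mult.commute)
      qed
    qed (use N gN g01 in auto)
    moreover have "(1 / (pi * (1 + x\<^sup>2))) *\<^sub>R v (g x) = \<Phi> r x" for x
      by (simp add: v_def g_def cisE \<Phi>_def)
    ultimately have "(\<Phi> r has_integral integral {g (- N)..g N} v) {- N..N}" by simp
    then have "integral {- N..N} (\<Phi> r) = integral {g (- N)..g N} v" by (rule integral_unique)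
    also have "\<dots> \<le> integral {0..1} v"
    proof (rule integral_subset_le)
      show "{g (- N)..g N} \<subseteq> {0..1}" using g01 by (metis atLeastAtMost_iff atLeastatMost_subset_iff)
      then show "v integrable_on {g (- N)..g N}"
        using circle_int[OF r] unfolding v_def by (rule integrable_on_subinterval[rotated])
    qed (use circle_int[OF r] u0 in \<open>auto simp: v_def\<close>)
    also have "\<dots> \<le> L" using circle_le[OF r] by (simp add: v_def)
    finally show ?thesis .
  qed
  have \<Phi>_cont: "continuous_on ({0..1} \<times> cbox (- N) N) (\<lambda>(r, x). \<Phi> r x)" for N :: real
    unfolding \<Phi>_def \<psi>E split_beta using dn sq_pos
    by (intro continuous_intros continuous_on_compose2[OF uc]) (auto simp: less_imp_neq[symmetric])
  have lim: "integral {- N..N} (\<Phi> 1) \<le> L" if N: "0 \<le> N" for N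
  proof -
    have "continuous_on {0..1} (\<lambda>r. integral (cbox (- N) N) (\<Phi> r))"
      by (rule integral_continuous_on_param[OF \<Phi>_cont])
    then have "((\<lambda>r. integral (cbox (- N) N) (\<Phi> r)) \<longlongrightarrow> integral (cbox (- N) N) (\<Phi> 1)) (at_left 1)"
      by (rule continuous_on_Icc_at_leftD) simp
    moreover have "eventually (\<lambda>r. integral (cbox (- N) N) (\<Phi> r) \<le> L) (at_left (1::real))"
      unfolding eventually_at_left_field using \<Phi>_le[OF _ _ N] by (auto intro!: exI[of _ 0])
    ultimately show ?thesis
      by (simp add: tendsto_upperbound)
  qed
  have \<psi>1: "\<psi> (of_real 1 * E x) = - \<i> * of_real x" for x
    unfolding \<psi>E by simp
  have "integrable lborel (\<Phi> 1)"
  proof (rule integrable_lborel_nonneg_bounded)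
    show "continuous_on UNIV (\<Phi> 1)"
      unfolding \<Phi>_def \<psi>1 using sq_pos
      by (intro continuous_intros continuous_on_compose2[OF uc]) (auto simp: less_imp_neq[symmetric])
    show "integral {- real N..real N} (\<Phi> 1) \<le> L" for N by (rule lim) simp
    show "0 \<le> \<Phi> 1 x" for x using u0 sq_pos[of x] by (simp add: \<Phi>_def)
  qed
  then have "integrable lborel (\<lambda>x. pi * \<Phi> 1 x)" by simp
  then show ?thesis unfolding \<Phi>_def \<psi>1 by (simp add: u_def)
qed

section \<open>Regularized Cauchy transforms\<close>

lemma one_plus_norm_le:
  assumes "0 \<le> Re z"
  shows "1 + norm z \<le> 2 * norm (1 + z)"
proof -
  have "(norm (1 + z))\<^sup>2 = 1 + 2 * Re z + (norm z)\<^sup>2"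
    unfolding cmod_power2 by (simp add: power2_eq_square algebra_simps)
  moreover have "0 \<le> (1 - norm z)\<^sup>2" "0 \<le> (norm z)\<^sup>2" by simp_all
  moreover have "(1 - norm z)\<^sup>2 = 1 - 2 * norm z + (norm z)\<^sup>2" by (simp add: power2_diff)
  ultimately have "1 + 2 * norm z + (norm z)\<^sup>2 \<le> 4 * (norm (1 + z))\<^sup>2"
    using assms by linarith
  then have "(1 + norm z)\<^sup>2 \<le> (2 * norm (1 + z))\<^sup>2"
    by (simp add: power2_sum power_mult_distrib)
  then show ?thesis by (rule power2_le_imp_le) simp
qed

text \<open>In the right half-plane \<open>(1 + z) ^ N\<close> has no zeros and is comparable in
  modulus to \<open>(1 + norm z) ^ N\<close>. Dividing numerator and denominator by it turns
  polynomial bounds into the bound 1 and leaves the quotient alone.\<close>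

lemma quotient_normalize_half_plane:
  assumes B: "B holomorphic_on {z. 0 < Re z}" and C: "0 \<le> C"
    and BC: "\<And>z. 0 < Re z \<Longrightarrow> norm (B z) \<le> C * (1 + norm z) ^ N"
    and AC: "\<And>z. 0 < Re z \<Longrightarrow> norm (f z * B z) \<le> C * (1 + norm z) ^ N"
    and B1: "B 1 \<noteq> 0"
  obtains B' where "B' holomorphic_on {z. 0 < Re z}" "B' 1 \<noteq> 0"
    "\<And>z. 0 < Re z \<Longrightarrow> norm (B' z) \<le> 1" "\<And>z. 0 < Re z \<Longrightarrow> norm (f z * B' z) \<le> 1"
proof -
  define D where "D = (C + 1) * 2 ^ N"
  have D: "0 < D" using C by (simp add: D_def)
  define B' where "B' = (\<lambda>z. B z / (of_real D * (1 + z) ^ N))"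
  have nz: "1 + z \<noteq> 0" if "0 < Re z" for z using that by (auto simp: complex_eq_iff)
  have le: "C * (1 + norm z) ^ N \<le> D * norm (1 + z) ^ N" if "0 < Re z" for z
  proof -
    have "1 + norm z \<le> 2 * norm (1 + z)" using that by (intro one_plus_norm_le) simp
    then have "(1 + norm z) ^ N \<le> (2 * norm (1 + z)) ^ N" by (intro power_mono) auto
    then have "C * (1 + norm z) ^ N \<le> (C + 1) * (2 * norm (1 + z)) ^ N"
      using C by (intro mult_mono) auto
    then show ?thesis by (simp add: D_def power_mult_distrib mult_ac)
  qed
  have pos: "0 < D * norm (1 + z) ^ N" if "0 < Re z" for z using D nz[OF that] by simp
  show ?thesis
  proof
    show "B' holomorphic_on {z. 0 < Re z}"
      unfolding B'_def using nz D by (intro holomorphic_intros B) auto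
    show "B' 1 \<noteq> 0" using B1 D by (simp add: B'_def)
    show "norm (B' z) \<le> 1" if "0 < Re z" for z
      using order_trans[OF BC[OF that] le[OF that]] pos[OF that] D
      by (simp add: B'_def norm_divide norm_mult norm_power)
    show "norm (f z * B' z) \<le> 1" if "0 < Re z" for z
      using order_trans[OF AC[OF that] le[OF that]] pos[OF that] D
      by (simp add: B'_def norm_divide norm_mult norm_power)
  qed
qed

text \<open>Separation is measured relative to \<open>norm (t n)\<close>, because then the
  coefficient condition dominates the Cauchy series term by term. Poles much larger than
  \<open>z\<close> satisfy it with constant \<open>1/2\<close>; the finitely many others are covered
  by a minimum. \<open>S\<close> selects the poles that really occur.\<close>

lemma poles_apart_local:
  assumes T: "admissible_seq t" and z: "\<And>n. n \<in> S \<Longrightarrow> z \<noteq> t n"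
  obtains d c where "0 < d" "0 < c" "\<And>w n. w \<in> cball z d \<Longrightarrow> n \<in> S \<Longrightarrow> c * norm (t n) \<le> norm (w - t n)"
proof -
  have "eventually (\<lambda>n. 2 * (norm z + 1) \<le> norm (t n)) sequentially"
    using T by (simp add: admissible_seq_def filterlim_at_top)
  then obtain N where N: "2 * (norm z + 1) \<le> norm (t n)" if "N \<le> n" for n
    unfolding eventually_sequentially by blast
  define X where "X = insert 1 ((\<lambda>n. norm (z - t n)) ` (S \<inter> {..<N}))"
  define e where "e = Min X"
  have X: "finite X" "X \<noteq> {}" by (auto simp: X_def)
  have e: "0 < e" "e \<le> 1" using z X by (auto simp: e_def X_def)
  define Y where "Y = insert 1 ((\<lambda>n. norm (t n)) ` {..<N})"
  define M where "M = Max Y"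
  have Y: "finite Y" "Y \<noteq> {}" by (auto simp: Y_def)
  have M: "1 \<le> M" "norm (t n) \<le> M" if "n < N" for n using that Y by (auto simp: M_def Y_def)
  have M1: "1 \<le> M" using Y by (auto simp: M_def Y_def)
  define c where "c = min (1/2) (e / (2 * M))"
  have c: "0 < c" "c \<le> 1/2" "c * M \<le> e / 2" using e M1 by (auto simp: c_def min_def field_simps)
  show ?thesis
  proof
    fix w n assume w: "w \<in> cball z (e / 2)" and n: "n \<in> S"
    have wz: "norm (w - z) \<le> e / 2" using w by (simp add: dist_norm norm_minus_commute)
    show "c * norm (t n) \<le> norm (w - t n)"
    proof (cases "n < N")
      case True
      then have "e \<le> norm (z - t n)" using n X by (auto simp: e_def X_def intro!: Min_le)
      moreover have "norm (z - t n) \<le> norm (w - z) + norm (w - t n)"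
        using norm_triangle_ineq[of "z - w" "w - t n"] by (simp add: norm_minus_commute)
      moreover have "c * norm (t n) \<le> c * M" using M(2)[OF True] c by simp
      ultimately show ?thesis using wz c(3) by linarith
    next
      case False
      have "norm w \<le> norm z + norm (w - z)" by (metis add.commute diff_add_cancel norm_triangle_ineq)
      moreover have "norm (t n) \<le> norm w + norm (w - t n)"
        using norm_triangle_ineq4[of w "w - t n"] by simp
      moreover have "c * norm (t n) \<le> 1/2 * norm (t n)" using c by (intro mult_right_mono) auto
      moreover have "2 * (norm z + 1) \<le> norm (t n)" using N False by simp
      ultimately show ?thesis using wz e by simp
    qed
  qed (use e c in auto)
qed

lemma cauchy_term_bound:
  fixes t a :: "nat \<Rightarrow> complex"
  assumes "c * norm (t n) \<le> norm (w - t n)" "0 < c" "t n \<noteq> 0"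
  shows "norm (a n / (t n ^ k * (w - t n))) \<le> norm (a n) / norm (t n) ^ (k + 1) / c"
proof -
  have p: "0 < c * norm (t n)" using assms by simp
  then have "0 < norm (w - t n)" using assms(1) by linarith
  then have "norm (a n) / (norm (t n) ^ k * norm (w - t n)) \<le> norm (a n) / (norm (t n) ^ k * (c * norm (t n)))"
    using p assms by (intro divide_left_mono mult_left_mono mult_pos_pos) auto
  then show ?thesis by (simp add: norm_divide norm_mult norm_power mult_ac del: divide_le_eq)
qed

text \<open>Poles are taken out of a transform by setting their coefficients to 0, which avoids
  re-indexing the sequence.\<close>

lemma cauchy_coeff_ok_if:
  assumes "cauchy_coeff_ok t k a"
  shows "cauchy_coeff_ok t k (\<lambda>n. if P n then 0 else a n)"
  unfolding cauchy_coeff_ok_def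
  by (rule summable_comparison_test'[OF assms[unfolded cauchy_coeff_ok_def], of 0]) auto

text \<open>A term with \<open>a n = 0\<close> is identically 0, even at \<open>t n\<close> where it
  reads \<open>0 / 0\<close>. Hence only points with a nonzero coefficient have to be left out;
  elsewhere the partial sums converge locally uniformly by the Weierstrass test.\<close>

lemma reg_cauchy_holomorphic:
  assumes T: "admissible_seq t" and a: "cauchy_coeff_ok t k a"
  shows "reg_cauchy t a k holomorphic_on {z. \<forall>n. a n \<noteq> 0 \<longrightarrow> z \<noteq> t n}" (is "_ holomorphic_on ?D")
proof -
  have local: "\<exists>d>0. cball z d \<subseteq> ?D \<and>
      uniform_limit (cball z d) (\<lambda>n w. \<Sum>i<n. a i / (t i ^ k * (w - t i))) (\<lambda>w. \<Sum>i. a i / (t i ^ k * (w - t i))) sequentially"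
    if z: "z \<in> ?D" for z
  proof -
    obtain d c where "0 < d" "0 < c" and
      dc': "\<And>w n. w \<in> cball z d \<Longrightarrow> n \<in> {n. a n \<noteq> 0} \<Longrightarrow> c * norm (t n) \<le> norm (w - t n)"
      by (rule poles_apart_local[OF T, of "{n. a n \<noteq> 0}" z]) (use z in auto)
    then have dc: "0 < d" "0 < c" "w \<in> cball z d \<Longrightarrow> a n \<noteq> 0 \<Longrightarrow> c * norm (t n) \<le> norm (w - t n)" for w n
      by simp_all
    have t0: "t n \<noteq> 0" for n using T by (simp add: admissible_seq_def)
    have "norm (a n / (t n ^ k * (w - t n))) \<le> norm (a n) / norm (t n) ^ (k + 1) / c" if "w \<in> cball z d" for w n
    proof (cases "a n = 0")
      case False
      then show ?thesis using cauchy_term_bound[OF dc(3)[OF that] dc(2) t0] by simp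
    qed simp
    moreover have "summable (\<lambda>n. norm (a n) / norm (t n) ^ (k + 1) / c)"
      using a unfolding cauchy_coeff_ok_def by (rule summable_divide)
    ultimately have ul: "uniform_limit (cball z d) (\<lambda>n w. \<Sum>i<n. a i / (t i ^ k * (w - t i))) (\<lambda>w. \<Sum>i. a i / (t i ^ k * (w - t i))) sequentially"
      by (rule Weierstrass_m_test)
    have "w \<noteq> t n" if "w \<in> cball z d" "a n \<noteq> 0" for w n
      using dc(3)[OF that] dc(2) t0[of n] by (auto simp: mult_le_0_iff)
    then have "cball z d \<subseteq> ?D" by blast
    with ul dc(1) show ?thesis by (intro exI[of _ d] conjI)
  qed
  have "open ?D" unfolding open_contains_cball
  proof
    fix z assume "z \<in> ?D"
    from local[OF this] obtain d where "0 < d" "cball z d \<subseteq> ?D" by (elim exE conjE)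
    then show "\<exists>e>0. cball z e \<subseteq> ?D" by (intro exI[of _ d] conjI)
  qed
  then have "(\<lambda>w. \<Sum>i. a i / (t i ^ k * (w - t i))) holomorphic_on ?D"
  proof (rule holomorphic_uniform_sequence)
    have t0: "t n \<noteq> 0" for n using T by (simp add: admissible_seq_def)
    show "(\<lambda>w. \<Sum>i<n. a i / (t i ^ k * (w - t i))) holomorphic_on ?D" for n
    proof (rule holomorphic_on_sum)
      fix i
      show "(\<lambda>w. a i / (t i ^ k * (w - t i))) holomorphic_on ?D"
      proof (cases "a i = 0")
        case False
        then show ?thesis using t0 by (auto intro!: holomorphic_intros)
      qed simp
    qed
  qed (rule local)
  then have "(\<lambda>z. z ^ k * (\<Sum>i. a i / (t i ^ k * (z - t i)))) holomorphic_on ?D"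
    by (intro holomorphic_intros)
  then show ?thesis by (simp add: reg_cauchy_def[abs_def])
qed

lemma reg_cauchy_bound:
  assumes T: "admissible_seq t" and a: "cauchy_coeff_ok t k a" and c: "0 < c"
    and w: "\<And>n. c * norm (t n) \<le> norm (w - t n)"
  shows "norm (reg_cauchy t a k w) \<le> norm w ^ k * ((\<Sum>n. norm (a n) / norm (t n) ^ (k + 1)) / c)"
proof -
  have t0: "t n \<noteq> 0" for n using T by (simp add: admissible_seq_def)
  have s: "summable (\<lambda>n. norm (a n) / norm (t n) ^ (k + 1))" using a by (simp add: cauchy_coeff_ok_def)
  have "norm (\<Sum>n. a n / (t n ^ k * (w - t n))) \<le> (\<Sum>n. norm (a n) / norm (t n) ^ (k + 1) / c)"
    by (intro norm_suminf_le cauchy_term_bound w c t0 summable_divide s)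
  also have "\<dots> = (\<Sum>n. norm (a n) / norm (t n) ^ (k + 1)) / c" by (rule suminf_divide[OF s])
  finally have "norm w ^ k * norm (\<Sum>n. a n / (t n ^ k * (w - t n)))
      \<le> norm w ^ k * ((\<Sum>n. norm (a n) / norm (t n) ^ (k + 1)) / c)"
    by (intro mult_left_mono) auto
  then show ?thesis by (simp only: reg_cauchy_def norm_mult norm_power)
qed

lemma reg_cauchy_split:
  assumes T: "admissible_seq t" and a: "cauchy_coeff_ok t k a" and z: "z \<notin> range t" and I: "finite I"
  shows "reg_cauchy t a k z = reg_cauchy t (\<lambda>n. if n \<in> I then 0 else a n) k z + z ^ k * (\<Sum>n\<in>I. a n / (t n ^ k * (z - t n)))"
proof -
  obtain d c where "0 < d" "0 < c" and dc': "\<And>w n. w \<in> cball z d \<Longrightarrow> n \<in> UNIV \<Longrightarrow> c * norm (t n) \<le> norm (w - t n)"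
    by (rule poles_apart_local[OF T, of UNIV z]) (use z in auto)
  then have dc: "0 < c" "c * norm (t n) \<le> norm (z - t n)" for n by auto
  have t0: "t n \<noteq> 0" for n using T by (simp add: admissible_seq_def)
  have sum: "summable (\<lambda>n. b n / (t n ^ k * (z - t n)))" if "cauchy_coeff_ok t k b" for b
  proof (rule summable_comparison_test')
    show "summable (\<lambda>n. norm (b n) / norm (t n) ^ (k + 1) / c)"
      using that unfolding cauchy_coeff_ok_def by (rule summable_divide)
  qed (use cauchy_term_bound[OF dc(2) dc(1) t0] in auto)
  let ?b = "\<lambda>n. if n \<in> I then 0 else a n"
  have "(\<Sum>n. a n / (t n ^ k * (z - t n)))
      = (\<Sum>n. ?b n / (t n ^ k * (z - t n)) + (if n \<in> I then a n / (t n ^ k * (z - t n)) else 0))"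
    by (rule arg_cong[of _ _ suminf]) auto
  also have "\<dots> = (\<Sum>n. ?b n / (t n ^ k * (z - t n))) + (\<Sum>n. if n \<in> I then a n / (t n ^ k * (z - t n)) else 0)"
    by (rule suminf_add[symmetric])
      (use sum[OF cauchy_coeff_ok_if[OF a, of "\<lambda>n. n \<in> I"]] summable_If_finite_set[OF I] in auto)
  also have "(\<Sum>n. if n \<in> I then a n / (t n ^ k * (z - t n)) else 0) = (\<Sum>n\<in>I. a n / (t n ^ k * (z - t n)))"
    using sums_If_finite_set[OF I, of "\<lambda>n. a n / (t n ^ k * (z - t n))"] by (simp add: sums_iff)
  finally show ?thesis by (simp add: reg_cauchy_def distrib_left)
qed

text \<open>The product cancels each denominator of the finite part split off, which becomes a
  polynomial, while the rest has no poles at the points of \<open>I\<close>. Writing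
  \<open>G\<close> this way avoids removable singularities.\<close>

lemma reg_cauchy_remove_poles:
  assumes T: "admissible_seq t" and a: "cauchy_coeff_ok t k a" and I: "finite I"
  obtains G where "G holomorphic_on - t ` (- I)"
    "\<And>z. z \<notin> range t \<Longrightarrow> G z = reg_cauchy t a k z * (\<Prod>n\<in>I. z - t n)"
proof
  let ?G = "\<lambda>z. reg_cauchy t (\<lambda>n. if n \<in> I then 0 else a n) k z * (\<Prod>n\<in>I. z - t n)
    + z ^ k * (\<Sum>n\<in>I. a n / t n ^ k * (\<Prod>j\<in>I - {n}. z - t j))"
  have "reg_cauchy t (\<lambda>n. if n \<in> I then 0 else a n) k holomorphic_on - t ` (- I)"
    by (rule holomorphic_on_subset[OF reg_cauchy_holomorphic[OF T cauchy_coeff_ok_if[OF a]]]) auto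
  then show "?G holomorphic_on - t ` (- I)" by (intro holomorphic_intros)
  fix z assume z: "z \<notin> range t"
  have "(\<Sum>n\<in>I. a n / (t n ^ k * (z - t n))) * (\<Prod>n\<in>I. z - t n) = (\<Sum>n\<in>I. a n / t n ^ k * (\<Prod>j\<in>I - {n}. z - t j))"
    unfolding sum_distrib_right
  proof (rule sum.cong[OF refl])
    fix n assume n: "n \<in> I"
    have "z - t n \<noteq> 0" using z by auto
    then show "a n / (t n ^ k * (z - t n)) * (\<Prod>n\<in>I. z - t n) = a n / t n ^ k * (\<Prod>j\<in>I - {n}. z - t j)"
      unfolding prod.remove[OF I n] by simp
  qed
  then show "?G z = reg_cauchy t a k z * (\<Prod>n\<in>I. z - t n)"
    unfolding reg_cauchy_split[OF T a z I] by (simp add: distrib_right mult.assoc)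
qed

text \<open>The complement of a countable set in the plane is connected, so a transform vanishing on
  a nonempty open set off the poles vanishes identically. This supplies the one point with
  \<open>B \<noteq> 0\<close> wherever it is wanted.\<close>

lemma nonzero_in_open:
  assumes T: "admissible_seq t" and b: "cauchy_coeff_ok t m b"
    and nz: "\<exists>z. z \<notin> range t \<and> reg_cauchy t b m z \<noteq> 0" and U: "open U" "U \<noteq> {}" "U \<inter> range t = {}"
  shows "\<exists>z\<in>U. reg_cauchy t b m z \<noteq> 0"
proof (rule ccontr)
  assume "\<not> (\<exists>z\<in>U. reg_cauchy t b m z \<noteq> 0)"
  then have zero: "reg_cauchy t b m z = 0" if "z \<in> U" for z using that by blast
  let ?D = "- range t"
  have "countable (range t)" by simp
  then have conn: "connected ?D"
    by (intro path_connected_imp_connected path_connected_complement_countable) auto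
  have op: "open ?D"
    unfolding open_contains_cball
  proof
    fix z assume "z \<in> ?D"
    then have z: "z \<noteq> t n" for n by auto
    obtain d c where dc: "0 < d" "0 < c" "\<And>w n. w \<in> cball z d \<Longrightarrow> n \<in> UNIV \<Longrightarrow> c * norm (t n) \<le> norm (w - t n)"
      by (rule poles_apart_local[OF T, of UNIV z]) (use z in auto)
    have "w \<noteq> t n" if "w \<in> cball z d" for w n
      using dc(3)[OF that, of n] dc(2) T by (auto simp: admissible_seq_def mult_le_0_iff)
    with dc(1) show "\<exists>e>0. cball z e \<subseteq> ?D" by blast
  qed
  have hol: "reg_cauchy t b m holomorphic_on ?D"
    by (rule holomorphic_on_subset[OF reg_cauchy_holomorphic[OF T b]]) auto
  have "reg_cauchy t b m z = 0" if "z \<in> ?D" for z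
  proof (rule analytic_continuation_open[OF U(1) op U(2) conn _ hol holomorphic_on_const])
    show "U \<subseteq> - range t" using U(3) by blast
  qed (use zero that in auto)
  then show False using nz by blast
qed

section \<open>Growth of the quotient\<close>

lemma finite_poles_in_disc:
  assumes "admissible_seq t"
  shows "finite {n. norm (t n - p) < x}"
proof -
  have "eventually (\<lambda>n. x + norm p \<le> norm (t n)) sequentially"
    using assms by (simp add: admissible_seq_def filterlim_at_top)
  then obtain N where N: "\<And>n. N \<le> n \<Longrightarrow> x + norm p \<le> norm (t n)"
    unfolding eventually_sequentially by blast
  have "{n. norm (t n - p) < x} \<subseteq> {..<N}"
  proof
    fix n assume "n \<in> {n. norm (t n - p) < x}"
    then have "norm (t n) < x + norm p" using norm_triangle_ineq2[of "t n" p] by simp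
    with N[of n] show "n \<in> {..<N}" by (cases "N \<le> n") auto
  qed
  then show ?thesis by (rule finite_subset) simp
qed

text \<open>An upper bound for the integrated counting function of \<open>t\<close> about \<open>p\<close>; the factor \<open>2\<close> makes
  every term at least \<open>ln 2\<close>, so that the counting function itself is dominated, too.\<close>

definition pole_weight :: "(nat \<Rightarrow> complex) \<Rightarrow> complex \<Rightarrow> real \<Rightarrow> real" where
  "pole_weight t p x = (\<Sum>n | norm (t n - p) < x. ln (2 * x / norm (t n - p)))"

text \<open>Pigeonhole: there are \<open>card I + 1\<close> candidate radii with spacing
  \<open>1 / (card I + 1)\<close>, and each \<open>\<rho> n\<close> is closer than half the spacing
  to at most one of them.\<close>

lemma exists_radius_apart:
  fixes \<rho> :: "'a \<Rightarrow> real"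
  assumes I: "finite I"
  shows "\<exists>r. R \<le> r \<and> r \<le> R + 1 \<and> (\<forall>n\<in>I. 1 / (2 * (real (card I) + 1)) \<le> \<bar>r - \<rho> n\<bar>)"
proof (rule ccontr)
  assume contra: "\<not> ?thesis"
  define N where "N = card I"
  define r where "r = (\<lambda>j::nat. R + real j / (real N + 1))"
  have "\<exists>n\<in>I. \<bar>r j - \<rho> n\<bar> < 1 / (2 * (real N + 1))" if "j \<le> N" for j
  proof -
    have "R \<le> r j" "r j \<le> R + 1" using that by (auto simp: r_def field_simps)
    then have "\<not> (\<forall>n\<in>I. 1 / (2 * (real (card I) + 1)) \<le> \<bar>r j - \<rho> n\<bar>)" using contra by blast
    then show ?thesis unfolding N_def by (meson not_le)
  qed
  then obtain g where g: "\<And>j. j \<le> N \<Longrightarrow> g j \<in> I" "\<And>j. j \<le> N \<Longrightarrow> \<bar>r j - \<rho> (g j)\<bar> < 1 / (2 * (real N + 1))"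
    by metis
  have "inj_on g {..N}"
  proof (rule inj_onI)
    fix i j assume ij: "i \<in> {..N}" "j \<in> {..N}" "g i = g j"
    have "\<bar>r i - r j\<bar> < 1 / (2 * (real N + 1)) + 1 / (2 * (real N + 1))"
      using g(2)[of i] g(2)[of j] ij by auto
    also have "\<dots> = 1 / (real N + 1)" by (simp add: field_simps)
    finally have "\<bar>(real i - real j) / (real N + 1)\<bar> < 1 / (real N + 1)"
      by (simp add: r_def diff_divide_distrib)
    then have "\<bar>real i - real j\<bar> < 1" by (simp add: divide_less_cancel)
    then show "i = j" by linarith
  qed
  then have "card {..N} \<le> card I" using I g(1) by (intro card_inj_on_le[of g]) auto
  then show False by (simp add: N_def)
qed

lemma pole_weight_ge_card:
  assumes p: "p \<notin> range t" and x: "0 < x"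
  shows "real (card {n. norm (t n - p) < x}) \<le> 2 * pole_weight t p x"
proof -
  have "(\<Sum>n | norm (t n - p) < x. 1 / 2) \<le> pole_weight t p x"
    unfolding pole_weight_def
  proof (rule sum_mono)
    fix n assume "n \<in> {n. norm (t n - p) < x}"
    moreover have "0 < norm (t n - p)" using p by auto
    ultimately have "2 \<le> 2 * x / norm (t n - p)" by (simp add: field_simps)
    then have "ln 2 \<le> ln (2 * x / norm (t n - p))" by simp
    with ln2_ge_two_thirds show "1 / 2 \<le> ln (2 * x / norm (t n - p))" by linarith
  qed
  then show ?thesis by simp
qed

lemma pole_weight_mono:
  assumes T: "admissible_seq t" and p: "p \<notin> range t" and xy: "0 < x" "x \<le> y"
  shows "pole_weight t p x \<le> pole_weight t p y"
proof -
  have pos: "0 < norm (t n - p)" for n using p by auto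
  have "pole_weight t p x \<le> (\<Sum>n | norm (t n - p) < x. ln (2 * y / norm (t n - p)))"
    unfolding pole_weight_def using pos xy
    by (intro sum_mono) (auto intro!: divide_right_mono simp: less_imp_le)
  also have "\<dots> \<le> pole_weight t p y"
    unfolding pole_weight_def
  proof (rule sum_mono2[OF finite_poles_in_disc[OF T]])
    fix n assume "n \<in> {n. norm (t n - p) < y} - {n. norm (t n - p) < x}"
    then have "norm (t n - p) \<le> 2 * y" using xy by auto
    then have "1 \<le> 2 * y / norm (t n - p)" using pos[of n] by simp
    then show "0 \<le> ln (2 * y / norm (t n - p))" by simp
  qed (use xy in auto)
  finally show ?thesis .
qed

text \<open>Poles with \<open>norm (t n - p) < 4 * R\<close> have modulus at most
  \<open>5 * R\<close> and distance at least \<open>1 / (2 * (N + 1))\<close> from the circle,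
  whence the constant \<open>10 * R * (N + 1)\<close>. For the remaining poles the distance to the
  circle is already comparable to their modulus, because \<open>r \<le> 2 * R\<close>.\<close>

lemma circle_apart_from_poles:
  assumes "admissible_seq t" and R: "1 + norm p \<le> R" and r: "R \<le> r" "r \<le> R + 1"
    and apart: "\<And>n. norm (t n - p) < 4 * R \<Longrightarrow> 1 / (2 * (N + 1)) \<le> \<bar>r - norm (t n - p)\<bar>"
    and N: "0 \<le> N" and w: "norm (w - p) = r"
  shows "1 / (10 * R * (N + 1)) * norm (t n) \<le> norm (w - t n)"
proof -
  have R1: "1 \<le> R" "norm p \<le> R" using R by (smt (verit) norm_ge_zero)+
  have tri: "\<bar>r - norm (t n - p)\<bar> \<le> norm (w - t n)"
    using norm_triangle_ineq3[of "w - p" "t n - p"] w by simp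
  have tn: "norm (t n) \<le> norm (t n - p) + norm p" using norm_triangle_ineq[of "t n - p" p] by simp
  have D: "10 \<le> 10 * R * (N + 1)" using mult_mono[of 1 R 1 "N + 1"] R1 N by simp
  show ?thesis
  proof (cases "norm (t n - p) < 4 * R")
    case True
    have "1 / (10 * R * (N + 1)) * norm (t n) \<le> 1 / (10 * R * (N + 1)) * (5 * R)"
      using tn True R1 D by (intro mult_left_mono) auto
    also have "\<dots> = 1 / (2 * (N + 1))"
    proof -
      have "10 * R * (N + 1) = (5 * R) * (2 * (N + 1))" by simp
      moreover have "5 * R \<noteq> 0" using R1 by simp
      ultimately show ?thesis by (metis mult.commute nonzero_divide_mult_cancel_left times_divide_eq_right mult.right_neutral)
    qed
    finally show ?thesis using apart[OF True] tri by linarith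
  next
    case False
    have "1 / (10 * R * (N + 1)) * norm (t n) \<le> 1 / 10 * norm (t n)"
      using D by (intro mult_right_mono divide_left_mono) auto
    then show ?thesis using tri tn False r R1 by linarith
  qed
qed

text \<open>The disc bound is applied about \<open>p\<close> with a radius \<open>r\<close> between
  \<open>R\<close> and \<open>R + 1\<close> that keeps clear of the poles, and with \<open>B\<close>
  equal to the second transform times the product of \<open>z - t n\<close> over the poles inside.
  At the centre this product has modulus the product of the \<open>norm (t n - p)\<close>, while on
  the circle it is at most \<open>(2 * r) ^ card I\<close>; the logarithm of the ratio is the pole
  weight.\<close>

lemma quotient_growth:
  assumes T: "admissible_seq t" and a: "cauchy_coeff_ok t k a" and b: "cauchy_coeff_ok t m b"
    and F: "F holomorphic_on UNIV"
    and quot: "\<And>z. z \<notin> range t \<Longrightarrow> F z * reg_cauchy t b m z = reg_cauchy t a k z"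
    and p: "p \<notin> range t" "reg_cauchy t b m p \<noteq> 0"
  obtains C where "0 \<le> C"
    "\<And>R z. 1 + norm p \<le> R \<Longrightarrow> norm (z - p) \<le> R / 2 \<Longrightarrow>
      norm (F z) \<le> exp (C * (1 + ln R + pole_weight t p (4 * R)))"
proof -
  define Ma Mb where "Ma = (\<Sum>n. norm (a n) / norm (t n) ^ (k + 1))" and "Mb = (\<Sum>n. norm (b n) / norm (t n) ^ (m + 1))"
  have M0: "0 \<le> Ma" "0 \<le> Mb"
    using a b unfolding Ma_def Mb_def cauchy_coeff_ok_def by (auto intro!: suminf_nonneg)
  define c0 where "c0 = ln 2 + real (k + m) * ln 3 + ln (Ma + Mb + 1) + ln 10 + \<bar>ln (norm (reg_cauchy t b m p))\<bar>"
  have c0: "0 \<le> c0" using M0 by (simp add: c0_def)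
  \<comment> \<open>3 is the Harnack factor \<open>(1 + s) / (1 - s)\<close> at
    \<open>s = 1 / 2\<close>; the bracket dominates each of the coefficients \<open>c0\<close>,
    \<open>k + m + 1\<close> and \<open>3\<close> in \<open>ln0\<close>.\<close>
  define C where "C = 3 * (c0 + real (k + m) + 4)"
  show thesis
  proof
    show "0 \<le> C" using c0 by (simp add: C_def)
    fix R z assume R: "1 + norm p \<le> R" and z: "norm (z - p) \<le> R / 2"
    have R1: "1 \<le> R" "norm p \<le> R" using R by (smt (verit) norm_ge_zero)+
    define S where "S = pole_weight t p (4 * R)"
    define N where "N = real (card {n. norm (t n - p) < 4 * R})"
    have N: "0 \<le> N" "N \<le> 2 * S" using pole_weight_ge_card[OF p(1)] R1 by (auto simp: N_def S_def)
    obtain r where r: "R \<le> r" "r \<le> R + 1"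
      and apart: "\<And>n. norm (t n - p) < 4 * R \<Longrightarrow> 1 / (2 * (N + 1)) \<le> \<bar>r - norm (t n - p)\<bar>"
      using exists_radius_apart[OF finite_poles_in_disc[OF T, of p "4 * R"], of R "\<lambda>n. norm (t n - p)"]
      unfolding N_def by blast
    have r0: "0 < r" "r \<le> 2 * R" using r R1 by linarith+
    define c where "c = 1 / (10 * R * (N + 1))"
    have c: "0 < c" using R1 N by (simp add: c_def)
    have wT: "c * norm (t n) \<le> norm (w - t n)" if "norm (w - p) = r" for w n
      unfolding c_def using circle_apart_from_poles[OF T R r apart N(1) that] .
    define W where "W = (3 * R) ^ (k + m) * (Ma + Mb + 1) / c"
    have W0: "0 < W" using R1 M0 c by (simp add: W_def)
    have bound: "norm w ^ j * (M / c) \<le> W" if w: "norm (w - p) = r" and j: "j \<le> k + m" and M: "0 \<le> M" "M \<le> Ma + Mb + 1" for w j M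
    proof -
      have "norm w \<le> 3 * R" using norm_triangle_ineq[of "w - p" p] w r0 R1 by simp
      then have "norm w ^ j \<le> (3 * R) ^ j" by (intro power_mono) auto
      also have "\<dots> \<le> (3 * R) ^ (k + m)" using R1 j by (intro power_increasing) auto
      finally have "norm w ^ j * (M / c) \<le> (3 * R) ^ (k + m) * ((Ma + Mb + 1) / c)"
        using M c R1 by (intro mult_mono divide_right_mono) auto
      then show ?thesis by (simp add: W_def)
    qed
    have circle: "w \<notin> range t" "norm (reg_cauchy t a k w) \<le> W" "norm (reg_cauchy t b m w) \<le> W"
      if w: "norm (w - p) = r" for w
    proof -
      have "t n \<noteq> 0" for n using T by (simp add: admissible_seq_def)
      then have "w \<noteq> t n" for n using wT[OF w, of n] c by (auto simp: mult_le_0_iff)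
      then show "w \<notin> range t" by auto
      show "norm (reg_cauchy t a k w) \<le> W"
        using order_trans[OF reg_cauchy_bound[OF T a c wT[OF w], folded Ma_def] bound[OF w, of k Ma]] M0 by simp
      show "norm (reg_cauchy t b m w) \<le> W"
        using order_trans[OF reg_cauchy_bound[OF T b c wT[OF w], folded Mb_def] bound[OF w, of m Mb]] M0 by simp
    qed
    define I where "I = {n. norm (t n - p) < r}"
    have I: "finite I" unfolding I_def by (rule finite_poles_in_disc[OF T])
    obtain G where G: "G holomorphic_on - t ` (- I)"
      "\<And>z. z \<notin> range t \<Longrightarrow> G z = reg_cauchy t b m z * (\<Prod>n\<in>I. z - t n)"
      using reg_cauchy_remove_poles[OF T b I] by blast
    \<comment> \<open>\<open>W\<close> bounds both transforms on the circle and
      \<open>(2 * r) ^ card I\<close> bounds the product, so division by \<open>D\<close> normalizes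
      to 1.\<close>
    define D where "D = W * (2 * r) ^ card I"
    have D: "0 < D" using W0 r0 by (simp add: D_def)
    have Q: "norm (\<Prod>n\<in>I. w - t n) \<le> (2 * r) ^ card I" if w: "norm (w - p) = r" for w
    proof -
      have "norm (\<Prod>n\<in>I. w - t n) \<le> (\<Prod>n\<in>I. 2 * r)"
        unfolding prod_norm[symmetric]
      proof (rule prod_mono, intro conjI)
        fix n assume "n \<in> I"
        then have "norm (t n - p) < r" by (simp add: I_def)
        then show "norm (w - t n) \<le> 2 * r"
          using norm_triangle_ineq4[of "w - p" "t n - p"] w by simp
      qed simp
      then show ?thesis by simp
    qed
    define f where "f = (\<lambda>w. F (p + of_real r * w))"
    define B where "B = (\<lambda>w. G (p + of_real r * w) / of_real D)"
    have on_circle: "norm (p + of_real r * w - p) = r" if "norm w = 1" for w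
      using that r0 by (simp add: norm_mult)
    have fh: "f holomorphic_on cball 0 1"
    proof -
      have "F \<circ> (\<lambda>w. p + of_real r * w) holomorphic_on cball 0 1"
        by (rule holomorphic_on_compose_gen[OF _ F]) (auto intro!: holomorphic_intros)
      then show ?thesis by (simp add: f_def o_def)
    qed
    have Bh: "B holomorphic_on cball 0 1"
    proof -
      have "G \<circ> (\<lambda>w. p + of_real r * w) holomorphic_on cball 0 1"
      proof (rule holomorphic_on_compose_gen[OF _ G(1)])
        show "(\<lambda>w. p + complex_of_real r * w) ` cball 0 1 \<subseteq> - t ` (- I)"
        proof clarsimp
          fix w n assume w: "norm w \<le> 1" and n: "p + of_real r * w = t n" "n \<notin> I"
          have "norm (t n - p) = r * norm w" using r0 by (simp add: n(1)[symmetric] norm_mult)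
          moreover have "r * norm w \<le> r" using w r0 by (simp add: mult_left_le)
          ultimately have "norm (t n - p) = r" using n(2) by (simp add: I_def)
          then show False using circle(1)[of "t n"] by auto
        qed
      qed (auto intro!: holomorphic_intros)
      then show ?thesis unfolding B_def using D by (auto simp: o_def intro!: holomorphic_intros)
    qed
    have B1: "norm (B w) \<le> 1" and A1: "norm (f w * B w) \<le> 1" if w: "norm w = 1" for w
    proof -
      note v = on_circle[OF w]
      have *: "norm (x * (\<Prod>n\<in>I. p + of_real r * w - t n) / of_real D) \<le> 1" if "norm x \<le> W" for x
      proof -
        have "norm (x * (\<Prod>n\<in>I. p + of_real r * w - t n)) \<le> D"
          unfolding norm_mult D_def using W0 by (intro mult_mono that Q[OF v]) auto
        then show ?thesis using D by (simp add: norm_divide)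
      qed
      show "norm (B w) \<le> 1"
        unfolding B_def G(2)[OF circle(1)[OF v]] by (rule *[OF circle(3)[OF v]])
      have "f w * B w = reg_cauchy t a k (p + of_real r * w) * (\<Prod>n\<in>I. p + of_real r * w - t n) / of_real D"
        unfolding f_def B_def G(2)[OF circle(1)[OF v]] quot[OF circle(1)[OF v], symmetric] by simp
      then show "norm (f w * B w) \<le> 1" using *[OF circle(2)[OF v]] by simp
    qed
    have pos: "0 < norm (t n - p)" for n using p by auto
    have B0: "norm (B 0) = norm (reg_cauchy t b m p) * (\<Prod>n\<in>I. norm (t n - p)) / D"
      using G(2)[OF p(1)] D by (simp add: B_def norm_mult norm_divide prod_norm norm_minus_commute)
    have P0: "0 < (\<Prod>n\<in>I. norm (t n - p))" using pos by (intro prod_pos) auto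
    have B0nz: "B 0 \<noteq> 0" using B0 P0 D p(2) by auto
    \<comment> \<open>One \<open>S\<close> is the pole weight produced by the product. The other two
      pay for \<open>ln (N + 1)\<close>, the cost of the separation of the circle from the
      poles.\<close>
    have ln0: "ln (2 / norm (B 0)) \<le> c0 + real (k + m + 1) * ln R + 3 * S"
    proof -
      have "ln (2 / norm (B 0)) = ln 2 + ln D - ln (norm (reg_cauchy t b m p)) - (\<Sum>n\<in>I. ln (norm (t n - p)))"
        unfolding B0 using D P0 p(2) pos I by (simp add: ln_div ln_mult ln_prod)
      also have "ln D = ln W + (\<Sum>n\<in>I. ln (2 * r))"
        using W0 r0 by (simp add: D_def ln_mult ln_realpow distrib_left)
      finally have "ln (2 / norm (B 0)) = ln 2 + ln W - ln (norm (reg_cauchy t b m p)) + (\<Sum>n\<in>I. ln (2 * r / norm (t n - p)))"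
        using pos r0 by (simp add: ln_div sum_subtractf)
      moreover have "(\<Sum>n\<in>I. ln (2 * r / norm (t n - p))) \<le> S"
        unfolding I_def S_def pole_weight_def[symmetric] using r0 R1 by (intro pole_weight_mono[OF T p(1)]) auto
      moreover have "ln W = real (k + m) * ln 3 + real (k + m) * ln R + ln (Ma + Mb + 1) + (ln 10 + ln R + ln (N + 1))"
      proof -
        have "W = (3 * R) ^ (k + m) * (Ma + Mb + 1) * (10 * R * (N + 1))" by (simp add: W_def c_def)
        moreover have "0 < (3 * R) ^ (k + m)" "0 < Ma + Mb + 1" "0 < 10 * R" "0 < N + 1" using R1 M0 N by auto
        ultimately have "ln W = real (k + m) * ln (3 * R) + ln (Ma + Mb + 1) + (ln (10 * R) + ln (N + 1))"
          using R1 by (simp only: ln_mult_pos mult_pos_pos ln_realpow)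
        then show ?thesis using R1 by (simp add: ln_mult distrib_left)
      qed
      moreover have "ln (N + 1) \<le> 2 * S" using ln_add_one_self_le_self[of N] N by (simp add: add.commute)
      moreover have "real (k + m + 1) * ln R = real (k + m) * ln R + ln R" by (simp add: algebra_simps)
      ultimately show ?thesis unfolding c0_def by linarith
    qed
    have lnB: "0 \<le> ln (2 / norm (B 0))"
      using norm_le_on_disc[OF Bh B1, of 0] B0nz by simp
    define w where "w = (z - p) / of_real r"
    have w: "norm w \<le> 1 / 2" using z r r0 by (simp add: w_def norm_divide field_simps)
    have zw: "p + of_real r * w = z" using r0 by (simp add: w_def)
    have "norm (F z) \<le> exp ((1 + norm w) / (1 - norm w) * ln (2 / norm (B 0)))"
      using quotient_bound_disc[OF fh Bh B1 A1 B0nz, of w] w zw by (simp add: f_def)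
    also have "\<dots> \<le> exp (3 * ln (2 / norm (B 0)))"
      unfolding exp_le_cancel_iff by (rule mult_right_mono[OF _ lnB]) (use w in \<open>simp add: field_simps\<close>)
    also have "\<dots> \<le> exp (C * (1 + ln R + S))"
    proof -
      have S0: "0 \<le> S" and L0: "0 \<le> ln R" using N R1 by auto
      have "c0 + real (k + m + 1) * ln R + 3 * S \<le> (c0 + real (k + m) + 4) * 1 + (c0 + real (k + m) + 4) * ln R + (c0 + real (k + m) + 4) * S"
        using c0 S0 L0 by (intro add_mono mult_right_mono) auto
      with ln0 have "ln (2 / norm (B 0)) \<le> (c0 + real (k + m) + 4) * (1 + ln R + S)"
        unfolding distrib_left by linarith
      then show ?thesis unfolding exp_le_cancel_iff C_def mult.assoc by (rule mult_left_mono) simp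
    qed
    finally show "norm (F z) \<le> exp (C * (1 + ln R + pole_weight t p (4 * R)))" by (simp add: S_def)
  qed
qed

section \<open>A Phragmen-Lindelof theorem for sectors\<close>

text \<open>Sectors are described by \<open>norm z * cos \<eta> \<le> Re z\<close>, a closed
  condition between continuous functions that includes the origin. This lemma translates it into a
  bound on the argument where powers are taken.\<close>

lemma abs_Arg_le:
  assumes "norm z * cos \<eta> \<le> Re z" "z \<noteq> 0" "0 \<le> \<eta>" "\<eta> \<le> pi"
  shows "\<bar>Arg z\<bar> \<le> \<eta>"
proof (rule ccontr)
  assume "\<not> \<bar>Arg z\<bar> \<le> \<eta>"
  moreover have "\<bar>Arg z\<bar> \<le> pi" using mpi_less_Arg[of z] Arg_le_pi[of z] by linarith
  ultimately have "cos \<bar>Arg z\<bar> < cos \<eta>" using assms by (intro cos_monotone_0_pi) auto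
  then have "norm z * cos (Arg z) < norm z * cos \<eta>" using assms by simp
  moreover have "Re z = norm z * cos (Arg z)"
    by (metis rcis_cmod_Arg Re_rcis)
  ultimately show False using assms(1) by simp
qed

lemma Re_powr_ge:
  assumes "\<bar>Arg w\<bar> \<le> \<eta>" "w \<noteq> 0" "0 \<le> s" "s * \<eta> \<le> pi"
  shows "cos (s * \<eta>) * norm w powr s \<le> Re (w powr of_real s)"
proof -
  have "Re (w powr of_real s) = norm w powr s * cos (s * Arg w)"
    using assms(2) by (simp add: powr_def Re_exp Arg_def)
  moreover have "cos (s * \<eta>) \<le> cos (s * \<bar>Arg w\<bar>)"
    using assms by (intro cos_monotone_0_pi_le mult_left_mono mult_nonneg_nonneg) auto
  moreover have "cos (s * \<bar>Arg w\<bar>) = cos (s * Arg w)"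
    by (metis abs_mult abs_of_nonneg assms(3) cos_abs_real)
  ultimately show ?thesis by (metis mult.commute mult_right_mono powr_ge_zero)
qed

text \<open>Adding 1 maps the sector into itself and keeps the base of the power away from the
  branch point 0, so the comparison functions are holomorphic on the whole closed sector.\<close>

lemma Re_one_plus_powr_ge:
  assumes z: "norm z * cos \<eta> \<le> Re z" and \<eta>: "0 < \<eta>" "\<eta> < pi / 2" and s: "0 \<le> s" "s * \<eta> < pi / 2"
  shows "cos (s * \<eta>) / 2 powr s * (1 + norm z) powr s \<le> Re ((1 + z) powr of_real s)"
proof -
  have c: "0 < cos \<eta>" using \<eta> by (intro cos_gt_zero_pi) auto
  have z0: "0 \<le> Re z" using z c by (meson mult_nonneg_nonneg less_imp_le norm_ge_zero order_trans)
  then have nz: "1 + z \<noteq> 0" by (auto simp: complex_eq_iff)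
  have "norm (1 + z) * cos \<eta> \<le> (1 + norm z) * cos \<eta>"
    using c norm_triangle_ineq[of 1 z] by (intro mult_right_mono) auto
  also have "\<dots> \<le> Re (1 + z)" using z cos_le_one[of \<eta>] unfolding distrib_right plus_complex.sel one_complex.sel by linarith
  finally have A: "\<bar>Arg (1 + z)\<bar> \<le> \<eta>" using \<eta> nz by (intro abs_Arg_le) auto
  have cs: "0 \<le> cos (s * \<eta>)" using s \<eta> by (intro cos_ge_zero) (auto intro: order_trans[of _ 0])
  have "(1 + norm z) powr s \<le> (2 * norm (1 + z)) powr s"
    using one_plus_norm_le[OF z0] s by (intro powr_mono2) auto
  then have "(1 + norm z) powr s / 2 powr s \<le> norm (1 + z) powr s"
    by (simp add: powr_mult field_simps)
  then have "cos (s * \<eta>) * ((1 + norm z) powr s / 2 powr s) \<le> cos (s * \<eta>) * norm (1 + z) powr s"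
    using cs by (rule mult_left_mono)
  also have "\<dots> \<le> Re ((1 + z) powr of_real s)" using Re_powr_ge[OF A nz s(1)] s \<eta> by simp
  finally show ?thesis by simp
qed

text \<open>\<open>F\<close> is multiplied by \<open>exp (- M1 * (1 + z) powr \<sigma> - \<epsilon>
  * (1 + z) powr \<rho>')\<close>. The first term absorbs the boundary bound, the second, of order
  strictly above \<rho>, absorbs the a priori growth on a large arc. The maximum principle on the
  truncated sector applies, and \<epsilon> disappears in the limit.\<close>

lemma Phragmen_Lindelof_sector:
  assumes F: "F holomorphic_on UNIV" and \<eta>: "0 < \<eta>" "\<eta> < pi / 2"
    and \<sigma>: "0 \<le> \<sigma>" "\<sigma> * \<eta> < pi / 2" and \<rho>: "0 \<le> \<rho>" "\<rho> * \<eta> < pi / 2" and C: "0 \<le> C" and M: "0 \<le> M"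
    and growth: "\<And>z. norm (F z) \<le> exp (C * (1 + norm z) powr \<rho>)"
    and boundary: "\<And>z. Re z = norm z * cos \<eta> \<Longrightarrow> norm (F z) \<le> exp (M * (1 + norm z) powr \<sigma>)"
  obtains M' where "0 \<le> M'"
    "\<And>z. norm z * cos \<eta> \<le> Re z \<Longrightarrow> norm (F z) \<le> exp (M' * (1 + norm z) powr \<sigma>)"
proof
  \<comment> \<open>The loss in \<open>Re_one_plus_powr_ge\<close> is compensated, so that
    \<open>M1 * Re ((1 + z) powr \<sigma>)\<close> is at least
    \<open>M * (1 + norm z) powr \<sigma>\<close> in the sector.\<close>
  define M1 where "M1 = M * 2 powr \<sigma> / cos (\<sigma> * \<eta>)"
  have cos_pos: "0 < cos (s * \<eta>)" if "0 \<le> s" "s * \<eta> < pi / 2" for s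
    using that \<eta> by (intro cos_gt_zero_pi) (auto intro: less_le_trans[of _ 0])
  show M1: "0 \<le> M1" using M cos_pos[OF \<sigma>] by (simp add: M1_def)
  \<comment> \<open>The midpoint between \<rho> and the critical order
    \<open>pi / (2 * \<eta>)\<close>: it beats the growth of \<open>F\<close>, yet its power still
    has positive real part in the sector.\<close>
  define \<rho>' where "\<rho>' = (\<rho> + pi / (2 * \<eta>)) / 2"
  have "\<rho> < pi / (2 * \<eta>)" using \<rho> \<eta> by (simp add: field_simps)
  then have \<rho>': "\<rho> < \<rho>'" "\<rho>' < pi / (2 * \<eta>)" unfolding \<rho>'_def by simp_all
  then have \<rho>'2: "0 \<le> \<rho>'" "\<rho>' * \<eta> < pi / 2" using \<rho> \<eta> by (auto simp: field_simps)
  have c\<eta>: "0 < cos \<eta>" using \<eta> by (intro cos_gt_zero_pi) auto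
  fix z assume z: "norm z * cos \<eta> \<le> Re z"
  have "ln (norm (F z)) \<le> M1 * (1 + norm z) powr \<sigma>" if nz: "F z \<noteq> 0"
  proof (rule field_le_epsilon)
    fix e :: real assume e: "0 < e"
    \<comment> \<open>At the fixed point \<open>z\<close> the auxiliary term then costs exactly
      \<open>e\<close>.\<close>
    define \<epsilon> where "\<epsilon> = e / (1 + norm z) powr \<rho>'"
    have zp: "0 < 1 + norm z" by (simp add: add_pos_nonneg)
    have \<epsilon>: "0 < \<epsilon>" using e zp by (simp add: \<epsilon>_def)
    define c where "c = \<epsilon> * (cos (\<rho>' * \<eta>) / 2 powr \<rho>')"
    have c: "0 < c" using \<epsilon> cos_pos[OF \<rho>'2] by (simp add: c_def)
    define \<delta> where "\<delta> = \<rho>' - \<rho>"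
    have \<delta>: "0 < \<delta>" using \<rho>' by (simp add: \<delta>_def)
    \<comment> \<open>From this radius on \<open>c * (1 + R) powr \<rho>'\<close> exceeds
      \<open>C * (1 + R) powr \<rho>\<close>, which makes the arc harmless; the other entry puts
      \<open>z\<close> inside.\<close>
    define R where "R = max (norm z + 1) ((C / c) powr (1 / \<delta>))"
    have "C / c = ((C / c) powr (1 / \<delta>)) powr \<delta>" using C c \<delta> by (simp add: powr_powr)
    also have "\<dots> \<le> (1 + R) powr \<delta>" using \<delta> by (intro powr_mono2) (auto simp: R_def)
    finally have R: "C / c \<le> (1 + R) powr (\<rho>' - \<rho>)" "norm z < R" by (auto simp: \<delta>_def R_def)
    have R0: "0 < R" using R(2) by (rule le_less_trans[OF norm_ge_zero])
    have RC: "C * (1 + R) powr \<rho> \<le> c * (1 + R) powr \<rho>'"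
    proof -
      have "C \<le> c * (1 + R) powr (\<rho>' - \<rho>)" using R(1) c by (simp add: field_simps)
      then have "C * (1 + R) powr \<rho> \<le> c * (1 + R) powr (\<rho>' - \<rho>) * (1 + R) powr \<rho>"
        by (rule mult_right_mono) simp
      then show ?thesis by (simp add: mult.assoc powr_add[symmetric])
    qed
    define S where "S = {w. norm w * cos \<eta> \<le> Re w \<and> norm w \<le> R}"
    define g where "g = (\<lambda>w. F w * exp (- (of_real M1 * (1 + w) powr of_real \<sigma> + of_real \<epsilon> * (1 + w) powr of_real \<rho>')))"
    have Re0: "0 \<le> Re w" if "norm w * cos \<eta> \<le> Re w" for w
      using that c\<eta> by (meson mult_nonneg_nonneg less_imp_le norm_ge_zero order_trans)
    have slit: "1 + w \<notin> \<real>\<^sub>\<le>\<^sub>0" if "norm w * cos \<eta> \<le> Re w" for w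
      using Re0[OF that] by (auto simp: complex_nonpos_Reals_iff)
    have ghol: "g holomorphic_on S"
      unfolding g_def using slit
      by (intro holomorphic_intros holomorphic_on_subset[OF F]) (auto simp: S_def)
    have closed: "closed S"
      unfolding S_def by (intro closed_Collect_conj closed_Collect_le continuous_intros)
    have g_le: "norm (g w) \<le> norm (F w) * exp (- (M * (1 + norm w) powr \<sigma>) - c * (1 + norm w) powr \<rho>')"
      if w: "norm w * cos \<eta> \<le> Re w" for w
    proof -
      have "M1 * (cos (\<sigma> * \<eta>) / 2 powr \<sigma> * (1 + norm w) powr \<sigma>) \<le> M1 * Re ((1 + w) powr of_real \<sigma>)"
        by (intro mult_left_mono Re_one_plus_powr_ge w \<eta> \<sigma> M1)
      moreover have "M1 * (cos (\<sigma> * \<eta>) / 2 powr \<sigma> * (1 + norm w) powr \<sigma>) = M * (1 + norm w) powr \<sigma>"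
        using cos_pos[OF \<sigma>] by (simp add: M1_def)
      moreover have "\<epsilon> * (cos (\<rho>' * \<eta>) / 2 powr \<rho>' * (1 + norm w) powr \<rho>') \<le> \<epsilon> * Re ((1 + w) powr of_real \<rho>')"
        using \<epsilon> by (intro mult_left_mono Re_one_plus_powr_ge w \<eta> \<rho>'2) simp
      ultimately show ?thesis
        by (simp add: g_def norm_mult norm_exp_eq_Re c_def mult_left_mono)
    qed
    have "norm (g z) \<le> 1"
    proof (rule maximum_modulus_frontier[of g S])
      show "g holomorphic_on interior S"
        using ghol interior_subset by (rule holomorphic_on_subset)
      show "continuous_on (closure S) g"
        using holomorphic_on_imp_continuous_on[OF ghol] closed by simp
      show "bounded S" by (rule bounded_subset[of "cball 0 R"]) (auto simp: S_def)
      show "z \<in> S" using z R by (simp add: S_def)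
      fix w assume w: "w \<in> frontier S"
      then have wS: "w \<in> S" using closed by (simp add: frontier_def)
      then have wsec: "norm w * cos \<eta> \<le> Re w" by (simp add: S_def)
      have "{w. norm w * cos \<eta> < Re w \<and> norm w < R} \<subseteq> interior S"
        by (rule interior_maximal)
           (auto simp: S_def intro!: open_Collect_conj open_Collect_less continuous_intros)
      then have "\<not> (norm w * cos \<eta> < Re w \<and> norm w < R)" using w by (auto simp: frontier_def)
      then consider "Re w = norm w * cos \<eta>" | "norm w = R" using wS by (auto simp: S_def)
      then have "norm (F w) \<le> exp (M * (1 + norm w) powr \<sigma> + c * (1 + norm w) powr \<rho>')"
      proof cases
        case 1
        have "0 \<le> c * (1 + norm w) powr \<rho>'" using c by simp
        then have "exp (M * (1 + norm w) powr \<sigma>) \<le> exp (M * (1 + norm w) powr \<sigma> + c * (1 + norm w) powr \<rho>')" by simp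
        with boundary[OF 1] show ?thesis by (rule order_trans)
      next
        case 2
        have "0 \<le> M * (1 + norm w) powr \<sigma>" using M by simp
        then have "exp (C * (1 + norm w) powr \<rho>) \<le> exp (M * (1 + norm w) powr \<sigma> + c * (1 + norm w) powr \<rho>')"
          using RC 2 by simp
        with growth[of w] show ?thesis by (rule order_trans)
      qed
      then have "norm (F w) * exp (- (M * (1 + norm w) powr \<sigma>) - c * (1 + norm w) powr \<rho>')
          \<le> exp (M * (1 + norm w) powr \<sigma> + c * (1 + norm w) powr \<rho>') * exp (- (M * (1 + norm w) powr \<sigma>) - c * (1 + norm w) powr \<rho>')"
        by (rule mult_right_mono) simp
      also have "\<dots> = 1" by (simp add: exp_add[symmetric])
      finally show "norm (g w) \<le> 1" using g_le[OF wsec] by linarith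
    qed
    then have "norm (F z) \<le> exp (M1 * Re ((1 + z) powr of_real \<sigma>) + \<epsilon> * Re ((1 + z) powr of_real \<rho>'))"
    proof -
      have "norm (F z) = norm (g z) * exp (M1 * Re ((1 + z) powr of_real \<sigma>) + \<epsilon> * Re ((1 + z) powr of_real \<rho>'))"
        by (simp add: g_def norm_mult norm_exp_eq_Re mult.assoc exp_add[symmetric])
      then show ?thesis using \<open>norm (g z) \<le> 1\<close> by (simp add: mult_left_le_one_le)
    qed
    then have "ln (norm (F z)) \<le> M1 * Re ((1 + z) powr of_real \<sigma>) + \<epsilon> * Re ((1 + z) powr of_real \<rho>')"
      using nz by (metis ln_exp ln_le_cancel_iff exp_gt_zero zero_less_norm_iff)
    also have "\<dots> \<le> M1 * (1 + norm z) powr \<sigma> + \<epsilon> * (1 + norm z) powr \<rho>'"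
    proof -
      have "Re ((1 + z) powr of_real s) \<le> (1 + norm z) powr s" if "0 \<le> s" for s
      proof -
        have nz1: "1 + z \<noteq> 0" using slit[OF z] by auto
        have "Re ((1 + z) powr of_real s) \<le> norm ((1 + z) powr of_real s)" by (rule complex_Re_le_cmod)
        also have "\<dots> = norm (1 + z) powr s" using nz1 by (simp add: powr_def norm_exp_eq_Re)
        also have "\<dots> \<le> (1 + norm z) powr s"
          using that norm_triangle_ineq[of 1 z] by (intro powr_mono2) auto
        finally show ?thesis .
      qed
      then show ?thesis using M1 \<epsilon> \<sigma>(1) \<rho>'2(1) by (intro add_mono mult_left_mono) auto
    qed
    also have "\<epsilon> * (1 + norm z) powr \<rho>' = e" using zp by (simp add: \<epsilon>_def)
    finally show "ln (norm (F z)) \<le> M1 * (1 + norm z) powr \<sigma> + e" .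
  qed
  then show "norm (F z) \<le> exp (M1 * (1 + norm z) powr \<sigma>)"
    by (cases "F z = 0") (auto, metis exp_le_cancel_iff exp_ln zero_less_norm_iff)
qed

section \<open>Growth on domains at a distance from the poles\<close>

text \<open>The known point with \<open>B w \<noteq> 0\<close> need not be 1. The affine map
  \<open>\<psi>\<close> preserves the half-plane and sends 1 to \<open>w\<close>; it alters the
  bounds only by constants depending on \<open>w\<close>.\<close>

lemma quotient_growth_half_plane:
  assumes f: "f holomorphic_on {z. 0 < Re z}" and B: "B holomorphic_on {z. 0 < Re z}" and C: "0 \<le> C"
    and BC: "\<And>z. 0 < Re z \<Longrightarrow> norm (B z) \<le> C * (1 + norm z) ^ N"
    and AC: "\<And>z. 0 < Re z \<Longrightarrow> norm (f z * B z) \<le> C * (1 + norm z) ^ N"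
    and w: "0 < Re w" "B w \<noteq> 0"
  obtains K where "0 \<le> K" "\<And>z. 0 < Re z \<Longrightarrow> norm (f z) \<le> exp (K * ((1 + norm z)\<^sup>2 / Re z))"
proof -
  define \<psi> where "\<psi> = (\<lambda>z. of_real (Re w) * z + \<i> * of_real (Im w))"
  have \<psi>: "0 < Re (\<psi> z)" if "0 < Re z" for z using that w by (simp add: \<psi>_def)
  have \<psi>1: "\<psi> 1 = w" by (simp add: \<psi>_def complex_eq_iff)
  have hol: "(\<lambda>z. g (\<psi> z)) holomorphic_on {z. 0 < Re z}" if "g holomorphic_on {z. 0 < Re z}" for g
  proof -
    have "g \<circ> \<psi> holomorphic_on {z. 0 < Re z}"
      by (rule holomorphic_on_compose_gen[OF _ that]) (use \<psi> in \<open>auto simp: \<psi>_def intro!: holomorphic_intros\<close>)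
    then show ?thesis by (simp add: o_def)
  qed
  define D where "D = C * (1 + norm w) ^ N"
  have D: "0 \<le> D" using C by (simp add: D_def)
  have le: "C * (1 + norm (\<psi> z)) ^ N \<le> D * (1 + norm z) ^ N" for z
  proof -
    have "norm (\<psi> z) \<le> \<bar>Re w\<bar> * norm z + \<bar>Im w\<bar>"
      unfolding \<psi>_def by (rule norm_triangle_le) (simp add: norm_mult)
    also have "\<dots> \<le> norm w * norm z + norm w"
      by (intro add_mono mult_right_mono abs_Re_le_cmod abs_Im_le_cmod) simp
    finally have "1 + norm (\<psi> z) \<le> (1 + norm w) * (1 + norm z)"
      using norm_ge_zero[of z] unfolding distrib_left distrib_right mult_1 mult_1_right by linarith
    then have "(1 + norm (\<psi> z)) ^ N \<le> ((1 + norm w) * (1 + norm z)) ^ N" by (intro power_mono) auto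
    then show ?thesis unfolding D_def power_mult_distrib mult.assoc using C by (rule mult_left_mono)
  qed
  obtain B' where B': "B' holomorphic_on {z. 0 < Re z}" "B' 1 \<noteq> 0"
    "\<And>z. 0 < Re z \<Longrightarrow> norm (B' z) \<le> 1" "\<And>z. 0 < Re z \<Longrightarrow> norm (f (\<psi> z) * B' z) \<le> 1"
  proof (rule quotient_normalize_half_plane[OF hol[OF B] D])
    show "norm (B (\<psi> z)) \<le> D * (1 + norm z) ^ N" "norm (f (\<psi> z) * B (\<psi> z)) \<le> D * (1 + norm z) ^ N"
      if "0 < Re z" for z using BC[OF \<psi>[OF that]] AC[OF \<psi>[OF that]] le[of z] by linarith+
    show "B (\<psi> 1) \<noteq> 0" using w \<psi>1 by simp
  qed (rule that)
  define L where "L = ln (2 / norm (B' 1))"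
  have L: "0 \<le> L" using B'(2) B'(3)[of 1] by (simp add: L_def)
  define K where "K = (1 + norm w)\<^sup>2 / Re w * L"
  show ?thesis
  proof
    show "0 \<le> K" using L w by (simp add: K_def)
    fix z assume z: "0 < Re z"
    define v where "v = (z - \<i> * of_real (Im w)) / of_real (Re w)"
    have v: "\<psi> v = z" "Re v = Re z / Re w" using w by (auto simp: \<psi>_def v_def)
    have "v + 1 = (z + cnj w) / of_real (Re w)"
      using w by (simp add: v_def complex_eq_iff field_simps)
    then have "norm (v + 1) = norm (z + cnj w) / Re w" using w by (simp add: norm_divide)
    then have "(norm (v + 1))\<^sup>2 / Re v = (norm (z + cnj w))\<^sup>2 / (Re w * Re z)"
      using w z by (simp add: v(2) power2_eq_square)
    also have "\<dots> \<le> ((1 + norm w) * (1 + norm z))\<^sup>2 / (Re w * Re z)"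
    proof (rule divide_right_mono[OF power_mono])
      have "norm (z + cnj w) \<le> norm z + norm w" using norm_triangle_ineq[of z "cnj w"] by simp
      also have "\<dots> \<le> (1 + norm w) * (1 + norm z)" by (simp add: algebra_simps)
      finally show "norm (z + cnj w) \<le> (1 + norm w) * (1 + norm z)" .
    qed (use w z in auto)
    finally have "(norm (v + 1))\<^sup>2 / Re v * L \<le> ((1 + norm w) * (1 + norm z))\<^sup>2 / (Re w * Re z) * L"
      using L by (rule mult_right_mono)
    also have "\<dots> = K * ((1 + norm z)\<^sup>2 / Re z)" by (simp add: K_def power_mult_distrib)
    finally have "exp ((norm (v + 1))\<^sup>2 / Re v * L) \<le> exp (K * ((1 + norm z)\<^sup>2 / Re z))" by simp
    moreover have "norm (f (\<psi> v)) \<le> exp ((norm (v + 1))\<^sup>2 / Re v * ln (2 / norm (B' 1)))"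
      by (rule quotient_bound_half_plane[OF hol[OF f] B'(1,3,4,2)]) (use z w v in auto)
    ultimately show "norm (f z) \<le> exp (K * ((1 + norm z)\<^sup>2 / Re z))"
      unfolding v(1) L_def by (rule order_trans[rotated])
  qed
qed

section \<open>Quotients of two transforms on pole-free half-planes and their conformal
  images\<close>

locale cauchy_quotient =
  fixes t a b :: "nat \<Rightarrow> complex" and k m :: nat and F :: "complex \<Rightarrow> complex"
  assumes T: "admissible_seq t" and a: "cauchy_coeff_ok t k a" and b: "cauchy_coeff_ok t m b"
    and nz: "\<exists>z. z \<notin> range t \<and> reg_cauchy t b m z \<noteq> 0"
    and F: "F holomorphic_on UNIV"
    and quot: "\<And>z. z \<notin> range t \<Longrightarrow> F z * reg_cauchy t b m z = reg_cauchy t a k z"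
begin

definition cauchy_const :: real where
  "cauchy_const = (\<Sum>n. norm (a n) / norm (t n) ^ (k + 1)) + (\<Sum>n. norm (b n) / norm (t n) ^ (m + 1))"

lemma cauchy_const_nonneg: "0 \<le> cauchy_const"
  using a b unfolding cauchy_const_def cauchy_coeff_ok_def by (intro add_nonneg_nonneg suminf_nonneg) auto

text \<open>One number \<open>X\<close> controls both the size of the point and its relative
  separation from the poles. In the applications \<open>X\<close> is a polynomial in the modulus of
  a parameter, and hence so are the bounds.\<close>

lemma cauchy_bounds:
  assumes X: "1 \<le> X" "norm w \<le> X" "\<And>n. norm (t n) \<le> X * norm (w - t n)"
  shows "w \<notin> range t" "norm (reg_cauchy t b m w) \<le> cauchy_const * X ^ (k + m + 1)"
    "norm (F w * reg_cauchy t b m w) \<le> cauchy_const * X ^ (k + m + 1)"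
proof -
  have t0: "t n \<noteq> 0" for n using T by (simp add: admissible_seq_def)
  have "w \<noteq> t n" for n using X(3)[of n] t0[of n] by auto
  then show wT: "w \<notin> range t" by auto
  have apart: "(1 / X) * norm (t n) \<le> norm (w - t n)" for n
    using X(3)[of n] X(1) by (simp add: field_simps)
  have *: "norm w ^ j * (M / (1 / X)) \<le> cauchy_const * X ^ (k + m + 1)"
    if "j \<le> k + m" "0 \<le> M" "M \<le> cauchy_const" for j M
  proof -
    have "norm w ^ j \<le> X ^ j" using X by (intro power_mono) auto
    also have "\<dots> \<le> X ^ (k + m)" using that X by (intro power_increasing) auto
    finally have "norm w ^ j * (M * X) \<le> X ^ (k + m) * (cauchy_const * X)"
      using that X by (intro mult_mono mult_right_mono) auto
    then show ?thesis by (simp add: mult_ac)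
  qed
  have M: "0 \<le> (\<Sum>n. norm (a n) / norm (t n) ^ (k + 1))" "0 \<le> (\<Sum>n. norm (b n) / norm (t n) ^ (m + 1))"
    using a b unfolding cauchy_coeff_ok_def by (auto intro!: suminf_nonneg)
  have X0: "0 < 1 / X" using X by simp
  show "norm (reg_cauchy t b m w) \<le> cauchy_const * X ^ (k + m + 1)"
    using reg_cauchy_bound[OF T b X0 apart] *[OF _ M(2)] M(1) unfolding cauchy_const_def
    by (meson le_add2 le_add_same_cancel2 order_trans)
  show "norm (F w * reg_cauchy t b m w) \<le> cauchy_const * X ^ (k + m + 1)"
    unfolding quot[OF wT]
    using reg_cauchy_bound[OF T a X0 apart] *[OF _ M(1)] M(2) unfolding cauchy_const_def
    by (meson le_add1 le_add_same_cancel1 order_trans)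
qed

lemma reg_cauchy_compose_holomorphic:
  assumes "\<phi> holomorphic_on S" "\<And>z. z \<in> S \<Longrightarrow> \<phi> z \<notin> range t"
  shows "(\<lambda>z. reg_cauchy t b m (\<phi> z)) holomorphic_on S"
proof -
  have "reg_cauchy t b m \<circ> \<phi> holomorphic_on S"
    by (rule holomorphic_on_compose_gen[OF assms(1) reg_cauchy_holomorphic[OF T b]]) (use assms(2) in auto)
  then show ?thesis by (simp add: o_def)
qed

text \<open>The parametrization \<open>\<phi>\<close> is affine (\<open>j = 1\<close>) for a
  half-plane and a power map (\<open>j = 2\<close>) for the complement of an angle.\<close>

lemma growth_along:
  assumes \<phi>: "\<phi> holomorphic_on {z. 0 < Re z}" and D: "1 \<le> D"
    and bound: "\<And>z. 0 < Re z \<Longrightarrow> norm (\<phi> z) \<le> D * (1 + norm z) ^ j"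
    and apart: "\<And>z n. 0 < Re z \<Longrightarrow> norm (t n) \<le> D * (1 + norm z) ^ j * norm (\<phi> z - t n)"
    and w: "0 < Re w" "reg_cauchy t b m (\<phi> w) \<noteq> 0"
  obtains K where "0 \<le> K" "\<And>z. 0 < Re z \<Longrightarrow> norm (F (\<phi> z)) \<le> exp (K * ((1 + norm z)\<^sup>2 / Re z))"
proof -
  have X: "1 \<le> D * (1 + norm z) ^ j" for z :: complex
    using mult_mono[OF D, of 1 "(1 + norm z) ^ j"] D by (simp add: one_le_power)
  note cb = cauchy_bounds[OF X bound apart]
  have e: "cauchy_const * (D * (1 + norm z) ^ j) ^ (k + m + 1) = (cauchy_const * D ^ (k + m + 1)) * (1 + norm z) ^ (j * (k + m + 1))" for z :: complex
    by (simp only: power_mult_distrib power_mult[symmetric] mult.assoc)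
  show ?thesis
  proof (rule quotient_growth_half_plane[of "\<lambda>z. F (\<phi> z)" "\<lambda>z. reg_cauchy t b m (\<phi> z)" "cauchy_const * D ^ (k + m + 1)" "j * (k + m + 1)" w])
    have "F \<circ> \<phi> holomorphic_on {z. 0 < Re z}" by (rule holomorphic_on_compose_gen[OF \<phi> F]) simp
    then show "(\<lambda>z. F (\<phi> z)) holomorphic_on {z. 0 < Re z}" by (simp add: o_def)
    show "(\<lambda>z. reg_cauchy t b m (\<phi> z)) holomorphic_on {z. 0 < Re z}"
      by (rule reg_cauchy_compose_holomorphic[OF \<phi>]) (use cb(1) in auto)
    show "0 \<le> cauchy_const * D ^ (k + m + 1)" using cauchy_const_nonneg D by simp
  qed (use cb(2,3)[unfolded e] w that in auto)
qed

text \<open>The point is sought in \<open>1 < Re w\<close> so that the half-plane can later be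
  translated by \<open>w - 1\<close> without leaving its pole-free range.\<close>

lemma half_plane_point:
  assumes v: "norm v = 1" and apart: "\<And>z n. 0 < Re z \<Longrightarrow> 1 \<le> norm (q + v * z - t n)"
  obtains w where "1 < Re w" "reg_cauchy t b m (q + v * w) \<noteq> 0"
proof -
  define U where "U = (\<lambda>z. q + v * z) ` {z. 1 < Re z}"
  have "v \<noteq> 0" using v by auto
  have "open U"
  proof -
    have "U = {y. 1 < Re ((y - q) / v)}"
    proof (intro equalityI subsetI)
      fix y assume "y \<in> {y. 1 < Re ((y - q) / v)}"
      then show "y \<in> U" unfolding U_def using \<open>v \<noteq> 0\<close> by (intro image_eqI[of _ _ "(y - q) / v"]) auto
    qed (use \<open>v \<noteq> 0\<close> in \<open>auto simp: U_def\<close>)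
    also have "open \<dots>" using \<open>v \<noteq> 0\<close> by (intro open_Collect_less continuous_intros) auto
    finally show ?thesis .
  qed
  moreover have "U \<noteq> {}" unfolding U_def by (auto intro!: exI[of _ 2])
  moreover have "U \<inter> range t = {}"
  proof -
    have "q + v * z \<noteq> t n" if "1 < Re z" for z n
      using apart[of z n] that by auto
    then show ?thesis unfolding U_def by blast
  qed
  ultimately show ?thesis using nonzero_in_open[OF T b nz, of U] that by (auto simp: U_def)
qed

text \<open>An absolute distance of 1 gives relative separation: \<open>norm (t n)\<close> is at
  most the modulus of the point plus the distance, hence at most \<open>1 +\<close> that modulus
  times the distance.\<close>

lemma half_plane_apart:
  assumes "norm v = 1" "1 \<le> norm (q + v * z - t n)"
  shows "norm (q + v * z) \<le> (1 + norm q) * (1 + norm z) ^ 1"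
    "norm (t n) \<le> (1 + norm q) * (1 + norm z) ^ 1 * norm (q + v * z - t n)"
proof -
  have n: "norm (q + v * z) \<le> norm q + norm z" using norm_triangle_ineq[of q "v * z"] assms(1) by (simp add: norm_mult)
  moreover have "0 \<le> norm q * norm z" by simp
  moreover have e: "(1 + norm q) * (1 + norm z) ^ 1 = 1 + norm q + norm z + norm q * norm z" by (simp add: algebra_simps)
  ultimately show "norm (q + v * z) \<le> (1 + norm q) * (1 + norm z) ^ 1" by linarith
  define X where "X = norm q + norm z"
  have "norm (t n) \<le> norm (q + v * z) + norm (q + v * z - t n)" using norm_triangle_ineq4[of "q + v * z" "q + v * z - t n"] by simp
  also have "\<dots> \<le> X * norm (q + v * z - t n) + norm (q + v * z - t n)"
    using n mult_mono[of X X 1 "norm (q + v * z - t n)"] assms(2) by (simp add: X_def)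
  also have "\<dots> = (1 + X) * norm (q + v * z - t n)" by (simp add: algebra_simps)
  also have "\<dots> \<le> (1 + norm q) * (1 + norm z) ^ 1 * norm (q + v * z - t n)"
    unfolding e X_def by (intro mult_right_mono) auto
  finally show "norm (t n) \<le> (1 + norm q) * (1 + norm z) ^ 1 * norm (q + v * z - t n)" .
qed

lemma growth_half_plane:
  assumes v: "norm v = 1" and apart: "\<And>z n. 0 < Re z \<Longrightarrow> 1 \<le> norm (q + v * z - t n)"
  obtains K where "0 \<le> K" "\<And>z. 0 < Re z \<Longrightarrow> norm (F (q + v * z)) \<le> exp (K * ((1 + norm z)\<^sup>2 / Re z))"
proof -
  obtain w where w: "1 < Re w" "reg_cauchy t b m (q + v * w) \<noteq> 0"
    using half_plane_point[OF assms] by blast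
  show ?thesis
    by (rule growth_along[of "\<lambda>z. q + v * z" "1 + norm q" 1 w])
      (use half_plane_apart[OF v apart] w that in \<open>auto intro!: holomorphic_intros\<close>)
qed

text \<open>The line sought is the boundary of a translate of the half-plane, placed so that
  \<open>B\<close> does not vanish at the point with parameter 1; harmonic measure from there has
  density \<open>1 / (pi * (1 + x\<^sup>2))\<close>. The base point is moved by translation alone,
  because a dilation would destroy \<open>norm u = 1\<close>.\<close>

lemma cartwright_half_plane:
  assumes v: "norm v = 1" and apart: "\<And>z n. 0 < Re z \<Longrightarrow> 1 \<le> norm (q + v * z - t n)"
    and type: "finite_exp_type F"
  shows "\<exists>c u. norm u = 1 \<and> cartwright (\<lambda>z. F (u * z + c))"
proof -
  obtain w where w: "1 < Re w" "reg_cauchy t b m (q + v * w) \<noteq> 0"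
    using half_plane_point[OF v apart] by blast
  define q' where "q' = q + v * (w - 1)"
  have apart': "1 \<le> norm (q' + v * z - t n)" if "0 < Re z" for z n
    using apart[of "z + (w - 1)" n] that w(1) by (simp add: q'_def algebra_simps)
  have hol: "(\<lambda>z. F (g z)) holomorphic_on S" if "g holomorphic_on S" for g S
    using holomorphic_on_compose_gen[OF that F] by (simp add: o_def)
  have X: "1 \<le> (1 + norm q') * (1 + norm z) ^ 1" for z :: complex
    using mult_mono[of 1 "1 + norm q'" 1 "1 + norm z"] by simp
  note cb = cauchy_bounds[OF X half_plane_apart[OF v apart']]
  have e: "cauchy_const * ((1 + norm q') * (1 + norm z) ^ 1) ^ (k + m + 1) = (cauchy_const * (1 + norm q') ^ (k + m + 1)) * (1 + norm z) ^ (k + m + 1)" for z :: complex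
    by (simp only: power_mult_distrib power_one_right mult.assoc)
  obtain B' where B': "B' holomorphic_on {z. 0 < Re z}" "B' 1 \<noteq> 0"
    "\<And>z. 0 < Re z \<Longrightarrow> norm (B' z) \<le> 1" "\<And>z. 0 < Re z \<Longrightarrow> norm (F (q' + v * z) * B' z) \<le> 1"
  proof (rule quotient_normalize_half_plane[of "\<lambda>z. reg_cauchy t b m (q' + v * z)" "cauchy_const * (1 + norm q') ^ (k + m + 1)" "k + m + 1" "\<lambda>z. F (q' + v * z)"])
    show "(\<lambda>z. reg_cauchy t b m (q' + v * z)) holomorphic_on {z. 0 < Re z}"
      by (rule reg_cauchy_compose_holomorphic) (use cb(1) in \<open>auto intro!: holomorphic_intros\<close>)
    show "0 \<le> cauchy_const * (1 + norm q') ^ (k + m + 1)" using cauchy_const_nonneg by simp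
    show "reg_cauchy t b m (q' + v * 1) \<noteq> 0" using w(2) by (simp add: q'_def algebra_simps)
    show "norm (reg_cauchy t b m (q' + v * z)) \<le> cauchy_const * (1 + norm q') ^ (k + m + 1) * (1 + norm z) ^ (k + m + 1)"
      "norm (F (q' + v * z) * reg_cauchy t b m (q' + v * z)) \<le> cauchy_const * (1 + norm q') ^ (k + m + 1) * (1 + norm z) ^ (k + m + 1)"
      if "0 < Re z" for z using cb(2,3)[unfolded e, OF that that] by auto
  qed (rule that)
  have int: "integrable lborel (\<lambda>x. ln (1 + norm (F (q' + v * (- \<i> * of_real x)))) / (1 + x\<^sup>2))"
    by (rule integrable_boundary_half_plane[OF _ B'(1,3,4,2)]) (auto intro!: hol holomorphic_intros)
  define G where "G = (\<lambda>z. F ((- \<i> * v) * z + q'))"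
  have Gh: "G holomorphic_on UNIV" unfolding G_def by (intro hol holomorphic_intros)
  obtain A B where AB: "\<And>z. norm (F z) \<le> A * exp (B * norm z)" using type by (auto simp: finite_exp_type_def)
  have A: "0 \<le> A" using order_trans[OF norm_ge_zero AB[of 0]] by simp
  have "finite_exp_type G"
    unfolding finite_exp_type_def
  proof (intro exI allI)
    fix z
    have "norm ((- \<i> * v) * z + q') \<le> norm z + norm q'"
      using norm_triangle_ineq[of "(- \<i> * v) * z" q'] v by (simp add: norm_mult)
    then have "B * norm ((- \<i> * v) * z + q') \<le> \<bar>B\<bar> * (norm z + norm q')"
      by (intro mult_mono) auto
    then have "A * exp (B * norm ((- \<i> * v) * z + q')) \<le> A * exp (\<bar>B\<bar> * (norm z + norm q'))"
      using A by (intro mult_left_mono) auto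
    with AB[of "(- \<i> * v) * z + q'"] show "norm (G z) \<le> A * exp (\<bar>B\<bar> * norm q') * exp (\<bar>B\<bar> * norm z)"
      by (simp add: G_def distrib_left exp_add mult_ac)
  qed
  moreover have "integrable lborel (\<lambda>x::real. max 0 (ln (norm (G (of_real x)))) / (1 + x\<^sup>2))"
  proof (rule Bochner_Integration.integrable_bound[OF int])
    have "continuous_on UNIV (\<lambda>x::real. G (of_real x))"
      by (rule continuous_on_compose2[OF holomorphic_on_imp_continuous_on[OF Gh]]) (auto intro!: continuous_intros)
    then have [measurable]: "(\<lambda>x::real. G (of_real x)) \<in> borel_measurable borel"
      by (rule borel_measurable_continuous_onI)
    show "(\<lambda>x::real. max 0 (ln (norm (G (of_real x)))) / (1 + x\<^sup>2)) \<in> borel_measurable lborel"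
      by measurable
    show "AE x in lborel. norm (max 0 (ln (norm (G (of_real x)))) / (1 + x\<^sup>2))
        \<le> norm (ln (1 + norm (F (q' + v * (- \<i> * of_real x)))) / (1 + x\<^sup>2))"
    proof (intro always_eventually allI)
      fix x :: real
      define y where "y = norm (G (of_real x))"
      have y: "y = norm (F (q' + v * (- \<i> * of_real x)))" by (simp add: y_def G_def algebra_simps)
      have y0: "0 \<le> y" by (simp add: y_def)
      then have "max 0 (ln y) \<le> ln (1 + y)" by (cases "y = 0") auto
      then have "max 0 (ln y) / (1 + x\<^sup>2) \<le> ln (1 + y) / (1 + x\<^sup>2)" by (intro divide_right_mono) auto
      then show "norm (max 0 (ln (norm (G (of_real x)))) / (1 + x\<^sup>2))
        \<le> norm (ln (1 + norm (F (q' + v * (- \<i> * of_real x)))) / (1 + x\<^sup>2))"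
        using y0 unfolding y[symmetric] y_def[symmetric] by simp
    qed
  qed
  ultimately have "cartwright G" using Gh by (simp add: cartwright_def)
  then show ?thesis unfolding G_def using v by (intro exI[of _ q'] exI[of _ "- \<i> * v"]) (simp add: norm_mult)
qed

end

section \<open>Zero type and finite order\<close>

lemma summable_shifted_powr:
  assumes T: "admissible_seq t" and K: "0 < K" and s: "summable (\<lambda>n. norm (t n) powr - K)"
  shows "summable (\<lambda>n. norm (t n - p) powr - K)"
proof (rule summable_comparison_test_ev)
  show "summable (\<lambda>n. 2 powr K * norm (t n) powr - K)" by (intro summable_mult s)
  have "eventually (\<lambda>n. max 1 (2 * norm p) \<le> norm (t n)) sequentially"
    using T by (simp only: admissible_seq_def filterlim_at_top)
  then show "eventually (\<lambda>n. norm (norm (t n - p) powr - K) \<le> 2 powr K * norm (t n) powr - K) sequentially"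
  proof eventually_elim
    case (elim n)
    have "norm (t n) / 2 \<le> norm (t n - p)" using elim norm_triangle_ineq2[of "t n" p] by simp
    then have "norm (t n - p) powr - K \<le> (norm (t n) / 2) powr - K"
      using elim K by (intro powr_mono2') auto
    also have "\<dots> = 2 powr K * norm (t n) powr - K"
      using elim by (simp add: powr_divide powr_minus field_simps)
    finally show ?case by simp
  qed
qed

text \<open>The inequality \<open>ln y \<le> y powr K / K\<close> for
  \<open>y = 2 * x / norm (t n - p)\<close> turns every term into a multiple of
  \<open>x powr K\<close> and of a term of a convergent series.\<close>

lemma pole_weight_le_powr:
  assumes T: "admissible_seq t" and p: "p \<notin> range t" and K: "0 < K"
    and s: "summable (\<lambda>n. norm (t n) powr - K)"
  obtains c where "0 \<le> c" "\<And>x. 0 < x \<Longrightarrow> pole_weight t p x \<le> c * x powr K"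
proof
  define \<Sigma> where "\<Sigma> = (\<Sum>n. norm (t n - p) powr - K)"
  have s': "summable (\<lambda>n. norm (t n - p) powr - K)" by (rule summable_shifted_powr[OF T K s])
  have \<Sigma>: "0 \<le> \<Sigma>" unfolding \<Sigma>_def by (rule suminf_nonneg[OF s']) simp
  show "0 \<le> 2 powr K / K * \<Sigma>" using \<Sigma> K by simp
  fix x :: real assume x: "0 < x"
  have pos: "0 < norm (t n - p)" for n using p by auto
  have "pole_weight t p x \<le> (\<Sum>n | norm (t n - p) < x. (2 * x) powr K / K * norm (t n - p) powr - K)"
    unfolding pole_weight_def
  proof (rule sum_mono)
    fix n
    define y where "y = 2 * x / norm (t n - p)"
    have y: "0 < y" using x pos[of n] by (simp add: y_def)
    have "ln y = ln (y powr K) / K" using y K by (simp add: ln_powr)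
    also have "\<dots> \<le> y powr K / K" using y K by (intro divide_right_mono less_imp_le[OF ln_less_self]) auto
    also have "y powr K = (2 * x) powr K * norm (t n - p) powr - K"
      using x pos[of n] by (simp add: y_def powr_divide powr_minus field_simps)
    finally show "ln (2 * x / norm (t n - p)) \<le> (2 * x) powr K / K * norm (t n - p) powr - K" by (simp add: y_def)
  qed
  also have "\<dots> = (2 * x) powr K / K * (\<Sum>n | norm (t n - p) < x. norm (t n - p) powr - K)"
    by (simp add: sum_distrib_left)
  also have "\<dots> \<le> (2 * x) powr K / K * \<Sigma>"
    unfolding \<Sigma>_def using K by (intro mult_left_mono sum_le_suminf s' finite_poles_in_disc[OF T]) auto
  also have "\<dots> = 2 powr K / K * \<Sigma> * x powr K" using x by (simp add: powr_mult)
  finally show "pole_weight t p x \<le> 2 powr K / K * \<Sigma> * x powr K" .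
qed

text \<open>One zero is divided out at a time; since the points are distinct, the remaining factor
  still vanishes at the next one. Multiple zeros of \<open>G\<close> simply leave zeros in
  \<open>H\<close>.\<close>

lemma entire_divide_zeros:
  assumes G: "G holomorphic_on UNIV" and t: "inj t" and zero: "\<And>n. G (t n) = 0" and I: "finite I"
  shows "\<exists>H. H holomorphic_on UNIV \<and> (\<forall>z. G z = H z * (\<Prod>n\<in>I. z - t n))"
  using I
proof induction
  case empty
  show ?case using G by auto
next
  case (insert j I)
  then obtain H where H: "H holomorphic_on UNIV" "\<And>z. G z = H z * (\<Prod>n\<in>I. z - t n)" by blast
  have "(\<Prod>n\<in>I. t j - t n) \<noteq> 0" using insert(1,2) t by (auto simp: inj_eq)
  then have H0: "H (t j) = 0" using H(2)[of "t j"] zero[of j] by auto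
  define H' where "H' = (\<lambda>z. if z = t j then deriv H (t j) else (H z - H (t j)) / (z - t j))"
  have "H' holomorphic_on UNIV" unfolding H'_def by (rule pole_lemma[OF H(1)]) simp
  moreover have "G z = H' z * (\<Prod>n\<in>insert j I. z - t n)" for z
  proof -
    have "H z = H' z * (z - t j)" using H0 by (simp add: H'_def)
    then show ?thesis using H(2)[of z] insert(1,2) by simp
  qed
  ultimately show ?case by blast
qed

text \<open>Jensen's inequality by hand: \<open>G\<close> is divided by the product over the zeros
  within distance \<open>x\<close>, and the quotient is estimated on the circle of radius
  \<open>3 * x\<close>. There each factor is at least \<open>2 * x\<close>, which matches the
  numerator \<open>2 * x\<close> of the pole weight, and the radius explains
  \<open>\<epsilon> / 3\<close>.\<close>

lemma pole_weight_le_if_cond_Z: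
  assumes T: "admissible_seq t" and Z: "cond_Z t" and p: "p \<notin> range t" and \<epsilon>: "0 < \<epsilon>"
  obtains c where "\<And>x. 0 < x \<Longrightarrow> pole_weight t p x \<le> \<epsilon> * x + c"
proof -
  obtain G where G: "G holomorphic_on UNIV" "zero_exp_type G" "{z. G z = 0} = range t"
    using Z by (auto simp: cond_Z_def)
  obtain A where A: "\<And>z. norm (G z) \<le> A * exp (\<epsilon> / 3 * norm z)"
    using G(2) \<epsilon> unfolding zero_exp_type_def by (metis divide_pos_pos zero_less_numeral)
  have Gp: "G p \<noteq> 0" using G(3) p by auto
  have A0: "0 < A" using less_le_trans[of 0 "norm (G p)", OF _ A[of p]] Gp by (simp add: zero_less_mult_iff)
  show ?thesis
  proof
    fix x :: real assume x: "0 < x"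
    define I where "I = {n. norm (t n - p) < x}"
    have I: "finite I" unfolding I_def by (rule finite_poles_in_disc[OF T])
    have "G (t n) = 0" for n using G(3) by auto
    then obtain H where H: "H holomorphic_on UNIV" "\<And>z. G z = H z * (\<Prod>n\<in>I. z - t n)"
      using entire_divide_zeros[OF G(1) _ _ I, of t] T by (auto simp: admissible_seq_def)
    define M where "M = A * exp (\<epsilon> / 3 * (3 * x + norm p)) / (2 * x) ^ card I"
    have Hp: "norm (H p) \<le> M"
    proof (rule maximum_modulus_frontier[of H "cball p (3 * x)"])
      show "H holomorphic_on interior (cball p (3 * x))" using H(1) by (rule holomorphic_on_subset) simp
      show "continuous_on (closure (cball p (3 * x))) H"
        by (rule holomorphic_on_imp_continuous_on) (rule holomorphic_on_subset[OF H(1)], simp)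
      fix z assume "z \<in> frontier (cball p (3 * x))"
      then have z: "norm (z - p) = 3 * x" using x by (simp add: dist_norm norm_minus_commute)
      have "(2 * x) ^ card I = (\<Prod>n\<in>I. 2 * x)" by simp
      also have "\<dots> \<le> norm (\<Prod>n\<in>I. z - t n)"
        unfolding prod_norm[symmetric]
      proof (rule prod_mono, intro conjI)
        fix n assume "n \<in> I"
        then show "2 * x \<le> norm (z - t n)"
          using norm_triangle_ineq2[of "z - p" "t n - p"] z by (simp add: I_def)
      qed (use x in simp)
      finally have "norm (H z) * (2 * x) ^ card I \<le> norm (G z)"
        unfolding H(2) norm_mult by (rule mult_left_mono) simp
      also have "\<dots> \<le> A * exp (\<epsilon> / 3 * norm z)" by (rule A)
      also have "\<dots> \<le> A * exp (\<epsilon> / 3 * (3 * x + norm p))"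
        using A0 \<epsilon> z norm_triangle_ineq[of "z - p" p] by (intro mult_left_mono) auto
      finally show "norm (H z) \<le> M" using x by (simp add: M_def field_simps)
    qed (use x in auto)
    have pos: "0 < norm (t n - p)" for n using p by auto
    have P0: "0 < (\<Prod>n\<in>I. norm (t n - p))" using pos by (intro prod_pos) auto
    have "norm (G p) = norm (H p) * (\<Prod>n\<in>I. norm (t n - p))"
      unfolding H(2) norm_mult prod_norm[symmetric] by (simp add: norm_minus_commute)
    also have "\<dots> \<le> M * (\<Prod>n\<in>I. norm (t n - p))" using Hp P0 by (intro mult_right_mono) auto
    finally have "ln (norm (G p)) \<le> ln (M * (\<Prod>n\<in>I. norm (t n - p)))"
      using Gp by (intro ln_mono) auto
    also have "\<dots> = ln A + \<epsilon> / 3 * (3 * x + norm p) - (\<Sum>n\<in>I. ln (2 * x)) + (\<Sum>n\<in>I. ln (norm (t n - p)))"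
    proof -
      have "0 < M" using A0 x by (simp add: M_def)
      then have "ln (M * (\<Prod>n\<in>I. norm (t n - p))) = ln M + (\<Sum>n\<in>I. ln (norm (t n - p)))"
        using P0 pos I by (simp add: ln_mult_pos ln_prod)
      moreover have "ln M = ln (A * exp (\<epsilon> / 3 * (3 * x + norm p))) - ln ((2 * x) ^ card I)"
        unfolding M_def using A0 x by (intro ln_divide_pos) auto
      moreover have "ln (A * exp (\<epsilon> / 3 * (3 * x + norm p))) = ln A + \<epsilon> / 3 * (3 * x + norm p)"
        using A0 by (simp only: ln_mult_pos exp_gt_zero ln_exp)
      moreover have "ln ((2 * x) ^ card I) = (\<Sum>n\<in>I. ln (2 * x))" by (simp only: ln_realpow sum_constant)
      ultimately show ?thesis by linarith
    qed
    also have "\<dots> = ln A + \<epsilon> * x + \<epsilon> / 3 * norm p - pole_weight t p x"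
    proof -
      have "pole_weight t p x = (\<Sum>n\<in>I. ln (2 * x) - ln (norm (t n - p)))"
        unfolding pole_weight_def I_def using x pos by (intro sum.cong ln_divide_pos refl) auto
      then show ?thesis by (simp add: sum_subtractf distrib_left)
    qed
    finally show "pole_weight t p x \<le> \<epsilon> * x + (ln A + \<epsilon> / 3 * norm p - ln (norm (G p)))" by linarith
  qed
qed

section \<open>Growth of the quotient in the whole plane\<close>

context cauchy_quotient
begin

lemma growth_pole_weight:
  obtains p C E where "p \<notin> range t" "0 \<le> C" "1 \<le> E"
    "\<And>z. \<exists>R. 1 \<le> R \<and> R \<le> E * (1 + norm z) \<and> norm (F z) \<le> exp (C * (1 + ln R + pole_weight t p (4 * R)))"
proof -
  obtain p where p: "p \<notin> range t" "reg_cauchy t b m p \<noteq> 0" using nz by blast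
  obtain C where C: "0 \<le> C" "\<And>R z. 1 + norm p \<le> R \<Longrightarrow> norm (z - p) \<le> R / 2 \<Longrightarrow>
      norm (F z) \<le> exp (C * (1 + ln R + pole_weight t p (4 * R)))"
    using quotient_growth[OF T a b F quot p] by blast
  show ?thesis
  proof
    show "p \<notin> range t" "0 \<le> C" "1 \<le> 2 + 3 * norm p" using p C by auto
    fix z
    \<comment> \<open>This meets both requirements on the radius, \<open>1 + norm p \<le> R\<close>
      and \<open>norm (z - p) \<le> R / 2\<close>, and remains linear in
      \<open>norm z\<close>.\<close>
    define R where "R = 1 + norm p + 2 * norm (z - p)"
    have "R \<le> 1 + 3 * norm p + 2 * norm z" using norm_triangle_ineq4[of z p] by (simp add: R_def)
    moreover have "0 \<le> norm p * norm z" by simp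
    moreover have "(2 + 3 * norm p) * (1 + norm z) = 2 + 3 * norm p + 2 * norm z + 3 * (norm p * norm z)"
      by (simp add: algebra_simps)
    ultimately have "R \<le> (2 + 3 * norm p) * (1 + norm z)" by linarith
    moreover have "norm (F z) \<le> exp (C * (1 + ln R + pole_weight t p (4 * R)))"
      by (rule C(2)) (auto simp: R_def)
    moreover have "1 \<le> R" by (simp add: R_def)
    ultimately show "\<exists>R. 1 \<le> R \<and> R \<le> (2 + 3 * norm p) * (1 + norm z) \<and>
      norm (F z) \<le> exp (C * (1 + ln R + pole_weight t p (4 * R)))" by blast
  qed
qed

lemma zero_exp_type_if_cond_Z:
  assumes "cond_Z t"
  shows "zero_exp_type F"
  unfolding zero_exp_type_def
proof (intro allI impI)
  fix e :: real assume e: "0 < e"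
  obtain p C E where p: "p \<notin> range t" and C: "0 \<le> C" and E: "1 \<le> E"
    and bd: "\<And>z. \<exists>R. 1 \<le> R \<and> R \<le> E * (1 + norm z) \<and> norm (F z) \<le> exp (C * (1 + ln R + pole_weight t p (4 * R)))"
    by (rule growth_pole_weight) (rule that)
  \<comment> \<open>The pole weight at \<open>4 * R\<close> costs \<open>4 * \<delta> * R\<close>
    and \<open>ln R\<close> another \<open>\<delta> * R\<close>, hence 5; \<open>C + 1\<close>
    instead of \<open>C\<close> keeps the denominator positive.\<close>
  define \<delta> where "\<delta> = e / (5 * (C + 1) * E)"
  have \<delta>: "0 < \<delta>" using e C E by (simp add: \<delta>_def)
  obtain c where c: "\<And>x. 0 < x \<Longrightarrow> pole_weight t p x \<le> \<delta> * x + c"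
    using pole_weight_le_if_cond_Z[OF T assms p \<delta>] by blast
  define c' where "c' = C * (1 - ln \<delta> + c) + e"
  have "norm (F z) \<le> exp c' * exp (e * norm z)" for z
  proof -
    obtain R where R: "1 \<le> R" "R \<le> E * (1 + norm z)" "norm (F z) \<le> exp (C * (1 + ln R + pole_weight t p (4 * R)))"
      using bd by blast
    have "ln R = ln (\<delta> * R) - ln \<delta>" using \<delta> R by (simp add: ln_mult_pos)
    also have "ln (\<delta> * R) \<le> \<delta> * R" using \<delta> R by (intro less_imp_le[OF ln_less_self]) auto
    finally have "1 + ln R + pole_weight t p (4 * R) \<le> (1 - ln \<delta> + c) + 5 * \<delta> * R"
      using c[of "4 * R"] R(1) by simp
    then have "C * (1 + ln R + pole_weight t p (4 * R)) \<le> C * ((1 - ln \<delta> + c) + 5 * \<delta> * R)"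
      using C by (rule mult_left_mono)
    also have "\<dots> = C * (1 - ln \<delta> + c) + C * (5 * \<delta> * R)" by (rule distrib_left)
    also have "C * (5 * \<delta> * R) \<le> (C + 1) * (5 * \<delta> * (E * (1 + norm z)))"
      using C \<delta> R by (intro mult_mono) auto
    also have "\<dots> = (5 * (C + 1) * E * \<delta>) * (1 + norm z)" by (simp only: mult_ac)
    also have "5 * (C + 1) * E * \<delta> = e" using C E by (simp add: \<delta>_def)
    finally have "C * (1 + ln R + pole_weight t p (4 * R)) \<le> c' + e * norm z"
      by (simp add: c'_def distrib_left)
    then have "exp (C * (1 + ln R + pole_weight t p (4 * R))) \<le> exp (c' + e * norm z)" by simp
    with R(3) show ?thesis unfolding exp_add by (rule order_trans)
  qed
  then show "\<exists>A. \<forall>z. norm (F z) \<le> A * exp (e * norm z)" by blast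
qed

text \<open>The a priori order required by Phragmen-Lindelof; both \<open>ln R\<close> and the pole
  weight are of order \<open>R powr K\<close>. It also bounds \<open>F\<close> near the origin of
  the chosen coordinates.\<close>

lemma finite_order_affine:
  assumes K: "0 < K" and s: "summable (\<lambda>n. norm (t n) powr - K)" and u: "norm u = 1"
  obtains C where "0 \<le> C" "\<And>z. norm (F (q + u * z)) \<le> exp (C * (1 + norm z) powr K)"
proof -
  obtain p C E where p: "p \<notin> range t" and C: "0 \<le> C" and E: "1 \<le> E"
    and bd: "\<And>z. \<exists>R. 1 \<le> R \<and> R \<le> E * (1 + norm z) \<and> norm (F z) \<le> exp (C * (1 + ln R + pole_weight t p (4 * R)))"
    by (rule growth_pole_weight) (rule that)
  obtain c where c: "0 \<le> c" "\<And>x. 0 < x \<Longrightarrow> pole_weight t p x \<le> c * x powr K"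
    using pole_weight_le_powr[OF T p K s] by blast
  define E' where "E' = E * (1 + norm q)"
  define D where "D = C * (1 + (1 / K + c * 4 powr K) * E' powr K)"
  show ?thesis
  proof
    show "0 \<le> D" using C c K by (simp add: D_def)
    fix z :: complex
    define X where "X = (1 + norm z) powr K"
    have X: "1 \<le> X" using K by (simp add: X_def ge_one_powr_ge_zero)
    obtain R where R: "1 \<le> R" "R \<le> E * (1 + norm (q + u * z))"
      "norm (F (q + u * z)) \<le> exp (C * (1 + ln R + pole_weight t p (4 * R)))"
      using bd by blast
    have "norm (q + u * z) \<le> norm q + norm z" using norm_triangle_ineq[of q "u * z"] u by (simp add: norm_mult)
    then have "1 + norm (q + u * z) \<le> (1 + norm q) * (1 + norm z)"
      using mult_nonneg_nonneg[OF norm_ge_zero[of q] norm_ge_zero[of z]] unfolding distrib_left distrib_right by linarith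
    then have "E * (1 + norm (q + u * z)) \<le> E' * (1 + norm z)" unfolding E'_def mult.assoc using E by (intro mult_left_mono) auto
    with R have "R \<le> E' * (1 + norm z)" by linarith
    then have "R powr K \<le> (E' * (1 + norm z)) powr K" using R K by (intro powr_mono2) auto
    also have "\<dots> = E' powr K * X" unfolding X_def by (rule powr_mult)
    finally have RK: "R powr K \<le> E' powr K * X" .
    have "ln R = ln (R powr K) / K" using R K by (simp add: ln_powr)
    also have "\<dots> \<le> R powr K / K" using R K by (intro divide_right_mono less_imp_le[OF ln_less_self]) auto
    finally have "1 + ln R + pole_weight t p (4 * R) \<le> 1 + R powr K / K + c * (4 * R) powr K"
      using c(2)[of "4 * R"] R(1) by simp
    also have "\<dots> = 1 + (1 / K + c * 4 powr K) * R powr K" using R(1) by (simp add: powr_mult algebra_simps)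
    also have "\<dots> \<le> X + (1 / K + c * 4 powr K) * (E' powr K * X)"
      using X RK c K by (intro add_mono mult_left_mono) auto
    finally have "C * (1 + ln R + pole_weight t p (4 * R)) \<le> C * (X + (1 / K + c * 4 powr K) * (E' powr K * X))"
      using C by (rule mult_left_mono)
    also have "\<dots> = D * X" by (simp add: D_def algebra_simps)
    finally have "exp (C * (1 + ln R + pole_weight t p (4 * R))) \<le> exp (D * X)" by simp
    with R(3) show "norm (F (q + u * z)) \<le> exp (D * (1 + norm z) powr K)" unfolding X_def by (rule order_trans)
  qed
qed

end

section \<open>Poles in a strip\<close>

lemma exp_affine_growth_imp_finite_exp_type:
  assumes u: "norm u = 1" and M: "0 \<le> M" and bd: "\<And>z. norm (F (q + u * z)) \<le> exp (M * (1 + norm z))"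
  shows "finite_exp_type F"
  unfolding finite_exp_type_def
proof (intro exI allI)
  fix z
  define w where "w = (z - q) / u"
  have "u \<noteq> 0" using u by auto
  then have w: "q + u * w = z" by (simp add: w_def)
  have "norm w \<le> norm z + norm q" using u by (simp add: w_def norm_divide norm_triangle_ineq4)
  then have "M * (1 + norm w) \<le> M * (1 + norm q) + M * norm z"
    unfolding distrib_left[symmetric] using M by (intro mult_left_mono) auto
  then have "exp (M * (1 + norm w)) \<le> exp (M * (1 + norm q) + M * norm z)" by simp
  with bd[of w] show "norm (F z) \<le> exp (M * (1 + norm q)) * exp (M * norm z)"
    unfolding w exp_add by (rule order_trans)
qed

context cauchy_quotient
begin

lemma holomorphic_affine: "(\<lambda>z. F (q + u * z)) holomorphic_on UNIV"
proof -
  have "F \<circ> (\<lambda>z. q + u * z) holomorphic_on UNIV"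
    by (rule holomorphic_on_compose_gen[OF _ F]) (auto intro!: holomorphic_intros)
  then show ?thesis by (simp add: o_def)
qed

lemma strip_apart:
  assumes u: "norm u = 1" and strip: "\<And>n. \<exists>s::real. norm (t n - (p + of_real s * u)) \<le> h" and z: "0 < Re z"
  shows "1 \<le> norm (p + \<i> * u * of_real (h + 1) + \<i> * u * z - t n)"
proof -
  obtain s :: real where s: "norm (t n - (p + of_real s * u)) \<le> h" using strip by blast
  have h: "0 \<le> h" using s by (meson norm_ge_zero order_trans)
  let ?w = "p + \<i> * u * of_real (h + 1) + \<i> * u * z"
  have "?w - (p + of_real s * u) = u * (\<i> * (of_real (h + 1) + z) - of_real s)" by (simp add: algebra_simps)
  then have "norm (?w - (p + of_real s * u)) = norm (\<i> * (of_real (h + 1) + z) - of_real s)" using u by (simp add: norm_mult)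
  moreover have "h + 1 \<le> norm (\<i> * (of_real (h + 1) + z) - of_real s)"
    using abs_Im_le_cmod[of "\<i> * (of_real (h + 1) + z) - of_real s"] z h by simp
  moreover have "norm (?w - (p + of_real s * u)) \<le> norm (?w - t n) + norm (t n - (p + of_real s * u))"
    using norm_triangle_ineq[of "?w - t n" "t n - (p + of_real s * u)"] by simp
  ultimately show ?thesis using s by linarith
qed

text \<open>In a sector strictly inside the half-plane beside the strip, the distance to the
  boundary line is comparable to \<open>norm z\<close>, so the factor
  \<open>(1 + norm w)\<^sup>2 / Re w\<close> is only linear. Bounded \<open>z\<close> are left to
  the finite order bound.\<close>

lemma strip_growth:
  assumes u: "norm u = 1" and strip: "\<And>n. \<exists>s::real. norm (t n - (p + of_real s * u)) \<le> h"
    and order: "0 < K" "summable (\<lambda>n. norm (t n) powr - K)" and \<eta>: "0 < \<eta>" "\<eta> < pi / 2"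
  obtains M where "0 \<le> M"
    "\<And>z. \<bar>Re z\<bar> \<le> norm z * cos \<eta> \<Longrightarrow> 0 \<le> Im z \<Longrightarrow> norm (F (p + u * z)) \<le> exp (M * (1 + norm z))"
proof -
  have h: "0 \<le> h" using strip[of 0] norm_ge_zero order_trans by blast
  have s: "0 < sin \<eta>" "sin \<eta> \<le> 1" using \<eta> by (auto intro!: sin_gt_zero)
  obtain L where L: "0 \<le> L" "\<And>z. 0 < Re z \<Longrightarrow>
      norm (F (p + \<i> * u * of_real (h + 1) + \<i> * u * z)) \<le> exp (L * ((1 + norm z)\<^sup>2 / Re z))"
    by (rule growth_half_plane[of "\<i> * u" "p + \<i> * u * of_real (h + 1)"])
       (use u strip_apart[OF u strip] that in \<open>auto simp: norm_mult\<close>)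
  obtain C where C: "0 \<le> C" "\<And>z. norm (F (p + u * z)) \<le> exp (C * (1 + norm z) powr K)"
    using finite_order_affine[OF order u] by blast
  \<comment> \<open>For \<open>norm z \<ge> r\<close>, at least half of
    \<open>norm z * sin \<eta>\<close> survives the shift by \<open>h + 1\<close>.\<close>
  define r where "r = 2 * (h + 2) / sin \<eta>"
  have r: "0 \<le> r" using h s by (simp add: r_def)
  define M where "M = C * (1 + r) powr K + L * (8 / sin \<eta>)"
  show ?thesis
  proof
    show M: "0 \<le> M" using C L s by (simp add: M_def)
    fix z assume z: "\<bar>Re z\<bar> \<le> norm z * cos \<eta>" "0 \<le> Im z"
    show "norm (F (p + u * z)) \<le> exp (M * (1 + norm z))"
    proof (cases "norm z < r")
      case True
      have "C * (1 + norm z) powr K \<le> C * (1 + r) powr K"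
        using True C order by (intro mult_left_mono powr_mono2) auto
      also have "\<dots> \<le> M" using L s by (simp add: M_def)
      also have "\<dots> \<le> M * (1 + norm z)" using M by (simp add: distrib_left)
      finally have "exp (C * (1 + norm z) powr K) \<le> exp (M * (1 + norm z))" by simp
      with C(2)[of z] show ?thesis by (rule order_trans)
    next
      case False
      have "(norm z * sin \<eta>)\<^sup>2 \<le> (Im z)\<^sup>2"
      proof -
        have "(Re z)\<^sup>2 \<le> (norm z * cos \<eta>)\<^sup>2" using power_mono[OF z(1), of 2] by simp
        moreover have "(norm z * sin \<eta>)\<^sup>2 + (norm z * cos \<eta>)\<^sup>2 = (norm z)\<^sup>2"
          unfolding power_mult_distrib distrib_left[symmetric] by simp
        ultimately show ?thesis using cmod_power2[of z] by linarith
      qed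
      then have Im: "norm z * sin \<eta> \<le> Im z" using z(2) by (rule power2_le_imp_le)
      have "r * sin \<eta> \<le> norm z * sin \<eta>" using False s by (intro mult_right_mono) auto
      then have big: "2 * (h + 2) \<le> norm z * sin \<eta>" using s by (simp add: r_def)
      also have "\<dots> \<le> norm z" using s by (simp add: mult_left_le)
      finally have big': "2 * (h + 2) \<le> norm z" .
      define w where "w = - \<i> * z - of_real (h + 1)"
      have Rew: "norm z * sin \<eta> / 2 \<le> Re w" using Im big by (simp add: w_def)
      have "0 < 2 * (h + 2)" using h by simp
      then have "0 < norm z * sin \<eta>" using big by (rule less_le_trans)
      then have Rew0: "0 < norm z * sin \<eta> / 2" by simp
      have "norm w \<le> norm z + (h + 1)"
        unfolding w_def using norm_triangle_ineq4[of "- \<i> * z" "of_real (h + 1)"] h by (simp add: norm_mult)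
      then have "(1 + norm w)\<^sup>2 \<le> (2 * norm z)\<^sup>2" using big' h by (intro power_mono) auto
      then have "(1 + norm w)\<^sup>2 / Re w \<le> (2 * norm z)\<^sup>2 / (norm z * sin \<eta> / 2)"
        using Rew Rew0 by (intro frac_le) auto
      also have "\<dots> = 8 / sin \<eta> * norm z" by (simp add: power2_eq_square)
      finally have "L * ((1 + norm w)\<^sup>2 / Re w) \<le> L * (8 / sin \<eta> * norm z)" using L by (intro mult_left_mono) auto
      also have "\<dots> = L * (8 / sin \<eta>) * norm z" by simp
      also have "\<dots> \<le> M * (1 + norm z)"
        using L s C by (intro mult_mono) (auto simp: M_def)
      finally have "exp (L * ((1 + norm w)\<^sup>2 / Re w)) \<le> exp (M * (1 + norm z))" by simp
      moreover have "norm (F (p + u * z)) \<le> exp (L * ((1 + norm w)\<^sup>2 / Re w))"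
      proof -
        have e: "p + \<i> * u * of_real (h + 1) + \<i> * u * w = p + u * z" by (simp add: w_def algebra_simps)
        have "0 < Re w" using Rew0 Rew by (rule less_le_trans)
        from L(2)[OF this] show ?thesis unfolding e .
      qed
      ultimately show ?thesis by linarith
    qed
  qed
qed

text \<open>Replacing \<open>u\<close> by \<open>- u\<close> gives the opposite side of the strip.
  What remains are two thin sectors along its two ends, with linear bounds on their edges. The value
  of \<eta> makes them thin enough for the order: \<open>K * \<eta> \<le> pi / 4\<close>.\<close>

lemma finite_exp_type_if_strip:
  assumes u: "norm u = 1" and strip: "\<And>n. \<exists>s::real. norm (t n - (p + of_real s * u)) \<le> h"
    and K: "0 < K" "summable (\<lambda>n. norm (t n) powr - K)"
  shows "finite_exp_type F"
proof -
  define \<eta> where "\<eta> = min (pi / 4) (pi / (4 * K))"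
  have \<eta>: "0 < \<eta>" "\<eta> < pi / 2" "K * \<eta> < pi / 2"
  proof -
    show "0 < \<eta>" using K by (simp add: \<eta>_def)
    have "\<eta> \<le> pi / 4" by (simp add: \<eta>_def)
    then show "\<eta> < pi / 2" using pi_gt_zero by linarith
    have "K * \<eta> \<le> K * (pi / (4 * K))" using K by (intro mult_left_mono) (auto simp: \<eta>_def)
    also have "\<dots> = pi / 4" using K by simp
    finally show "K * \<eta> < pi / 2" using pi_gt_zero by linarith
  qed
  have cos: "0 < cos \<eta>" using \<eta> by (intro cos_gt_zero_pi) auto
  have strip': "\<exists>s::real. norm (t n - (p + of_real s * (- u))) \<le> h" for n
  proof -
    obtain s :: real where "norm (t n - (p + of_real s * u)) \<le> h" using strip by blast
    then have "norm (t n - (p + of_real (- s) * (- u))) \<le> h" by simp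
    then show ?thesis by blast
  qed
  obtain M1 where M1: "0 \<le> M1"
    "\<And>z. \<bar>Re z\<bar> \<le> norm z * cos \<eta> \<Longrightarrow> 0 \<le> Im z \<Longrightarrow> norm (F (p + u * z)) \<le> exp (M1 * (1 + norm z))"
    using strip_growth[OF u strip K \<eta>(1,2)] by blast
  obtain M2 where M2: "0 \<le> M2"
    "\<And>z. \<bar>Re z\<bar> \<le> norm z * cos \<eta> \<Longrightarrow> 0 \<le> Im z \<Longrightarrow> norm (F (p + (- u) * z)) \<le> exp (M2 * (1 + norm z))"
    using strip_growth[OF _ strip' K \<eta>(1,2)] u by (metis norm_minus_cancel)
  define M where "M = M1 + M2"
  have M: "0 \<le> M" using M1 M2 by (simp add: M_def)
  have mid: "norm (F (p + u * z)) \<le> exp (M * (1 + norm z))" if z: "\<bar>Re z\<bar> \<le> norm z * cos \<eta>" for z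
  proof (cases "0 \<le> Im z")
    case True
    have "M1 * (1 + norm z) \<le> M * (1 + norm z)" using M1 M2 by (intro mult_right_mono) (auto simp: M_def)
    then have "exp (M1 * (1 + norm z)) \<le> exp (M * (1 + norm z))" by simp
    with M1(2)[OF z True] show ?thesis by (rule order_trans)
  next
    case False
    have "M2 * (1 + norm z) \<le> M * (1 + norm z)" using M1 M2 by (intro mult_right_mono) (auto simp: M_def)
    then have "exp (M2 * (1 + norm z)) \<le> exp (M * (1 + norm z))" by simp
    moreover have "norm (F (p + u * z)) \<le> exp (M2 * (1 + norm z))" using M2(2)[of "- z"] z False by simp
    ultimately show ?thesis by (rule order_trans[rotated])
  qed
  have sector: "\<exists>M'\<ge>0. \<forall>z. norm z * cos \<eta> \<le> Re z \<longrightarrow> norm (F (p + v * z)) \<le> exp (M' * (1 + norm z))"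
    if v: "v = u \<or> v = - u" for v
  proof -
    have nv: "norm v = 1" using u v by auto
    obtain C where C: "0 \<le> C" "\<And>z. norm (F (p + v * z)) \<le> exp (C * (1 + norm z) powr K)"
      using finite_order_affine[OF K nv] by blast
    obtain M' where M': "0 \<le> M'" "\<And>z. norm z * cos \<eta> \<le> Re z \<Longrightarrow> norm (F (p + v * z)) \<le> exp (M' * (1 + norm z) powr 1)"
    proof (rule Phragmen_Lindelof_sector[OF holomorphic_affine[of p v] \<eta>(1,2) _ _ _ \<eta>(3) C(1) M C(2), of 1])
      fix z assume z: "Re z = norm z * cos \<eta>"
      have "0 \<le> norm z * cos \<eta>" using cos by simp
      with z have "\<bar>Re z\<bar> \<le> norm z * cos \<eta>" "\<bar>Re (- z)\<bar> \<le> norm (- z) * cos \<eta>" by auto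
      then show "norm (F (p + v * z)) \<le> exp (M * (1 + norm z) powr 1)"
        using mid[of z] mid[of "- z"] v by (auto simp: add_nonneg_nonneg)
    qed (use \<eta> K that in auto)
    have "norm (F (p + v * z)) \<le> exp (M' * (1 + norm z))" if "norm z * cos \<eta> \<le> Re z" for z
      using M'(2)[OF that] by (simp add: add_nonneg_nonneg)
    with M'(1) show ?thesis by blast
  qed
  obtain M3 where M3: "0 \<le> M3" "\<And>z. norm z * cos \<eta> \<le> Re z \<Longrightarrow> norm (F (p + u * z)) \<le> exp (M3 * (1 + norm z))"
    using sector[of u] by blast
  obtain M4 where M4: "0 \<le> M4" "\<And>z. norm z * cos \<eta> \<le> Re z \<Longrightarrow> norm (F (p + (- u) * z)) \<le> exp (M4 * (1 + norm z))"
    using sector[of "- u"] by blast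
  define M' where "M' = M + M3 + M4"
  have "norm (F (p + u * z)) \<le> exp (M' * (1 + norm z))" for z
  proof -
    have le: "exp (X * (1 + norm z)) \<le> exp (M' * (1 + norm z))" if "X \<le> M'" for X
      using that by (simp add: mult_right_mono)
    consider "\<bar>Re z\<bar> \<le> norm z * cos \<eta>" | "norm z * cos \<eta> \<le> Re z" | "norm (- z) * cos \<eta> \<le> Re (- z)" by force
    then show ?thesis
    proof cases
      case 1 then show ?thesis using order_trans[OF mid le[of M]] M M3 M4 by (simp add: M'_def)
    next
      case 2 then show ?thesis using order_trans[OF M3(2) le[of M3]] M M3 M4 by (simp add: M'_def)
    next
      case 3 then show ?thesis using order_trans[OF M4(2)[OF 3] , of "exp (M' * (1 + norm z))"] le[of M4] M M3 M4 by (simp add: M'_def)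
    qed
  qed
  then show ?thesis using M M3 M4 by (intro exp_affine_growth_imp_finite_exp_type[OF u, of M' F p]) (auto simp: M'_def)
qed

lemma cond_Pi_imp:
  assumes "cond_Pi t"
  shows "finite_exp_type F" "\<exists>c u. norm u = 1 \<and> cartwright (\<lambda>z. F (u * z + c))"
proof -
  obtain p u' h where u': "u' \<noteq> 0" and strip: "\<And>n. \<exists>s::real. norm (t n - (p + of_real s * u')) \<le> h"
    and fin: "finite_conv_exponent t"
    using assms unfolding cond_Pi_def by blast
  define u where "u = u' / of_real (norm u')"
  have u: "norm u = 1" using u' by (simp add: u_def norm_divide)
  have strip_u: "\<exists>s::real. norm (t n - (p + of_real s * u)) \<le> h" for n
  proof -
    obtain s :: real where "norm (t n - (p + of_real s * u')) \<le> h" using strip by blast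
    then have "norm (t n - (p + of_real (s * norm u') * u)) \<le> h" using u' by (simp add: u_def)
    then show ?thesis by blast
  qed
  obtain K where K: "0 < K" "summable (\<lambda>n. norm (t n) powr - K)"
    using fin by (auto simp: finite_conv_exponent_def)
  show type: "finite_exp_type F" by (rule finite_exp_type_if_strip[OF u strip_u K])
  show "\<exists>c u. norm u = 1 \<and> cartwright (\<lambda>z. F (u * z + c))"
    by (rule cartwright_half_plane[of "\<i> * u" "p + \<i> * u * of_real (h + 1)"])
       (use u strip_apart[OF u strip_u] type in \<open>auto simp: norm_mult\<close>)
qed

end

section \<open>Poles in an angle\<close>

text \<open>The minus sign makes the directions of the two points differ by at least \<epsilon>.
  Over all \<open>r1\<close> the squared distance is then smallest at
  \<open>r1 = r2 * cos \<epsilon>\<close>, which is completing the square.\<close>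

lemma norm_cis_diff_ge:
  assumes r: "0 \<le> r1" "0 \<le> r2" and \<epsilon>: "0 \<le> \<epsilon>" "\<epsilon> \<le> pi" and xy: "\<bar>x - y\<bar> \<le> pi - \<epsilon>"
  shows "r2 * sin \<epsilon> \<le> norm (- (of_real r1 * cis x) - of_real r2 * cis y)"
proof (rule power2_le_imp_le)
  have "cos (pi - \<epsilon>) \<le> cos \<bar>x - y\<bar>" using \<epsilon> xy by (intro cos_monotone_0_pi_le) auto
  then have "- cos \<epsilon> \<le> cos (x - y)" by simp
  then have "2 * r1 * r2 * (- cos \<epsilon>) \<le> 2 * r1 * r2 * cos (x - y)" using r by (intro mult_left_mono) auto
  moreover have "(norm (- (of_real r1 * cis x) - of_real r2 * cis y))\<^sup>2
      = r1\<^sup>2 * ((cos x)\<^sup>2 + (sin x)\<^sup>2) + r2\<^sup>2 * ((cos y)\<^sup>2 + (sin y)\<^sup>2) + 2 * r1 * r2 * cos (x - y)"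
  proof -
    have "Re (- (of_real r1 * cis x) - of_real r2 * cis y) = - (r1 * cos x) - r2 * cos y"
      "Im (- (of_real r1 * cis x) - of_real r2 * cis y) = - (r1 * sin x) - r2 * sin y"
      by simp_all
    then show ?thesis unfolding cmod_power2 cos_diff by algebra
  qed
  moreover have "0 \<le> (r1 - r2 * cos \<epsilon>)\<^sup>2" by simp
  moreover have "(r1 - r2 * cos \<epsilon>)\<^sup>2 = r1\<^sup>2 + r2\<^sup>2 * (cos \<epsilon>)\<^sup>2 - 2 * r1 * r2 * cos \<epsilon>"
    by (simp add: power2_eq_square algebra_simps)
  moreover have "(r2 * sin \<epsilon>)\<^sup>2 + r2\<^sup>2 * (cos \<epsilon>)\<^sup>2 = r2\<^sup>2"
    unfolding power_mult_distrib distrib_left[symmetric] by simp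
  ultimately show "(r2 * sin \<epsilon>)\<^sup>2 \<le> (norm (- (of_real r1 * cis x) - of_real r2 * cis y))\<^sup>2"
    by simp
qed simp

lemma powr_of_real_conv_cis:
  assumes "z \<noteq> 0"
  shows "z powr of_real s = of_real (norm z powr s) * cis (s * Arg z)"
proof -
  have "Ln z = of_real (ln (norm z)) + \<i> * of_real (Arg z)"
    using assms by (auto simp: complex_eq_iff Arg_def)
  then have "z powr of_real s = exp (of_real (s * ln (norm z)) + \<i> * of_real (s * Arg z))"
    using assms by (simp add: powr_def algebra_simps)
  then show ?thesis using assms
    by (simp add: exp_add powr_def cis_conv_exp exp_of_real[symmetric])
qed

text \<open>An exponent below 1 keeps the argument strictly between \<open>- pi\<close> and
  \<open>pi\<close>, so the principal branch undoes the first power.\<close>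

lemma powr_powr_inverse:
  fixes z :: complex
  assumes z: "z \<noteq> 0" and s: "0 < s" "s < 1"
  shows "(z powr of_real s) powr of_real (1 / s) = z"
proof -
  have "\<bar>Arg z\<bar> \<le> pi" using mpi_less_Arg[of z] Arg_le_pi[of z] by linarith
  then have "s * \<bar>Arg z\<bar> \<le> s * pi" using s by (intro mult_left_mono) auto
  also have "\<dots> < pi" using s by simp
  finally have "\<bar>s * Arg z\<bar> < pi" using s by (simp add: abs_mult)
  then have "Ln (exp (of_real s * Ln z)) = of_real s * Ln z"
    using z by (intro Ln_exp) (auto simp: Arg_def)
  then show ?thesis using z s by (simp add: powr_def)
qed

context cauchy_quotient
begin

text \<open>With \<open>u\<close> as bisector, the complement of the angle contains a sector of
  half-opening \<open>\<alpha> > pi / 2\<close> about \<open>- u\<close>. The power map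
  \<open>\<phi>\<close> opens the half-plane onto it with exponent \<open>1 / \<sigma>\<close>, so a
  linear bound in the parameter becomes one of order \<open>\<sigma> < 1\<close>. The sector around
  the poles is closed by Phragmen-Lindelof.\<close>

lemma angle_growth:
  assumes \<gamma>: "0 < \<gamma>" "\<gamma> < 1" and K: "0 < K" "summable (\<lambda>n. norm (t n) powr - K)" "K < 1 / \<gamma>"
    and u: "norm u = 1"
    and angle: "\<And>n. \<exists>r \<theta>. 0 < r \<and> \<bar>\<theta>\<bar> < pi * \<gamma> / 2 \<and> t n = u * (of_real r * cis \<theta>)"
  obtains \<sigma> M where "0 < \<sigma>" "\<sigma> < 1" "0 \<le> M" "\<And>z. norm (F (u * z)) \<le> exp (M * (1 + norm z) powr \<sigma>)"
proof -
  have u0: "u \<noteq> 0" using u by auto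
  define \<beta> where "\<beta> = pi * \<gamma> / 2"
  have \<beta>: "0 < \<beta>" "\<beta> < pi / 2" using \<gamma> by (auto simp: \<beta>_def)
  have "K * \<gamma> < 1" using K \<gamma> by (simp add: field_simps)
  then have "\<beta> < pi / (2 * K)" using K by (simp add: \<beta>_def field_simps)
  \<comment> \<open>\<eta> must exceed the half-opening of the angle, for the edge rays to avoid the
    poles, and stay below \<open>pi / (2 * K)\<close>, for Phragmen-Lindelof.\<close>
  then obtain \<eta> where \<eta>: "\<beta> < \<eta>" "\<eta> < pi / 2" "\<eta> < pi / (2 * K)"
    using dense[of \<beta> "min (pi / 2) (pi / (2 * K))"] \<beta> by auto
  have K\<eta>: "K * \<eta> < pi / 2" using \<eta>(3) K by (simp add: field_simps)
  \<comment> \<open>The gap between \<beta> and \<eta> is split in two: one half separates the image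
    of \<open>\<phi>\<close> from the poles, the other puts the rays of argument
    \<open>\<plusminus> \<eta>\<close> strictly inside that image.\<close>
  define \<epsilon> where "\<epsilon> = (\<eta> - \<beta>) / 2"
  have \<epsilon>2: "2 * \<epsilon> = \<eta> - \<beta>" by (simp add: \<epsilon>_def)
  have \<epsilon>: "0 < \<epsilon>" "\<epsilon> < pi" "\<beta> + \<epsilon> < \<eta>"
  proof -
    show "0 < \<epsilon>" using \<epsilon>2 \<eta>(1) by linarith
    show "\<epsilon> < pi" using \<epsilon>2 \<eta>(2) \<beta>(1) pi_gt_zero by linarith
    show "\<beta> + \<epsilon> < \<eta>" using \<epsilon>2 \<eta>(1) by linarith
  qed
  define \<alpha> where "\<alpha> = pi - \<beta> - \<epsilon>"
  have \<alpha>: "pi / 2 < \<alpha>" "\<alpha> < pi" using \<epsilon> \<eta> \<beta> by (auto simp: \<alpha>_def)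
  define \<sigma> where "\<sigma> = pi / 2 / \<alpha>"
  have \<alpha>0: "0 < \<alpha>" using \<alpha> pi_gt_zero by linarith
  have \<sigma>: "0 < \<sigma>" "\<sigma> < 1" "1 / \<sigma> \<le> 2" using \<alpha> \<alpha>0 by (auto simp: \<sigma>_def field_simps)
  define \<phi> where "\<phi> = (\<lambda>z. - u * z powr of_real (1 / \<sigma>))"
  have Re_nz: "z \<noteq> 0" if "0 < Re z" for z using that by auto
  have \<phi>_eq: "\<phi> z = u * (- (of_real (norm z powr (1 / \<sigma>)) * cis (1 / \<sigma> * Arg z)))" if "0 < Re z" for z
    unfolding \<phi>_def powr_of_real_conv_cis[OF Re_nz[OF that]] by simp
  have \<phi>_Arg: "\<bar>1 / \<sigma> * Arg z\<bar> < \<alpha>" if "0 < Re z" for z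
  proof -
    have "\<bar>Arg z\<bar> < pi / 2" using that Arg_Re_pos by blast
    then have "1 / \<sigma> * \<bar>Arg z\<bar> < 1 / \<sigma> * (pi / 2)" using \<sigma> by (intro mult_strict_left_mono) auto
    also have "\<dots> = \<alpha>" using \<alpha>0 by (simp add: \<sigma>_def)
    finally show ?thesis using \<sigma> by (simp add: abs_mult)
  qed
  have sin: "0 < sin \<epsilon>" using \<epsilon> by (intro sin_gt_zero) auto
  have apart: "norm (t n) \<le> 1 / sin \<epsilon> * norm (\<phi> z - t n)" if z: "0 < Re z" for z n
  proof -
    obtain r \<theta> where t: "0 < r" "\<bar>\<theta>\<bar> < \<beta>" "t n = u * (of_real r * cis \<theta>)"
      using angle[of n] by (auto simp: \<beta>_def)
    have "\<bar>1 / \<sigma> * Arg z - \<theta>\<bar> \<le> pi - \<epsilon>" using \<phi>_Arg[OF z] t(2) unfolding \<alpha>_def by linarith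
    then have "r * sin \<epsilon> \<le> norm (- (of_real (norm z powr (1 / \<sigma>)) * cis (1 / \<sigma> * Arg z)) - of_real r * cis \<theta>)"
      using t \<epsilon> by (intro norm_cis_diff_ge) auto
    also have "\<dots> = norm (\<phi> z - t n)"
      unfolding \<phi>_eq[OF z] t(3) right_diff_distrib[symmetric] norm_mult u by simp
    finally have "r * sin \<epsilon> \<le> norm (\<phi> z - t n)" .
    moreover have "norm (t n) = r" using t u by (simp add: norm_mult)
    ultimately show ?thesis using sin by (simp add: field_simps)
  qed
  define D where "D = 1 / sin \<epsilon>"
  have D: "1 \<le> D" using sin sin_le_one[of \<epsilon>] by (simp add: D_def)
  have X: "1 \<le> (1 + norm z) ^ 2" for z :: complex by (rule one_le_power) simp
  have bound: "norm (\<phi> z) \<le> D * (1 + norm z) ^ 2" if z: "0 < Re z" for z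
  proof -
    have "norm (\<phi> z) = norm z powr (1 / \<sigma>)" unfolding \<phi>_eq[OF z] by (simp add: norm_mult u)
    also have "\<dots> \<le> (1 + norm z) powr (1 / \<sigma>)" using \<sigma> by (intro powr_mono2) auto
    also have "\<dots> \<le> (1 + norm z) powr 2" using \<sigma> by (intro powr_mono) auto
    also have "\<dots> = (1 + norm z) ^ 2" by (simp add: add_pos_nonneg)
    also have "\<dots> \<le> D * (1 + norm z) ^ 2" using mult_right_mono[OF D, of "(1 + norm z) ^ 2"] by simp
    finally show ?thesis .
  qed
  have apart': "norm (t n) \<le> D * (1 + norm z) ^ 2 * norm (\<phi> z - t n)" if z: "0 < Re z" for z n
  proof -
    have "D * norm (\<phi> z - t n) \<le> D * (1 + norm z) ^ 2 * norm (\<phi> z - t n)"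
      using mult_left_mono[OF X[of z], of D] D by (intro mult_right_mono) auto
    with apart[OF z, of n] show ?thesis by (simp add: D_def)
  qed
  have \<phi>hol: "\<phi> holomorphic_on {z. 0 < Re z}"
    unfolding \<phi>_def by (intro holomorphic_intros) (auto simp: complex_nonpos_Reals_iff)
  have onto: "\<phi> ((- z) powr of_real \<sigma>) = u * z" if "z \<noteq> 0" for z
    using powr_powr_inverse[of "- z" \<sigma>] that \<sigma> by (simp add: \<phi>_def)
  obtain w where w: "0 < Re w" "reg_cauchy t b m (\<phi> w) \<noteq> 0"
  proof -
    \<comment> \<open>The half-plane opposite to the angle. It is free of poles, and its points pull
      back through \<open>\<phi>\<close> to positive real part, because \<open>\<sigma> < 1\<close>
      shrinks arguments.\<close>
    define U where "U = {z. Re (z / u) < 0}"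
    have "open U" unfolding U_def using u0 by (intro open_Collect_less continuous_intros) auto
    moreover have "- u \<in> U" using u0 by (simp add: U_def)
    moreover have "t n \<notin> U" for n
    proof -
      obtain r \<theta> where t: "0 < r" "\<bar>\<theta>\<bar> < \<beta>" "t n = u * (of_real r * cis \<theta>)"
        using angle[of n] by (auto simp: \<beta>_def)
      have "0 < cos \<theta>" using t(2) \<beta> by (intro cos_gt_zero_pi) auto
      then have "0 < r * cos \<theta>" using t(1) by simp
      then show ?thesis using t(3) u0 by (simp add: U_def)
    qed
    ultimately obtain y where y: "y \<in> U" "reg_cauchy t b m y \<noteq> 0"
      using nonzero_in_open[OF T b nz, of U] by blast
    define x where "x = - (y / u)"
    have x: "0 < Re x" using y(1) by (simp add: x_def U_def)
    have "\<bar>Arg x\<bar> < pi / 2" using x Arg_Re_pos by blast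
    then have "\<sigma> * \<bar>Arg x\<bar> \<le> 1 * \<bar>Arg x\<bar>" using \<sigma> by (intro mult_right_mono) auto
    with \<open>\<bar>Arg x\<bar> < pi / 2\<close> have "\<bar>\<sigma> * Arg x\<bar> < pi / 2" using \<sigma> by (simp add: abs_mult)
    then have "0 < cos (\<sigma> * Arg x)" by (intro cos_gt_zero_pi) auto
    then have "0 < Re (x powr of_real \<sigma>)"
      unfolding powr_of_real_conv_cis[OF Re_nz[OF x]] using Re_nz[OF x] by simp
    moreover have "\<phi> (x powr of_real \<sigma>) = y"
      using onto[of "- x"] Re_nz[OF x] u0 by (simp add: x_def)
    ultimately show thesis using y(2) that[of "x powr of_real \<sigma>"] by simp
  qed
  obtain L where L: "0 \<le> L" "\<And>z. 0 < Re z \<Longrightarrow> norm (F (\<phi> z)) \<le> exp (L * ((1 + norm z)\<^sup>2 / Re z))"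
    using growth_along[OF \<phi>hol D bound apart' w] by blast
  obtain C where C: "0 \<le> C" "\<And>z. norm (F (0 + u * z)) \<le> exp (C * (1 + norm z) powr K)"
    using finite_order_affine[OF K(1,2) u, of 0] by blast
  \<comment> \<open>Points outside the sector of half-opening \<eta> pull back to arguments of size
    at most \<open>\<sigma> * (pi - \<eta>) < pi / 2\<close>, so their real part is at least
    \<open>c\<close> times their modulus.\<close>
  define c where "c = cos (\<sigma> * (pi - \<eta>))"
  have \<sigma>\<eta>: "\<sigma> * (pi - \<eta>) < pi / 2"
  proof -
    have "\<sigma> * (pi - \<eta>) < \<sigma> * \<alpha>" using \<sigma> \<epsilon> by (intro mult_strict_left_mono) (auto simp: \<alpha>_def)
    also have "\<dots> = pi / 2" using \<alpha>0 by (simp add: \<sigma>_def)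
    finally show ?thesis .
  qed
  have \<eta>': "0 \<le> pi - \<eta>" "pi - \<eta> \<le> pi" using \<eta>(1,2) \<beta>(1) pi_gt_zero by linarith+
  have \<sigma>\<eta>0: "0 \<le> \<sigma> * (pi - \<eta>)" using \<sigma>(1) \<eta>' by simp
  have \<sigma>\<eta>\<pi>: "\<sigma> * (pi - \<eta>) \<le> pi" using \<sigma>\<eta> pi_gt_zero by linarith
  have c: "0 < c" unfolding c_def using \<sigma>\<eta> \<sigma>\<eta>0 by (intro cos_gt_zero_pi) auto
  define M where "M = C * 2 powr K + L * (4 / c)"
  have M: "0 \<le> M" using C L c by (simp add: M_def)
  have outside: "norm (F (u * z)) \<le> exp (M * (1 + norm z) powr \<sigma>)" if z: "Re z \<le> norm z * cos \<eta>" for z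
  proof (cases "norm z < 1")
    case True
    have "C * (1 + norm z) powr K \<le> C * 2 powr K"
      using True C K by (intro mult_left_mono powr_mono2) auto
    also have "\<dots> \<le> M * 1" using L c by (simp add: M_def)
    also have "\<dots> \<le> M * (1 + norm z) powr \<sigma>" using M \<sigma> by (intro mult_left_mono ge_one_powr_ge_zero) auto
    finally have "exp (C * (1 + norm z) powr K) \<le> exp (M * (1 + norm z) powr \<sigma>)" by simp
    with C(2)[of z] show ?thesis unfolding add_0 by (rule order_trans)
  next
    case False
    define y where "y = - z"
    have y: "1 \<le> norm y" "y \<noteq> 0" "norm y = norm z" using False by (auto simp: y_def)
    have Arg: "\<bar>Arg y\<bar> \<le> pi - \<eta>"
      using z \<eta>' y(2) by (intro abs_Arg_le) (auto simp: y_def)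
    define x where "x = y powr of_real \<sigma>"
    have nx: "norm x = norm y powr \<sigma>"
      unfolding x_def powr_of_real_conv_cis[OF y(2)] by (simp add: norm_mult)
    have nx1: "1 \<le> norm x" unfolding nx using y(1) \<sigma> by (intro ge_one_powr_ge_zero) auto
    have Rex: "c * norm x \<le> Re x"
      unfolding nx unfolding x_def c_def using Arg y(2) \<sigma>(1) \<sigma>\<eta>\<pi> by (intro Re_powr_ge) auto
    have "0 < c * norm x" using c nx1 by (intro mult_pos_pos) auto
    then have "0 < Re x" using Rex by linarith
    have "(1 + norm x)\<^sup>2 / Re x \<le> (2 * norm x)\<^sup>2 / (c * norm x)"
      using nx1 Rex \<open>0 < c * norm x\<close> by (intro frac_le power_mono) auto
    also have "\<dots> = 4 / c * norm z powr \<sigma>" using nx1 by (simp add: power2_eq_square nx y(3))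
    also have "\<dots> \<le> 4 / c * (1 + norm z) powr \<sigma>" using c \<sigma> by (intro mult_left_mono powr_mono2) auto
    finally have "L * ((1 + norm x)\<^sup>2 / Re x) \<le> L * (4 / c * (1 + norm z) powr \<sigma>)"
      using L by (intro mult_left_mono) auto
    also have "\<dots> = L * (4 / c) * (1 + norm z) powr \<sigma>" by simp
    also have "\<dots> \<le> M * (1 + norm z) powr \<sigma>" using C by (intro mult_right_mono) (auto simp: M_def)
    finally have "exp (L * ((1 + norm x)\<^sup>2 / Re x)) \<le> exp (M * (1 + norm z) powr \<sigma>)" by simp
    moreover have "\<phi> x = u * z" unfolding x_def y_def by (rule onto) (use y in \<open>auto simp: y_def\<close>)
    ultimately show ?thesis using L(2)[OF \<open>0 < Re x\<close>] by (metis order_trans)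
  qed
  have "\<sigma> * \<eta> < 1 * (pi / 2)" using \<sigma> \<eta> \<beta> by (intro mult_strict_mono) auto
  then obtain M' where M': "0 \<le> M'" "\<And>z. norm z * cos \<eta> \<le> Re z \<Longrightarrow> norm (F (0 + u * z)) \<le> exp (M' * (1 + norm z) powr \<sigma>)"
    using Phragmen_Lindelof_sector[OF holomorphic_affine[of 0 u] _ \<eta>(2) _ _ _ K\<eta> C(1) M C(2), of \<sigma>]
      outside \<sigma> \<eta> \<beta> K by auto
  show ?thesis
  proof (rule that[OF \<sigma>(1,2)])
    show "0 \<le> M + M'" using M M' by simp
    fix z :: complex
    have le: "exp (X * (1 + norm z) powr \<sigma>) \<le> exp ((M + M') * (1 + norm z) powr \<sigma>)" if "X \<le> M + M'" for X
      using that by (simp add: mult_right_mono)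
    show "norm (F (u * z)) \<le> exp ((M + M') * (1 + norm z) powr \<sigma>)"
    proof (cases "Re z \<le> norm z * cos \<eta>")
      case True
      then show ?thesis using order_trans[OF outside le[of M]] M' by simp
    next
      case False
      then show ?thesis using order_trans[OF M'(2) le[of M']] M by simp
    qed
  qed
qed

lemma cond_A_imp:
  assumes \<gamma>: "0 < \<gamma>" "\<gamma> < 1" and A: "cond_A \<gamma> t"
  shows "zero_exp_type F" "\<exists>c u. norm u = 1 \<and> cartwright (\<lambda>z. F (u * z + c))"
proof -
  obtain \<theta>0 where \<theta>0: "\<And>n. \<exists>r \<theta>. r > 0 \<and> \<theta>0 < \<theta> \<and> \<theta> < \<theta>0 + pi * \<gamma> \<and> t n = of_real r * cis \<theta>"
    and ce: "conv_exponent t < ereal (1 / \<gamma>)"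
    using A unfolding cond_A_def by blast
  obtain K where K: "0 < K" "summable (\<lambda>n. norm (t n) powr - K)" "K < 1 / \<gamma>"
    using ce unfolding conv_exponent_def Inf_less_iff by auto
  \<comment> \<open>The bisector of the angle; relative to it all arguments are below
    \<open>pi * \<gamma> / 2\<close> in absolute value.\<close>
  define u where "u = cis (\<theta>0 + pi * \<gamma> / 2)"
  have u: "norm u = 1" by (simp add: u_def)
  have angle: "\<exists>r \<theta>. 0 < r \<and> \<bar>\<theta>\<bar> < pi * \<gamma> / 2 \<and> t n = u * (of_real r * cis \<theta>)" for n
  proof -
    obtain r \<theta> where t: "r > 0" "\<theta>0 < \<theta>" "\<theta> < \<theta>0 + pi * \<gamma>" "t n = of_real r * cis \<theta>" using \<theta>0 by blast
    define x where "x = \<theta> - (\<theta>0 + pi * \<gamma> / 2)"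
    have "\<bar>x\<bar> < pi * \<gamma> / 2" using t by (simp add: x_def abs_less_iff field_simps)
    moreover have "t n = u * (of_real r * cis x)" using t by (simp add: x_def u_def cis_mult)
    ultimately show ?thesis using t(1) by blast
  qed
  obtain \<sigma> M where \<sigma>: "0 < \<sigma>" "\<sigma> < 1" and M: "0 \<le> M" and bd: "\<And>z. norm (F (u * z)) \<le> exp (M * (1 + norm z) powr \<sigma>)"
    using angle_growth[OF \<gamma> K u angle] by blast
  have u0: "u \<noteq> 0" using u by auto
  show zero: "zero_exp_type F"
    unfolding zero_exp_type_def
  proof (intro allI impI)
    fix e :: real assume e: "0 < e"
    \<comment> \<open>The crossover of \<open>M * X powr \<sigma>\<close> and \<open>e * X\<close>:
      to the right of it the linear term wins, to the left a constant suffices.\<close>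
    define R where "R = (M / e) powr (1 / (1 - \<sigma>))"
    have R: "0 \<le> R" by (simp add: R_def)
    have "M * X powr \<sigma> \<le> e * X + M * R powr \<sigma>" if X: "0 < X" for X
    proof (cases "R \<le> X")
      case True
      have "M / e = R powr (1 - \<sigma>)" using M e \<sigma> by (simp add: R_def powr_powr)
      also have "\<dots> \<le> X powr (1 - \<sigma>)" using True R \<sigma> by (intro powr_mono2) auto
      finally have "M \<le> e * X powr (1 - \<sigma>)" using e by (simp add: field_simps)
      then have "M * X powr \<sigma> \<le> e * X powr (1 - \<sigma>) * X powr \<sigma>" by (rule mult_right_mono) simp
      also have "\<dots> = e * X" using X by (simp add: mult.assoc powr_add[symmetric])
      finally show ?thesis using M by (simp add: add_increasing2)
    next
      case False
      then have "M * X powr \<sigma> \<le> M * R powr \<sigma>" using M X \<sigma> by (intro mult_left_mono powr_mono2) auto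
      then show ?thesis using e X by (simp add: add_increasing)
    qed
    note X = this
    have "norm (F z) \<le> exp (e + M * R powr \<sigma>) * exp (e * norm z)" for z
    proof -
      have "norm (F (u * (z / u))) \<le> exp (M * (1 + norm (z / u)) powr \<sigma>)" by (rule bd)
      moreover have "norm (z / u) = norm z" using u by (simp add: norm_divide)
      ultimately have "norm (F z) \<le> exp (M * (1 + norm z) powr \<sigma>)" using u0 by simp
      also have "\<dots> \<le> exp ((e + M * R powr \<sigma>) + e * norm z)"
        using X[of "1 + norm z"] by (simp add: add_pos_nonneg distrib_left)
      finally show ?thesis by (simp add: exp_add)
    qed
    then show "\<exists>A. \<forall>z. norm (F z) \<le> A * exp (e * norm z)" by blast
  qed
  have "finite_exp_type F" using zero unfolding zero_exp_type_def finite_exp_type_def by (meson zero_less_one)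
  then show "\<exists>c u. norm u = 1 \<and> cartwright (\<lambda>z. F (u * z + c))"
  proof (rule cartwright_half_plane[of "- u" "- u", rotated 2])
    fix z :: complex and n assume z: "0 < Re z"
    obtain r \<theta> where t: "0 < r" "\<bar>\<theta>\<bar> < pi * \<gamma> / 2" "t n = u * (of_real r * cis \<theta>)" using angle by blast
    have "pi * \<gamma> / 2 < pi / 2" using \<gamma> by simp
    then have "\<bar>\<theta>\<bar> < pi / 2" using t(2) by linarith
    \<comment> \<open>All poles lie in the open half-plane in direction \<open>u\<close>, so the
      half-plane in direction \<open>- u\<close> with its boundary moved to \<open>- u\<close> stays
      at distance at least 1 from them.\<close>
    then have "0 < cos \<theta>" by (intro cos_gt_zero_pi) auto
    then have "0 < r * cos \<theta>" using t(1) by simp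
    then have "1 \<le> \<bar>Re (1 + z + of_real r * cis \<theta>)\<bar>" using z by simp
    also have "\<dots> \<le> norm (u * - (1 + z + of_real r * cis \<theta>))" unfolding norm_mult u norm_minus_cancel mult_1 by (rule abs_Re_le_cmod)
    also have "u * - (1 + z + of_real r * cis \<theta>) = - u + - u * z - t n" unfolding t(3) by (simp add: algebra_simps)
    finally show "1 \<le> norm (- u + - u * z - t n)" .
  qed (use u in simp)
qed

end

theorem theorem1p1:
  fixes t a b :: "nat \<Rightarrow> complex" and k m :: nat and F :: "complex \<Rightarrow> complex"
  assumes T: "admissible_seq t"
    and cond: "cond_Z t \<or> cond_Pi t \<or> (\<exists>\<gamma>. 0 < \<gamma> \<and> \<gamma> < 1 \<and> cond_A \<gamma> t)"
    and a: "cauchy_coeff_ok t k a" and b: "cauchy_coeff_ok t m b"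
    and Cb_nonzero: "\<exists>z. z \<notin> range t \<and> reg_cauchy t b m z \<noteq> 0"
    and F_entire: "F holomorphic_on UNIV"
    and F_quot: "\<And>z. z \<notin> range t \<Longrightarrow> F z * reg_cauchy t b m z = reg_cauchy t a k z"
  shows "finite_exp_type F
    \<and> ((cond_Z t \<or> (\<exists>\<gamma>. 0 < \<gamma> \<and> \<gamma> < 1 \<and> cond_A \<gamma> t)) \<longrightarrow> zero_exp_type F)
    \<and> ((cond_Pi t \<or> (\<exists>\<gamma>. 0 < \<gamma> \<and> \<gamma> < 1 \<and> cond_A \<gamma> t)) \<longrightarrow>
         (\<exists>c u. norm u = 1 \<and> cartwright (\<lambda>z. F (u * z + c))))"
proof -
  interpret cauchy_quotient t a b k m F
    using assms by unfold_locales
  have zero: "zero_exp_type F" if "cond_Z t \<or> (\<exists>\<gamma>. 0 < \<gamma> \<and> \<gamma> < 1 \<and> cond_A \<gamma> t)"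
    using that zero_exp_type_if_cond_Z cond_A_imp(1) by blast
  have cart: "\<exists>c u. norm u = 1 \<and> cartwright (\<lambda>z. F (u * z + c))"
    if "cond_Pi t \<or> (\<exists>\<gamma>. 0 < \<gamma> \<and> \<gamma> < 1 \<and> cond_A \<gamma> t)"
    using that cond_Pi_imp(2) cond_A_imp(2) by blast
  have "finite_exp_type F" if "zero_exp_type F"
    using that unfolding zero_exp_type_def finite_exp_type_def by (meson zero_less_one)
  then show ?thesis using cond zero cart cond_Pi_imp(1) by blast
qed

end
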